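(* Let $\gamma\ge1$, $d\in\mathbb N$ and $a_n = n^{-\frac{2\gamma}{2\gamma+d}}$. Suppose that - $F \ge 1$, - $L_f \ge \log_2(n)\log_2(4d\vee 4\gamma)$, - $\min_{i=1,\dots,L_f}p_{f,i} \gtrsim na_n$, - $s_f \gtrsim \log(n)\, na_n$, where the constants in the asymptotic expressions depend on $\gamma,d$. Then there exist constants $C > 0$, $K \in (0,1)$ only depending on $\gamma,d,F$ such that $$\sup_{f\in C^{\gamma}([0,1]^d,K),\ \|f\|_L \le 1}\ \inf_{\tilde f\in \mathcal{R}(L_f,\mathbf{p}_f,s_f)}\|f - \tilde f\|_{\infty} \le C a_n^{1/2}.$$ Especially, for any measurable $g:\mathbb R^{d_Z} \to \mathbb R^d$, $$W_1^{\gamma}(g) \le W_{1,n}(g) + Ca_n^{1/2}.$$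
   Context: Notation: $a\gtrsim b$ means $a\ge cb$ for a suitable constant $c>0$. $X$ is a random variable with values in $[0,1]^d$, $Z$ a random variable with values in $[0,1]^{d_Z}$. Hölder classes: for $T\subset\mathbb R^r$, $\beta\ge1$, $K>0$, $C^\beta(T,K)$ is the set of $f:T\to\mathbb R$ with $\sum_{0\le|\alpha|<\beta}\|\partial^\alpha f\|_\infty+\sum_{|\alpha|=\beta-1}\sup_{x\ne y}\frac{|\partial^\alpha f(x)-\partial^\alpha f(y)|}{|x-y|_\infty}\le K$ ($\alpha$ multi-indices). $\|f\|_L$ is the Lipschitz constant of $f$ with respect to the Euclidean norm; $\|f-\tilde f\|_\infty$ is the supremum norm. Networks: $\sigma(x)=\max\{x,0\}$, $\sigma_v(x)=\sigma(x-v)$ componentwise. For $L\in\mathbb N$, $\mathbf p=(p_0,\dots,p_{L+1})\in\mathbb N^{L+2}$, $s>0$, $F>0$, $\mathcal R(L,\mathbf p,s)=\mathcal R(L,\mathbf p,s,F)$ is the set of $h:\mathbb R^{p_0}\to\mathbb R^{p_{L+1}}$ of the form $h(x)=W^{(L)}\sigma_{v^{(L)}}W^{(L-1)}\cdots W^{(1)}\sigma_{v^{(1)}}W^{(0)}x$ with $W^{(l)}\in\mathbb R^{p_{l+1}\times p_l}$, $v^{(l)}\in\mathbb R^{p_l}$, all entries bounded by 1 in absolute value, at most $s$ nonzero entries in total, and $\sup_{x\in[0,1]^{p_0}}|h(x)|_\infty\le F$. The critic class is $\mathcal R(L_f,\mathbf p_f,s_f)$ with $p_{f,0}=d$, $p_{f,L_f+1}=1$;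 its parameters may depend on $n$. $W_{1,n}(g)=\sup_{f\in\mathcal R(L_f,\mathbf p_f,s_f),\|f\|_L\le1}\{\mathbb Ef(X)-\mathbb Ef(g(Z))\}$ and $W_1^\gamma(g)=\sup_{f\in C^\gamma([0,1]^d,K),\|f\|_L\le1}\{\mathbb Ef(X)-\mathbb Ef(g(Z))\}$, the latter with the constant $K$ from the claim.
   Formalization: Proved with the extra condition s_f ≳ L_f (constant depending on γ,d), without which all networks may be constant and the claim fails; γ is an integer, as the Hölder class requires for the rate; g(Z) is assumed to lie in [0,1]^d so that f(g(Z)) is defined. *)

theory Defs
  imports "HOL-Probability.Probability"
begin

section \<open>Hoelder classes\<close>

definition unit_cube :: "(real ^ 'd) set" where
  "unit_cube = {x. \<forall>i. 0 \<le> x $ i \<and> x $ i \<le> 1}"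

text \<open>A multi-index is a function \<open>\<alpha> :: 'd \<Rightarrow> nat\<close>.\<close>

definition mi_abs :: "('d::finite \<Rightarrow> nat) \<Rightarrow> nat" where
  "mi_abs \<alpha> = (\<Sum>i\<in>UNIV. \<alpha> i)"

text \<open>The family \<open>D\<close> consists of the partial derivatives of \<open>f\<close> on \<open>T\<close> of all orders
  \<open>\<le> m\<close>. Derivatives are taken within \<open>T\<close>, so they are one-sided at boundary points of the
  cube. \<open>D \<alpha>\<close> is then determined on the cube for every \<open>\<alpha>\<close> of order at most \<open>m\<close>.\<close>

definition partial_derivs ::
  "(real ^ 'd) set \<Rightarrow> nat \<Rightarrow> (real ^ 'd \<Rightarrow> real) \<Rightarrow> (('d \<Rightarrow> nat) \<Rightarrow> real ^ 'd \<Rightarrow> real) \<Rightarrow> bool" where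
  "partial_derivs T m f D \<longleftrightarrow>
     (\<forall>x\<in>T. D (\<lambda>_. 0) x = f x) \<and>
     (\<forall>\<alpha> i. mi_abs \<alpha> < m \<longrightarrow> (\<forall>x\<in>T.
        ((\<lambda>t. D \<alpha> (x + t *\<^sub>R axis i 1)) has_real_derivative D (\<alpha>(i := Suc (\<alpha> i))) x)
          (at 0 within {t. x + t *\<^sub>R axis i 1 \<in> T})))"

text \<open>The suprema are formed in \<open>[0, \<infinity>]\<close>, so an unbounded derivative or difference quotient
  makes the norm infinite.\<close>

definition holder_norm ::
  "(real ^ 'd) set \<Rightarrow> nat \<Rightarrow> (('d \<Rightarrow> nat) \<Rightarrow> real ^ 'd \<Rightarrow> real) \<Rightarrow> ennreal" where
  "holder_norm T \<beta> D =
     (\<Sum>\<alpha> | mi_abs \<alpha> < \<beta>. SUP x\<in>T. ennreal \<bar>D \<alpha> x\<bar>) +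
     (\<Sum>\<alpha> | mi_abs \<alpha> = \<beta> - 1. SUP (x, y)\<in>{(x, y). x \<in> T \<and> y \<in> T \<and> x \<noteq> y}.
        ennreal (\<bar>D \<alpha> x - D \<alpha> y\<bar> / infnorm (x - y)))"

text \<open>The class of order \<open>\<beta> \<ge> 1\<close>. The smoothness is an integer: the top-order term ranges over
  the multi-indices with \<open>|\<alpha>| = \<beta> - 1\<close>. Only the values of \<open>f\<close> on \<open>T\<close> matter.\<close>

definition holder_class :: "(real ^ 'd) set \<Rightarrow> nat \<Rightarrow> real \<Rightarrow> (real ^ 'd \<Rightarrow> real) set" where
  "holder_class T \<beta> K =
     {f. \<exists>D. partial_derivs T (\<beta> - 1) f D \<and> holder_norm T \<beta> D \<le> ennreal K}"

definition holder_lip1 :: "nat \<Rightarrow> real \<Rightarrow> (real ^ 'd \<Rightarrow> real) set" where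
  "holder_lip1 \<gamma> K = {f \<in> holder_class unit_cube \<gamma> K. 1-lipschitz_on unit_cube f}"

section \<open>Sparse ReLU networks\<close>

text \<open>Since the layer widths \<open>p 0, \<dots>, p (L + 1)\<close> vary, a vector of length \<open>k\<close> is a function
  \<open>nat \<Rightarrow> real\<close> of which only the entries \<open>i < k\<close> are used. \<open>W l i j\<close> is the entry \<open>(i, j)\<close> of the
  \<open>p (l + 1) \<times> p l\<close> matrix of layer \<open>l\<close>, and \<open>v l\<close> is the shift applied in hidden layer \<open>l\<close>
  (\<open>1 \<le> l \<le> L\<close>). The network with \<open>L\<close> hidden layers is \<open>net p W v L\<close>.\<close>

primrec net ::
  "(nat \<Rightarrow> nat) \<Rightarrow> (nat \<Rightarrow> nat \<Rightarrow> nat \<Rightarrow> real) \<Rightarrow> (nat \<Rightarrow> nat \<Rightarrow> real) \<Rightarrow>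
   nat \<Rightarrow> (nat \<Rightarrow> real) \<Rightarrow> nat \<Rightarrow> real" where
  "net p W v 0 x = (\<lambda>i. \<Sum>j<p 0. W 0 i j * x j)"
| "net p W v (Suc l) x =
     (\<lambda>i. \<Sum>j<p (Suc l). W (Suc l) i j * max (net p W v l x j - v (Suc l) j) 0)"

definition weights_bounded ::
  "nat \<Rightarrow> (nat \<Rightarrow> nat) \<Rightarrow> (nat \<Rightarrow> nat \<Rightarrow> nat \<Rightarrow> real) \<Rightarrow> (nat \<Rightarrow> nat \<Rightarrow> real) \<Rightarrow> bool" where
  "weights_bounded L p W v \<longleftrightarrow>
     (\<forall>l\<le>L. \<forall>i<p (Suc l). \<forall>j<p l. \<bar>W l i j\<bar> \<le> 1) \<and> (\<forall>l\<in>{1..L}. \<forall>j<p l. \<bar>v l j\<bar> \<le> 1)"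

definition num_nonzero ::
  "nat \<Rightarrow> (nat \<Rightarrow> nat) \<Rightarrow> (nat \<Rightarrow> nat \<Rightarrow> nat \<Rightarrow> real) \<Rightarrow> (nat \<Rightarrow> nat \<Rightarrow> real) \<Rightarrow> nat" where
  "num_nonzero L p W v =
     card {(l, i, j). l \<le> L \<and> i < p (Suc l) \<and> j < p l \<and> W l i j \<noteq> 0} +
     card {(l, j). l \<in> {1..L} \<and> j < p l \<and> v l j \<noteq> 0}"

text \<open>Every layer matrix of a nonconstant network has a nonzero entry. Hence the class contains
  only constant functions (on the components \<open>i < p (L + 1)\<close>) if \<open>s < L + 1\<close>.\<close>

definition relu_nets ::
  "nat \<Rightarrow> (nat \<Rightarrow> nat) \<Rightarrow> real \<Rightarrow> real \<Rightarrow> ((nat \<Rightarrow> real) \<Rightarrow> nat \<Rightarrow> real) set" where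
  "relu_nets L p s F =
     {net p W v L | W v.
        weights_bounded L p W v \<and> real (num_nonzero L p W v) \<le> s \<and>
        (\<forall>x. (\<forall>j<p 0. 0 \<le> x j \<and> x j \<le> 1) \<longrightarrow> (\<forall>i<p (Suc L). \<bar>net p W v L x i\<bar> \<le> F))}"

text \<open>The networks with \<open>p 0 = CARD('d)\<close> and \<open>p (L + 1) = 1\<close>, as functions on \<open>real ^ 'd\<close>. The
  coordinates are listed by \<open>from_nat_into UNIV\<close>, a bijection from \<open>{..<CARD('d)}\<close> onto \<open>'d\<close>;
  the class does not depend on the choice of this bijection.\<close>

definition critics :: "nat \<Rightarrow> (nat \<Rightarrow> nat) \<Rightarrow> real \<Rightarrow> real \<Rightarrow> (real ^ 'd \<Rightarrow> real) set" where
  "critics L p s F = (\<lambda>h x. h (\<lambda>i. x $ from_nat_into UNIV i) 0) ` relu_nets L p s F"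

section \<open>Distances\<close>

definition rate :: "nat \<Rightarrow> nat \<Rightarrow> nat \<Rightarrow> real" where
  "rate \<gamma> d n = real n powr (- (2 * real \<gamma> / (2 * real \<gamma> + real d)))"

text \<open>A vector in the space of \<open>Z\<close> is an element of \<open>{..<dZ} \<rightarrow>\<^sub>E UNIV\<close>, with the product Borel
  \<open>\<sigma>\<close>-algebra, so that \<open>dZ\<close> can be quantified inside a formula.\<close>

abbreviation vec_space :: "nat \<Rightarrow> (nat \<Rightarrow> real) measure" where
  "vec_space k \<equiv> (\<Pi>\<^sub>M i\<in>{..<k}. borel)"

definition W1n ::
  "'w measure \<Rightarrow> ('w \<Rightarrow> real ^ 'd) \<Rightarrow> ('w \<Rightarrow> 'z) \<Rightarrow>
   nat \<Rightarrow> (nat \<Rightarrow> nat) \<Rightarrow> real \<Rightarrow> real \<Rightarrow> ('z \<Rightarrow> real ^ 'd) \<Rightarrow> real" where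
  "W1n M X Z L p s F g =
     (SUP f\<in>{f \<in> critics L p s F. 1-lipschitz_on UNIV f}.
        (\<integral>\<omega>. f (X \<omega>) \<partial>M) - (\<integral>\<omega>. f (g (Z \<omega>)) \<partial>M))"

definition W1_holder ::
  "'w measure \<Rightarrow> ('w \<Rightarrow> real ^ 'd) \<Rightarrow> ('w \<Rightarrow> 'z) \<Rightarrow>
   nat \<Rightarrow> real \<Rightarrow> ('z \<Rightarrow> real ^ 'd) \<Rightarrow> real" where
  "W1_holder M X Z \<gamma> K g =
     (SUP f\<in>holder_lip1 \<gamma> K. (\<integral>\<omega>. f (X \<omega>) \<partial>M) - (\<integral>\<omega>. f (g (Z \<omega>)) \<partial>M))"

end

theory Submission
  imports Defs
begin

text \<open>Take the grid of mesh \<open>2 ^ -k\<close> with \<open>2 ^ k\<close> about \<open>n powr (1 / (2 * \<gamma> + d))\<close>. Around each grid point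
  replace \<open>f\<close> by its Taylor polynomial of degree \<open>\<gamma> - 1\<close> and blend these polynomials by tensor products
  of hat functions; the error is \<open>O(K * 2 ^ -(k * \<gamma>))\<close>. After rescaling, the blend is a linear combination,
  with coefficients at most \<open>K * 2 ^ \<gamma>\<close>, of products of univariate functions with values in \<open>[0, 1]\<close>.
  A binary tree of approximate multiplications computes each product, using
  \<open>x y = ((x + y) / 2)\<^sup>2 - ((x - y) / 2)\<^sup>2\<close> and Yarotsky's sawtooth approximation of the square. The
  error \<open>e m w\<close> of the latter satisfies \<open>e (m + 1) w = e m (tent w) / 4\<close>, so it is of size \<open>4 ^ -m\<close> with
  Lipschitz constant \<open>2 ^ -m\<close>.

  The critics have to be 1-Lipschitz. The hat functions have slope \<open>2 ^ k\<close>, but they sum to one, so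
  the blend is \<open>O(K)\<close>-Lipschitz, and for \<open>m = k * \<gamma>\<close> the slope is compensated by the factor \<open>2 ^ -m\<close> in
  the error of the multiplications. Hence the network is \<open>O(K)\<close>-Lipschitz, uniformly in \<open>n\<close>, and a
  small \<open>K\<close> makes it a critic. Clipping the inputs to the cube makes the bound global.\<close>

section \<open>Approximate multiplication\<close>

text \<open>\<open>W1n\<close> ranges only over 1-Lipschitz networks, so uniform closeness alone
  does not let a network replace \<open>f\<close> in the second claim. Two restrictions of the class
  shape the construction. All weights are at most 1, so a slope \<open>2 ^ k\<close> has to be built
  up by \<open>k\<close> doubling layers; and the sparsity budget leaves O(log n) nonzero parameters
  for each of the O(n a_n) products. Summing over the whole grid would multiply every error by a
  number of order n a_n. This is avoided because \<open>approx_mult\<close> vanishes exactly when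
  one factor does: a product is zero off the support of its hat functions, so at most 2^d grid
  points contribute at a point of the cube. The depth condition is the depth of the tree: each of
  \<open>\<kappa>\<close> levels costs \<open>k * \<gamma> + 3\<close> layers, where k (2 \<gamma> +
  d) is at most log_2 n and \<open>\<kappa>\<close> at most log_2 max(4d, 4\<gamma>). As
  \<open>L\<close> has no upper bound, the network is padded by identity layers at six parameters
  each; hence \<open>s\<close> has to dominate a multiple of \<open>L\<close>.\<close>

definition tent :: "real \<Rightarrow> real" where
  "tent w = 1 - \<bar>2 * w - 1\<bar>"

text \<open>On [0, 1] this is the piecewise linear interpolation of the square at the multiples of
  \<open>2 ^ -m\<close>; each further sawtooth corrects the midpoints.\<close>

definition sq :: "nat \<Rightarrow> real \<Rightarrow> real" where
  "sq m w = w - (\<Sum>r<m. (tent ^^ Suc r) w / 4 ^ Suc r)"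

text \<open>For factors in [0, 1] both arguments of \<open>sq\<close> stay in [0, 1], and they
  coincide when one factor is 0.\<close>

definition approx_mult :: "nat \<Rightarrow> real \<Rightarrow> real \<Rightarrow> real" where
  "approx_mult m x y = sq m ((x + y) / 2) - sq m (\<bar>x - y\<bar> / 2)"

primrec ptree :: "nat \<Rightarrow> nat \<Rightarrow> real list \<Rightarrow> real" where
  "ptree m 0 as = hd as"
| "ptree m (Suc k) as = approx_mult m (ptree m k (take (2 ^ k) as)) (ptree m k (drop (2 ^ k) as))"

lemma tent_range: "w \<in> {0..1} \<Longrightarrow> tent w \<in> {0..1}"
  by (auto simp: tent_def abs_if)

lemma tent_lipschitz: "\<bar>tent x - tent y\<bar> \<le> 2 * \<bar>x - y\<bar>"
  by (auto simp: tent_def abs_if)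

lemma tent_iter_range: "w \<in> {0..1} \<Longrightarrow> (tent ^^ r) w \<in> {0..1}"
  using tent_range by (induction r) auto

lemma sq_0: "sq 0 w = w"
  by (simp add: sq_def)

lemma sq_Suc: "sq (Suc m) w = w - tent w / 2 + sq m (tent w) / 4"
proof -
  have "(\<Sum>r<Suc m. (tent ^^ Suc r) w / 4 ^ Suc r)
      = tent w / 4 + (\<Sum>r<m. (tent ^^ Suc r) (tent w) / 4 ^ Suc r) / 4"
    by (subst sum.lessThan_Suc_shift) (simp add: funpow_swap1 sum_divide_distrib)
  then show ?thesis
    by (simp add: sq_def field_simps)
qed

lemma sq_error_Suc: "sq (Suc m) w - w\<^sup>2 = (sq m (tent w) - (tent w)\<^sup>2) / 4"
proof -
  \<comment> \<open>The exact square satisfies the same recursion as \<open>sq\<close>, so the error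
    is divided by 4 without an additional term.\<close>
  have "w - tent w / 2 + (tent w)\<^sup>2 / 4 = w\<^sup>2"
    by (cases "2 * w \<le> 1") (auto simp: tent_def power2_eq_square field_simps)
  then show ?thesis
    unfolding sq_Suc by (simp add: field_simps)
qed

lemma sq_error_bounds:
  assumes "w \<in> {0..1}"
  shows "0 \<le> sq m w - w\<^sup>2 \<and> sq m w - w\<^sup>2 \<le> 1 / 4 ^ m"
  using assms
proof (induction m arbitrary: w)
  case 0
  then have "w * w \<le> 1 * w" by (intro mult_right_mono) auto
  moreover have "w \<le> 1 + w * w"
    using 0 by (auto intro: order_trans[of w 1])
  ultimately show ?case by (simp add: sq_0 power2_eq_square)
next
  case (Suc m)
  from Suc.IH[OF tent_range[OF Suc.prems]] show ?case
    unfolding sq_error_Suc by (auto simp: field_simps)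
qed

lemma sq_error_lipschitz:
  assumes "x \<in> {0..1}" "y \<in> {0..1}"
  shows "\<bar>(sq m x - x\<^sup>2) - (sq m y - y\<^sup>2)\<bar> \<le> \<bar>x - y\<bar> / 2 ^ m"
  using assms
proof (induction m arbitrary: x y)
  case 0
  have "(x - x\<^sup>2) - (y - y\<^sup>2) = (x - y) * (1 - (x + y))"
    by (simp add: power2_eq_square algebra_simps)
  also have "\<bar>\<dots>\<bar> \<le> \<bar>x - y\<bar> * 1"
    unfolding abs_mult using 0 by (intro mult_left_mono) auto
  finally show ?case by (simp add: sq_0)
next
  case (Suc m)
  have "\<bar>(sq m (tent x) - (tent x)\<^sup>2) - (sq m (tent y) - (tent y)\<^sup>2)\<bar> \<le> \<bar>tent x - tent y\<bar> / 2 ^ m"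
    using Suc.IH Suc.prems tent_range by blast
  also have "\<dots> \<le> 2 * \<bar>x - y\<bar> / 2 ^ m"
    by (intro divide_right_mono tent_lipschitz) auto
  finally have "\<bar>(sq m (tent x) - (tent x)\<^sup>2) / 4 - (sq m (tent y) - (tent y)\<^sup>2) / 4\<bar>
      \<le> (2 * \<bar>x - y\<bar> / 2 ^ m) / 4"
    unfolding diff_divide_distrib[symmetric] abs_divide by (simp add: divide_right_mono)
  then show ?case
    unfolding sq_error_Suc by (simp add: field_simps)
qed

text \<open>Monotonicity keeps \<open>approx_mult\<close> in [0, 1]. On the left half
  \<open>sq (Suc m)\<close> is a rescaled \<open>sq m\<close>. On the right half the tent decreases
  and the induction hypothesis has the wrong sign; there the Lipschitz bound of the error limits the
  slope of \<open>sq m\<close>, whose contribution is then at most the slope 2 of the linear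
  part.\<close>

lemma sq_mono:
  assumes "0 \<le> x" "x \<le> y" "y \<le> 1"
  shows "sq m x \<le> sq m y"
  using assms
proof (induction m arbitrary: x y)
  case 0
  then show ?case by (simp add: sq_0)
next
  case (Suc m)
  have low: "sq (Suc m) u \<le> sq (Suc m) v" if "0 \<le> u" "u \<le> v" "v \<le> 1/2" for u v
  proof -
    have "tent u = 2 * u" "tent v = 2 * v" using that by (auto simp: tent_def abs_if)
    with Suc.IH[of "2 * u" "2 * v"] that show ?thesis by (simp add: sq_Suc)
  qed
  have high: "sq (Suc m) u \<le> sq (Suc m) v" if "1/2 \<le> u" "u \<le> v" "v \<le> 1" for u v
  proof -
    define p q where "p = 2 - 2 * u" and "q = 2 - 2 * v"
    have t: "tent u = p" "tent v = q" using that by (auto simp: tent_def p_def q_def)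
    have pq: "p \<in> {0..1}" "q \<in> {0..1}" "q \<le> p" using that by (auto simp: p_def q_def)
    have "\<bar>(sq m p - p\<^sup>2) - (sq m q - q\<^sup>2)\<bar> \<le> \<bar>p - q\<bar> / 2 ^ m"
      by (rule sq_error_lipschitz) (use pq in auto)
    also have "\<dots> \<le> \<bar>p - q\<bar>" by (simp add: divide_le_eq mult_le_cancel_left1)
    finally have "sq m p - sq m q \<le> (p - q) + (p\<^sup>2 - q\<^sup>2)" using pq by linarith
    also have "p\<^sup>2 - q\<^sup>2 = (p - q) * (p + q)" by (simp add: power2_eq_square algebra_simps)
    also have "(p - q) + (p - q) * (p + q) \<le> (p - q) + (p - q) * 2"
      using pq by (intro add_left_mono mult_left_mono) auto
    finally have "sq m p - sq m q \<le> 4 * (p - q)" using pq by (simp add: algebra_simps)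
    then have "u - p / 2 + sq m p / 4 \<le> v - q / 2 + sq m q / 4"
      using that unfolding p_def q_def by (simp add: field_simps)
    then show ?thesis by (simp add: sq_Suc t)
  qed
  show ?case
  proof (cases "y \<le> 1/2 \<or> 1/2 \<le> x")
    case True
    then show ?thesis using low high Suc.prems by blast
  next
    case False
    then show ?thesis using low[of x "1/2"] high[of "1/2" y] Suc.prems by linarith
  qed
qed

lemma sq_1_le: "sq m 1 \<le> 1"
proof -
  have "0 \<le> (tent ^^ Suc r) 1" for r
    using tent_iter_range[of 1 "Suc r"] by (simp del: funpow.simps)
  then show ?thesis
    by (simp add: sq_def sum_nonneg del: funpow.simps)
qed

lemma sq_nonneg: "w \<in> {0..1} \<Longrightarrow> 0 \<le> sq m w"
  using sq_error_bounds[of w m] zero_le_power2[of w] by linarith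

text \<open>Exact vanishing, not merely a small error: it propagates through the tree and keeps
  every approximate product inside the support of its hat functions.\<close>

lemma approx_mult_zero: "approx_mult m 0 y = 0" "approx_mult m x 0 = 0" if "0 \<le> x" "0 \<le> y"
  using that by (auto simp: approx_mult_def)

lemma approx_mult_range:
  assumes "x \<in> {0..1}" "y \<in> {0..1}"
  shows "approx_mult m x y \<in> {0..1}"
proof -
  have "sq m (\<bar>x - y\<bar> / 2) \<le> sq m ((x + y) / 2)" "sq m ((x + y) / 2) \<le> sq m 1"
    by (rule sq_mono; use assms in auto)+
  moreover have "0 \<le> sq m (\<bar>x - y\<bar> / 2)"
    by (rule sq_nonneg) (use assms in auto)
  ultimately show ?thesis
    using sq_1_le[of m] by (auto simp: approx_mult_def)
qed

lemma approx_mult_error_eq: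
  "approx_mult m x y - x * y
     = (sq m ((x + y) / 2) - ((x + y) / 2)\<^sup>2) - (sq m (\<bar>x - y\<bar> / 2) - (\<bar>x - y\<bar> / 2)\<^sup>2)"
proof -
  have "((x + y) / 2)\<^sup>2 - (\<bar>x - y\<bar> / 2)\<^sup>2 = x * y"
    by (simp add: power_divide power2_eq_square field_simps)
  then show ?thesis by (simp add: approx_mult_def)
qed

text \<open>Both errors of the squares have the same sign, so their difference does not double the
  bound.\<close>

lemma approx_mult_error:
  assumes "x \<in> {0..1}" "y \<in> {0..1}"
  shows "\<bar>approx_mult m x y - x * y\<bar> \<le> 1 / 4 ^ m"
proof -
  have "(x + y) / 2 \<in> {0..1}" "\<bar>x - y\<bar> / 2 \<in> {0..1}"
    using assms by auto
  from this[THEN sq_error_bounds, of m] show ?thesis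
    unfolding approx_mult_error_eq by linarith
qed

lemma approx_mult_error_lipschitz:
  assumes "x \<in> {0..1}" "y \<in> {0..1}" "x' \<in> {0..1}" "y' \<in> {0..1}"
  shows "\<bar>(approx_mult m x y - x * y) - (approx_mult m x' y' - x' * y')\<bar> \<le> (\<bar>x - x'\<bar> + \<bar>y - y'\<bar>) / 2 ^ m"
proof -
  let ?e = "\<lambda>w. sq m w - w\<^sup>2"
  have half: "\<bar>(x + y) / 2 - (x' + y') / 2\<bar> \<le> (\<bar>x - x'\<bar> + \<bar>y - y'\<bar>) / 2"
    "\<bar>\<bar>x - y\<bar> / 2 - \<bar>x' - y'\<bar> / 2\<bar> \<le> (\<bar>x - x'\<bar> + \<bar>y - y'\<bar>) / 2"
    by (simp_all add: abs_if field_simps)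
  have "\<bar>?e ((x + y) / 2) - ?e ((x' + y') / 2)\<bar> \<le> \<bar>(x + y) / 2 - (x' + y') / 2\<bar> / 2 ^ m"
    by (rule sq_error_lipschitz) (use assms in auto)
  also have "\<dots> \<le> ((\<bar>x - x'\<bar> + \<bar>y - y'\<bar>) / 2) / 2 ^ m"
    by (intro divide_right_mono half) simp
  finally have 1: "\<bar>?e ((x + y) / 2) - ?e ((x' + y') / 2)\<bar> \<le> ((\<bar>x - x'\<bar> + \<bar>y - y'\<bar>) / 2) / 2 ^ m" .
  have "\<bar>?e (\<bar>x - y\<bar> / 2) - ?e (\<bar>x' - y'\<bar> / 2)\<bar> \<le> \<bar>\<bar>x - y\<bar> / 2 - \<bar>x' - y'\<bar> / 2\<bar> / 2 ^ m"
    by (rule sq_error_lipschitz) (use assms in auto)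
  also have "\<dots> \<le> ((\<bar>x - x'\<bar> + \<bar>y - y'\<bar>) / 2) / 2 ^ m"
    by (intro divide_right_mono half) simp
  finally have 2: "\<bar>?e (\<bar>x - y\<bar> / 2) - ?e (\<bar>x' - y'\<bar> / 2)\<bar> \<le> ((\<bar>x - x'\<bar> + \<bar>y - y'\<bar>) / 2) / 2 ^ m" .
  have "(\<bar>x - x'\<bar> + \<bar>y - y'\<bar>) / 2 ^ m = 2 * (((\<bar>x - x'\<bar> + \<bar>y - y'\<bar>) / 2) / 2 ^ m)"
    by (simp add: field_simps)
  with 1 2 show ?thesis
    unfolding approx_mult_error_eq by linarith
qed

section \<open>Products of \<open>2 ^ k\<close> numbers by a binary tree\<close>

lemma length_halves:
  assumes "length as = 2 ^ Suc k"
  shows "length (take (2 ^ k) as) = 2 ^ k" "length (drop (2 ^ k) as) = 2 ^ k"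
  using assms by simp_all

lemma prod_list_halves: "prod_list as = prod_list (take n as) * prod_list (drop n (as :: real list))"
  by (metis append_take_drop_id prod_list.append)

lemma prod_list_unit: "set as \<subseteq> {0..1} \<Longrightarrow> prod_list as \<in> {0..1 :: real}"
  by (induction as) (auto intro: mult_le_one)

lemma ptree_range:
  assumes "length as = 2 ^ k" "set as \<subseteq> {0..1}"
  shows "ptree m k as \<in> {0..1}"
  using assms
proof (induction k arbitrary: as)
  case 0
  then show ?case by (cases as) auto
next
  case (Suc k)
  have "set (take (2 ^ k) as) \<subseteq> {0..1}" "set (drop (2 ^ k) as) \<subseteq> {0..1}"
    using Suc.prems(2) set_take_subset set_drop_subset by (metis order_trans)+
  then show ?case
    unfolding ptree.simps using Suc.IH length_halves[OF Suc.prems(1)] by (intro approx_mult_range)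
qed

lemma ptree_zero:
  assumes "length as = 2 ^ k" "set as \<subseteq> {0..1}" "0 \<in> set as"
  shows "ptree m k as = 0"
  using assms
proof (induction k arbitrary: as)
  case 0
  then show ?case by (cases as) auto
next
  case (Suc k)
  note len = length_halves[OF Suc.prems(1)]
  have sub: "set (take (2 ^ k) as) \<subseteq> {0..1}" "set (drop (2 ^ k) as) \<subseteq> {0..1}"
    using Suc.prems(2) set_take_subset set_drop_subset by (metis order_trans)+
  have "0 \<le> ptree m k (take (2 ^ k) as)" "0 \<le> ptree m k (drop (2 ^ k) as)"
    using ptree_range len sub by fastforce+
  moreover have "0 \<in> set (take (2 ^ k) as) \<or> 0 \<in> set (drop (2 ^ k) as)"
    using Suc.prems(3) by (metis Un_iff append_take_drop_id set_append)
  ultimately show ?case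
    unfolding ptree.simps using Suc.IH len sub approx_mult_zero by metis
qed

text \<open>The tree has \<open>2 ^ k - 1\<close> inner nodes. Each adds at most
  \<open>1 / 4 ^ m\<close>, and multiplication by numbers in [0, 1] does not amplify the errors from
  below.\<close>

lemma ptree_error:
  assumes "length as = 2 ^ k" "set as \<subseteq> {0..1}"
  shows "\<bar>ptree m k as - prod_list as\<bar> \<le> (2 ^ k - 1) / 4 ^ m"
  using assms
proof (induction k arbitrary: as)
  case 0
  then show ?case by (cases as) auto
next
  case (Suc k)
  note len = length_halves[OF Suc.prems(1)]
  have sub: "set (take (2 ^ k) as) \<subseteq> {0..1}" "set (drop (2 ^ k) as) \<subseteq> {0..1}"
    using Suc.prems(2) set_take_subset set_drop_subset by (metis order_trans)+
  define a b \<alpha> \<beta> where ab: "a = ptree m k (take (2 ^ k) as)" "b = ptree m k (drop (2 ^ k) as)"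
    "\<alpha> = prod_list (take (2 ^ k) as)" "\<beta> = prod_list (drop (2 ^ k) as)"
  have r: "a \<in> {0..1}" "b \<in> {0..1}" "\<alpha> \<in> {0..1}" "\<beta> \<in> {0..1}"
    unfolding ab using ptree_range len sub prod_list_unit by blast+
  have e: "\<bar>a - \<alpha>\<bar> \<le> (2 ^ k - 1) / 4 ^ m" "\<bar>b - \<beta>\<bar> \<le> (2 ^ k - 1) / 4 ^ m"
    unfolding ab using Suc.IH len sub by blast+
  have "\<bar>approx_mult m a b - \<alpha> * \<beta>\<bar> = \<bar>(approx_mult m a b - a * b) + (a - \<alpha>) * b + \<alpha> * (b - \<beta>)\<bar>"
    by (simp add: algebra_simps)
  also have "\<dots> \<le> \<bar>approx_mult m a b - a * b\<bar> + \<bar>(a - \<alpha>) * b\<bar> + \<bar>\<alpha> * (b - \<beta>)\<bar>"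
    by (intro order_trans[OF abs_triangle_ineq] add_mono order_refl)
  also have "\<dots> \<le> 1 / 4 ^ m + (2 ^ k - 1) / 4 ^ m * 1 + 1 * ((2 ^ k - 1) / 4 ^ m)"
    unfolding abs_mult by (intro add_mono mult_mono approx_mult_error r e) (use r in auto)
  also have "\<dots> = (2 ^ Suc k - 1) / 4 ^ m"
    by (simp add: field_simps)
  finally show ?case
    unfolding ptree.simps prod_list_halves[of as "2 ^ k"] ab .
qed

lemma prod_list_diff:
  assumes "length as = length bs" "set as \<subseteq> {0..1}" "set bs \<subseteq> {0..1}"
    "\<And>i. i < length as \<Longrightarrow> \<bar>as ! i - bs ! i\<bar> \<le> \<delta>"
  shows "\<bar>prod_list as - prod_list bs\<bar> \<le> real (length as) * \<delta>"
  using assms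
proof (induction as bs rule: list_induct2)
  case Nil
  then show ?case by simp
next
  case (Cons a as b bs)
  have IH: "\<bar>prod_list as - prod_list bs\<bar> \<le> real (length as) * \<delta>"
  proof (rule Cons.IH)
    show "\<bar>as ! i - bs ! i\<bar> \<le> \<delta>" if "i < length as" for i
      using Cons.prems(3)[of "Suc i"] that by simp
  qed (use Cons.prems in auto)
  have "\<bar>a * prod_list as - b * prod_list bs\<bar>
      = \<bar>(a - b) * prod_list as + b * (prod_list as - prod_list bs)\<bar>"
    by (simp add: algebra_simps)
  also have "\<dots> \<le> \<bar>a - b\<bar> * \<bar>prod_list as\<bar> + \<bar>b\<bar> * \<bar>prod_list as - prod_list bs\<bar>"
    unfolding abs_mult[symmetric] by (intro order_trans[OF abs_triangle_ineq] add_mono order_refl)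
  also have "\<dots> \<le> \<delta> * 1 + 1 * (real (length as) * \<delta>)"
    using prod_list_unit[of as] Cons.prems(1,2) Cons.prems(3)[of 0] IH
    by (intro add_mono mult_mono) auto
  finally show ?case by (simp add: algebra_simps)
qed

text \<open>The recursion collects, rounded up, the terms of the estimate in
  \<open>ptree_error_lipschitz\<close>. What matters is that \<open>m\<close> does not
  occur.\<close>

primrec ptree_lip :: "nat \<Rightarrow> real" where
  "ptree_lip 0 = 0"
| "ptree_lip (Suc k) = 4 * 2 ^ k + 4 * ptree_lip k + 2 ^ k * (2 ^ k + ptree_lip k) + 2 ^ k * 2 ^ k"

lemma ptree_lip_nonneg: "0 \<le> ptree_lip k"
  by (induction k) auto

text \<open>The error is compared at two inputs, rather than the tree itself, because only the error
  carries the factor \<open>2 ^ -m\<close> that later absorbs the slope \<open>2 ^ k\<close> of the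
  inputs.\<close>

lemma ptree_error_lipschitz:
  assumes "length as = 2 ^ k" "length bs = 2 ^ k" "set as \<subseteq> {0..1}" "set bs \<subseteq> {0..1}"
    and "\<And>i. i < 2 ^ k \<Longrightarrow> \<bar>as ! i - bs ! i\<bar> \<le> \<delta>"
  shows "\<bar>(ptree m k as - prod_list as) - (ptree m k bs - prod_list bs)\<bar> \<le> ptree_lip k * \<delta> / 2 ^ m"
  using assms
proof (induction k arbitrary: as bs)
  case 0
  then show ?case by (cases as; cases bs) auto
next
  case (Suc k)
  note len = length_halves[OF Suc.prems(1)] length_halves[OF Suc.prems(2)]
  have sub: "set (take (2 ^ k) as) \<subseteq> {0..1}" "set (drop (2 ^ k) as) \<subseteq> {0..1}"
    "set (take (2 ^ k) bs) \<subseteq> {0..1}" "set (drop (2 ^ k) bs) \<subseteq> {0..1}"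
    using Suc.prems(3,4) set_take_subset set_drop_subset by (metis order_trans)+
  have d: "\<And>i. i < 2 ^ k \<Longrightarrow> \<bar>take (2 ^ k) as ! i - take (2 ^ k) bs ! i\<bar> \<le> \<delta>"
    "\<And>i. i < 2 ^ k \<Longrightarrow> \<bar>drop (2 ^ k) as ! i - drop (2 ^ k) bs ! i\<bar> \<le> \<delta>"
    using Suc.prems(1,2,5) by auto
  have \<delta>: "0 \<le> \<delta>" using Suc.prems(5)[of 0] by auto
  define a1 a2 \<alpha>1 \<alpha>2 where a: "a1 = ptree m k (take (2 ^ k) as)" "a2 = ptree m k (drop (2 ^ k) as)"
    "\<alpha>1 = prod_list (take (2 ^ k) as)" "\<alpha>2 = prod_list (drop (2 ^ k) as)"
  define b1 b2 \<beta>1 \<beta>2 where b: "b1 = ptree m k (take (2 ^ k) bs)" "b2 = ptree m k (drop (2 ^ k) bs)"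
    "\<beta>1 = prod_list (take (2 ^ k) bs)" "\<beta>2 = prod_list (drop (2 ^ k) bs)"
  define \<eta> :: real where "\<eta> = 1 / 2 ^ m"
  define c where "c = ptree_lip k"
  have \<eta>: "0 \<le> \<eta>" "\<eta> \<le> 1" by (simp_all add: \<eta>_def)
  have c: "0 \<le> c" unfolding c_def by (rule ptree_lip_nonneg)
  have r: "a1 \<in> {0..1}" "a2 \<in> {0..1}" "\<alpha>1 \<in> {0..1}" "\<alpha>2 \<in> {0..1}"
    "b1 \<in> {0..1}" "b2 \<in> {0..1}" "\<beta>1 \<in> {0..1}" "\<beta>2 \<in> {0..1}"
    unfolding a b using ptree_range len sub prod_list_unit by blast+
  have e: "\<bar>(a1 - \<alpha>1) - (b1 - \<beta>1)\<bar> \<le> c * \<delta> * \<eta>" "\<bar>(a2 - \<alpha>2) - (b2 - \<beta>2)\<bar> \<le> c * \<delta> * \<eta>"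
    using Suc.IH[OF len(1,3) sub(1,3) d(1)] Suc.IH[OF len(2,4) sub(2,4) d(2)]
    by (simp_all add: a b c_def \<eta>_def)
  have p: "\<bar>\<alpha>1 - \<beta>1\<bar> \<le> 2 ^ k * \<delta>" "\<bar>\<alpha>2 - \<beta>2\<bar> \<le> 2 ^ k * \<delta>"
    using prod_list_diff[OF _ sub(1,3), of \<delta>] prod_list_diff[OF _ sub(2,4), of \<delta>] len d
    by (simp_all add: a b)
  have "(2 ^ k - 1) / 4 ^ m \<le> 2 ^ k * \<eta>"
    unfolding \<eta>_def by (simp add: power_mono frac_le)
  then have q: "\<bar>b1 - \<beta>1\<bar> \<le> 2 ^ k * \<eta>" "\<bar>b2 - \<beta>2\<bar> \<le> 2 ^ k * \<eta>"
    using ptree_error[OF len(3) sub(3), of m] ptree_error[OF len(4) sub(4), of m]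
    unfolding b by linarith+
  have "c * \<delta> * \<eta> \<le> c * \<delta>" using c \<delta> \<eta> by (simp add: mult_left_le)
  then have "\<bar>a1 - b1\<bar> \<le> 2 ^ k * \<delta> + c * \<delta>" "\<bar>a2 - b2\<bar> \<le> 2 ^ k * \<delta> + c * \<delta>"
    using e p abs_triangle_ineq[of "(a1 - \<alpha>1) - (b1 - \<beta>1)" "\<alpha>1 - \<beta>1"]
      abs_triangle_ineq[of "(a2 - \<alpha>2) - (b2 - \<beta>2)" "\<alpha>2 - \<beta>2"] by auto
  then have ab: "\<bar>a1 - b1\<bar> \<le> (2 ^ k + c) * \<delta>" "\<bar>a2 - b2\<bar> \<le> (2 ^ k + c) * \<delta>"
    by (simp_all add: distrib_right)
  \<comment> \<open>The splitting is chosen so that every summand contains an error, which yields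
    \<open>\<eta>\<close>, and a difference between the two inputs, which yields
    \<open>\<delta>\<close>, either combined in one factor or in separate ones.\<close>
  have "\<bar>(approx_mult m a1 a2 - \<alpha>1 * \<alpha>2) - (approx_mult m b1 b2 - \<beta>1 * \<beta>2)\<bar>
      = \<bar>((approx_mult m a1 a2 - a1 * a2) - (approx_mult m b1 b2 - b1 * b2))
        + ((a1 - \<alpha>1) - (b1 - \<beta>1)) * a2 + (b1 - \<beta>1) * (a2 - b2)
        + \<alpha>1 * ((a2 - \<alpha>2) - (b2 - \<beta>2)) + (\<alpha>1 - \<beta>1) * (b2 - \<beta>2)\<bar>"
    by (simp add: algebra_simps)
  also have "\<dots> \<le> \<bar>(approx_mult m a1 a2 - a1 * a2) - (approx_mult m b1 b2 - b1 * b2)\<bar>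
        + \<bar>(a1 - \<alpha>1) - (b1 - \<beta>1)\<bar> * \<bar>a2\<bar> + \<bar>b1 - \<beta>1\<bar> * \<bar>a2 - b2\<bar>
        + \<bar>\<alpha>1\<bar> * \<bar>(a2 - \<alpha>2) - (b2 - \<beta>2)\<bar> + \<bar>\<alpha>1 - \<beta>1\<bar> * \<bar>b2 - \<beta>2\<bar>"
    unfolding abs_mult[symmetric] by (intro order_trans[OF abs_triangle_ineq] add_mono order_refl)
  also have "\<dots> \<le> (\<bar>a1 - b1\<bar> + \<bar>a2 - b2\<bar>) / 2 ^ m
        + (c * \<delta> * \<eta>) * 1 + (2 ^ k * \<eta>) * ((2 ^ k + c) * \<delta>)
        + 1 * (c * \<delta> * \<eta>) + (2 ^ k * \<delta>) * (2 ^ k * \<eta>)"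
    by (intro add_mono mult_mono approx_mult_error_lipschitz r e p q ab)
      (use r \<delta> \<eta> c in simp_all)
  also have "(\<bar>a1 - b1\<bar> + \<bar>a2 - b2\<bar>) / 2 ^ m \<le> ((2 ^ k + c) * \<delta> + (2 ^ k + c) * \<delta>) * \<eta>"
    unfolding \<eta>_def using divide_right_mono[OF add_mono[OF ab], of "2 ^ m"] by simp
  also have "((2 ^ k + c) * \<delta> + (2 ^ k + c) * \<delta>) * \<eta>
        + (c * \<delta> * \<eta>) * 1 + (2 ^ k * \<eta>) * ((2 ^ k + c) * \<delta>)
        + 1 * (c * \<delta> * \<eta>) + (2 ^ k * \<delta>) * (2 ^ k * \<eta>)
      = (2 * 2 ^ k + 4 * c + 2 ^ k * (2 ^ k + c) + 2 ^ k * 2 ^ k) * (\<delta> * \<eta>)"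
    by (simp add: algebra_simps)
  also have "\<dots> \<le> ptree_lip (Suc k) * (\<delta> * \<eta>)"
    using \<delta> \<eta> by (intro mult_right_mono) (auto simp: c_def)
  finally show ?case
    unfolding ptree.simps prod_list_halves[of as "2 ^ k"] prod_list_halves[of bs "2 ^ k"] a b
    by (simp add: \<eta>_def)
qed

section \<open>Computations by sparse ReLU networks\<close>

text \<open>\<open>net\<close> never reads the width of its output layer, so a uniform inner width
  suffices; the number of outputs is tracked in \<open>net_data\<close>.\<close>

definition widths :: "nat \<Rightarrow> nat \<Rightarrow> nat \<Rightarrow> nat" where
  "widths d w a = (if a = 0 then d else w)"

text \<open>The parameters vanish outside their index ranges. A network can then be placed in wider
  layers without changing its values, and its nonzero parameters are counted without reference to
  the surrounding widths.\<close>

definition net_data ::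
  "nat \<Rightarrow> nat \<Rightarrow> nat \<Rightarrow> nat \<Rightarrow> nat \<Rightarrow> (nat \<Rightarrow> nat \<Rightarrow> nat \<Rightarrow> real) \<Rightarrow> (nat \<Rightarrow> nat \<Rightarrow> real) \<Rightarrow> bool" where
  "net_data d l w r c W v \<longleftrightarrow>
     (\<forall>a i j. \<bar>W a i j\<bar> \<le> 1) \<and> (\<forall>a j. \<bar>v a j\<bar> \<le> 1) \<and>
     (\<forall>a i j. W a i j \<noteq> 0 \<longrightarrow> a \<le> l \<and> i < (if a = l then r else w) \<and> j < widths d w a) \<and>
     (\<forall>a j. v a j \<noteq> 0 \<longrightarrow> a \<in> {1..l} \<and> j < w) \<and>
     card {(a, i, j). W a i j \<noteq> 0} + card {(a, j). v a j \<noteq> 0} \<le> c"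

lemma net_dataI:
  assumes "\<And>a i j. \<bar>W a i j\<bar> \<le> 1" "\<And>a j. \<bar>v a j\<bar> \<le> 1"
    "\<And>a i j. W a i j \<noteq> 0 \<Longrightarrow> a \<le> l \<and> i < (if a = l then r else w) \<and> j < widths d w a"
    "\<And>a j. v a j \<noteq> 0 \<Longrightarrow> a \<in> {1..l} \<and> j < w"
    "card {(a, i, j). W a i j \<noteq> 0} + card {(a, j). v a j \<noteq> 0} \<le> c"
  shows "net_data d l w r c W v"
  using assms unfolding net_data_def by blast

lemma net_dataD:
  assumes "net_data d l w r c W v"
  shows "\<bar>W a i j\<bar> \<le> 1" "\<bar>v a j\<bar> \<le> 1"
    "W a i j \<noteq> 0 \<Longrightarrow> a \<le> l \<and> i < (if a = l then r else w) \<and> j < widths d w a"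
    "v a j \<noteq> 0 \<Longrightarrow> a \<in> {1..l} \<and> j < w"
    "card {(a, i, j). W a i j \<noteq> 0} + card {(a, j). v a j \<noteq> 0} \<le> c"
  using assms unfolding net_data_def by blast+

definition coords :: "real ^ 'd \<Rightarrow> nat \<Rightarrow> real" where
  "coords x = (\<lambda>i. x $ from_nat_into UNIV i)"

text \<open>The outputs are pre-activations, so that a computation can be continued by a further layer.\<close>

definition computes :: "nat \<Rightarrow> nat \<Rightarrow> nat \<Rightarrow> (real ^ 'd \<Rightarrow> real) list \<Rightarrow> bool" where
  "computes l w c fs \<longleftrightarrow>
     (\<exists>W v. net_data CARD('d) l w (length fs) c W v \<and>
        (\<forall>x. \<forall>i<length fs. net (widths CARD('d) w) W v l (coords x) i = (fs ! i) x))"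

lemma computesI:
  fixes fs :: "(real ^ 'd \<Rightarrow> real) list"
  assumes "net_data CARD('d) l w (length fs) c W v"
    "\<And>x i. i < length fs \<Longrightarrow> net (widths CARD('d) w) W v l (coords x) i = (fs ! i) x"
  shows "computes l w c fs"
  using assms unfolding computes_def by blast

lemma finite_nonzero:
  assumes "net_data d l w r c W v"
  shows "finite {(a, i, j). W a i j \<noteq> 0}" "finite {(a, j). v a j \<noteq> 0}"
proof -
  have "{(a, i, j). W a i j \<noteq> 0} \<subseteq> {..l} \<times> {..<r + w} \<times> {..<d + w}"
  proof (rule subsetI)
    fix z assume "z \<in> {(a, i, j). W a i j \<noteq> 0}"
    then obtain a i j where z: "z = (a, i, j)" "W a i j \<noteq> 0" by auto
    note net_dataD(3)[OF assms z(2)]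
    then show "z \<in> {..l} \<times> {..<r + w} \<times> {..<d + w}"
      by (auto simp: z(1) widths_def split: if_splits)
  qed
  then show "finite {(a, i, j). W a i j \<noteq> 0}"
    by (rule finite_subset) auto
  have "{(a, j). v a j \<noteq> 0} \<subseteq> {..l} \<times> {..<w}"
    using net_dataD(4)[OF assms] by auto
  then show "finite {(a, j). v a j \<noteq> 0}"
    by (rule finite_subset) auto
qed

lemma net_widen:
  assumes "\<And>a i j. a \<le> l \<Longrightarrow> q a \<le> j \<Longrightarrow> W a i j = 0" "\<And>a. a \<le> l \<Longrightarrow> q a \<le> p a"
  shows "net p W v l x i = net q W v l x i"
  using assms
proof (induction l arbitrary: i)
  case 0
  show ?case
    unfolding net.simps using 0 by (intro sum.mono_neutral_right) (auto simp: not_less)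
next
  case (Suc l)
  have IH: "net p W v l x j = net q W v l x j" for j
    using Suc by auto
  show ?case
    unfolding net.simps IH using Suc.prems by (intro sum.mono_neutral_right) (auto simp: not_less)
qed

lemma net_data_widen:
  assumes "net_data d l w r c W v" "\<And>a. a \<le> l \<Longrightarrow> widths d w a \<le> p a"
  shows "net p W v l x i = net (widths d w) W v l x i"
proof (rule net_widen)
  show "W a i j = 0" if "widths d w a \<le> j" for a i j
    using net_dataD(3)[OF assms(1), of a i j] that by auto
qed (rule assms(2))

lemma net_cong_params:
  assumes "\<And>a. a \<le> l \<Longrightarrow> W a = W' a" "\<And>a. a \<le> l \<Longrightarrow> v a = v' a"
  shows "net p W v l x i = net p W' v' l x i"
  using assms by (induction l arbitrary: i) auto

lemma net_cong_input:
  assumes "\<And>j. j < p 0 \<Longrightarrow> x j = y j"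
  shows "net p W v l x i = net p W v l y i"
  using assms by (induction l arbitrary: i) auto

lemma net_zero: "net p (\<lambda>_ _ _. 0) v l x i = 0"
  by (cases l) auto

lemma computes_mono:
  assumes "computes l w c fs" "w \<le> w'" "c \<le> c'"
  shows "computes l w' c' fs"
proof -
  obtain W v where Wv: "net_data CARD('a) l w (length fs) c W v"
    "\<And>x i. i < length fs \<Longrightarrow> net (widths CARD('a) w) W v l (coords x) i = (fs ! i) x"
    using assms(1) unfolding computes_def by blast
  have "widths CARD('a) w a \<le> widths CARD('a) w' a" for a
    using assms(2) by (simp add: widths_def)
  note wd = this
  have "net_data CARD('a) l w' (length fs) c' W v"
  proof (intro net_dataI)
    show "a \<le> l \<and> i < (if a = l then length fs else w') \<and> j < widths CARD('a) w' a"
      if "W a i j \<noteq> 0" for a i j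
      using net_dataD(3)[OF Wv(1) that] wd[of a] assms(2) by auto
    show "a \<in> {1..l} \<and> j < w'" if "v a j \<noteq> 0" for a j
      using net_dataD(4)[OF Wv(1) that] assms(2) by auto
  qed (use net_dataD[OF Wv(1)] assms(3) in auto)
  moreover have "net (widths CARD('a) w') W v l x i = net (widths CARD('a) w) W v l x i" for x i
    using assms(2) by (intro net_data_widen[OF Wv(1)]) (auto simp: widths_def)
  ultimately show ?thesis
    using Wv(2) by (intro computesI) auto
qed

section \<open>Building blocks: inputs, additional layers, parallel networks\<close>

lemma computes_zeros: "computes l w c (replicate n (\<lambda>_. 0))"
proof -
  have "net_data CARD('a) l w n c (\<lambda>_ _ _. 0) (\<lambda>_ _. 0)"
    by (simp add: net_data_def case_prod_unfold)
  then show ?thesis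
    by (intro computesI[of _ _ _ _ "\<lambda>_ _ _. 0" "\<lambda>_ _. 0"]) (auto simp: net_zero)
qed

lemma bij_coords: "bij_betw (from_nat_into (UNIV :: 'd::finite set)) {..<CARD('d)} UNIV"
  using bij_betw_from_nat_into_finite[of "UNIV :: 'd set"] by simp

lemma computes_coords:
  fixes ks :: "'d::finite list"
  shows "computes 0 w (length ks) (map (\<lambda>i x. x $ i) ks)"
proof -
  let ?f = "from_nat_into (UNIV :: 'd set)"
  define W :: "nat \<Rightarrow> nat \<Rightarrow> nat \<Rightarrow> real" where
    "W a i j = of_bool (a = 0 \<and> i < length ks \<and> j < CARD('d) \<and> ?f j = ks ! i)" for a i j
  define g where "g = inv_into {..<CARD('d)} ?f"
  have g: "g (?f j) = j" if "j < CARD('d)" for j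
    unfolding g_def using bij_betw_imp_inj_on[OF bij_coords[where 'd = 'd]] that by (simp add: inv_into_f_f)
  have "{(a, i, j). W a i j \<noteq> 0} \<subseteq> (\<lambda>i. (0, i, g (ks ! i))) ` {..<length ks}"
  proof (rule subsetI)
    fix z assume "z \<in> {(a, i, j). W a i j \<noteq> 0}"
    then obtain a i j where z: "z = (a, i, j)" "W a i j \<noteq> 0" by auto
    then have "a = 0" "i < length ks" "j = g (ks ! i)"
      using g[of j] by (auto simp: W_def)
    then show "z \<in> (\<lambda>i. (0, i, g (ks ! i))) ` {..<length ks}" using z(1) by auto
  qed
  then have "card {(a, i, j). W a i j \<noteq> 0} \<le> card ((\<lambda>i. (0 :: nat, i, g (ks ! i))) ` {..<length ks})"
    by (intro card_mono) auto
  also have "\<dots> \<le> length ks"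
    using card_image_le[of "{..<length ks}"] by simp
  finally have "net_data CARD('d) 0 w (length ks) (length ks) W (\<lambda>_ _. 0)"
    by (auto simp: net_data_def W_def widths_def)
  moreover have "net (widths CARD('d) w) W (\<lambda>_ _. 0) 0 (coords x) i = x $ (ks ! i)"
    if "i < length ks" for x :: "real ^ 'd" and i
  proof -
    have "net (widths CARD('d) w) W (\<lambda>_ _. 0) 0 (coords x) i
        = (\<Sum>j<CARD('d). (\<lambda>k. of_bool (k = ks ! i) * x $ k) (?f j))"
      using that by (simp add: widths_def W_def coords_def)
    also have "\<dots> = (\<Sum>k\<in>UNIV. of_bool (k = ks ! i) * x $ k)"
      by (rule sum.reindex_bij_betw[OF bij_coords])
    also have "\<dots> = (\<Sum>k\<in>UNIV. if k = ks ! i then x $ k else 0)"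
      by (intro sum.cong) auto
    finally show ?thesis by simp
  qed
  ultimately show ?thesis
    by (intro computesI) auto
qed

text \<open>The previous outputs become the new hidden layer, so their number enters the width. The
  parameter count charges the whole matrix \<open>A\<close>, zero entries included.\<close>

lemma computes_layer:
  assumes fs: "computes l w c fs"
    and A: "\<And>i j. i < length gs \<Longrightarrow> j < length fs \<Longrightarrow> \<bar>A i j\<bar> \<le> 1"
    and b: "\<And>j. j < length fs \<Longrightarrow> \<bar>b j\<bar> \<le> 1"
    and gs: "\<And>i x. i < length gs \<Longrightarrow> (gs ! i) x = (\<Sum>j<length fs. A i j * max ((fs ! j) x - b j) 0)"
  shows "computes (Suc l) (max w (length fs)) (c + length gs * length fs + length fs) gs"
proof -
  let ?w = "max w (length fs)"
  obtain W v where Wv: "net_data CARD('a) l w (length fs) c W v"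
    "\<And>x i. i < length fs \<Longrightarrow> net (widths CARD('a) w) W v l (coords x) i = (fs ! i) x"
    using fs unfolding computes_def by blast
  define W' where "W' a = (if a = Suc l then (\<lambda>i j. if i < length gs \<and> j < length fs then A i j else 0) else W a)" for a
  define v' where "v' a = (if a = Suc l then (\<lambda>j. if j < length fs then b j else 0) else v a)" for a
  note fin = finite_nonzero[OF Wv(1)]
  have nd: "\<And>a i j. \<bar>W a i j\<bar> \<le> 1" "\<And>a j. \<bar>v a j\<bar> \<le> 1"
    "\<And>a i j. W a i j \<noteq> 0 \<Longrightarrow> a \<le> l \<and> i < (if a = l then length fs else w) \<and> j < widths CARD('a) w a"
    "\<And>a j. v a j \<noteq> 0 \<Longrightarrow> a \<in> {1..l} \<and> j < w"
    "card {(a, i, j). W a i j \<noteq> 0} + card {(a, j). v a j \<noteq> 0} \<le> c"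
    using net_dataD[OF Wv(1)] by blast+
  have "{(a, i, j). W' a i j \<noteq> 0} \<subseteq> {(a, i, j). W a i j \<noteq> 0} \<union> {Suc l} \<times> {..<length gs} \<times> {..<length fs}"
    by (auto simp: W'_def split: if_splits)
  then have "card {(a, i, j). W' a i j \<noteq> 0}
      \<le> card ({(a, i, j). W a i j \<noteq> 0} \<union> {Suc l} \<times> {..<length gs} \<times> {..<length fs})"
    using fin by (intro card_mono) auto
  also have "\<dots> \<le> card {(a, i, j). W a i j \<noteq> 0} + length gs * length fs"
    by (rule order_trans[OF card_Un_le]) (simp add: card_cartesian_product)
  finally have cW: "card {(a, i, j). W' a i j \<noteq> 0} \<le> card {(a, i, j). W a i j \<noteq> 0} + length gs * length fs" .
  have "{(a, j). v' a j \<noteq> 0} \<subseteq> {(a, j). v a j \<noteq> 0} \<union> {Suc l} \<times> {..<length fs}"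
    by (auto simp: v'_def split: if_splits)
  then have "card {(a, j). v' a j \<noteq> 0} \<le> card ({(a, j). v a j \<noteq> 0} \<union> {Suc l} \<times> {..<length fs})"
    using fin by (intro card_mono) auto
  also have "\<dots> \<le> card {(a, j). v a j \<noteq> 0} + length fs"
    by (rule order_trans[OF card_Un_le]) (simp add: card_cartesian_product)
  finally have cv: "card {(a, j). v' a j \<noteq> 0} \<le> card {(a, j). v a j \<noteq> 0} + length fs" .
  have 1: "\<bar>W' a i j\<bar> \<le> 1" "\<bar>v' a j\<bar> \<le> 1" for a i j
    using nd(1,2) A b by (auto simp: W'_def v'_def)
  have 2: "a \<le> Suc l \<and> i < (if a = Suc l then length gs else ?w) \<and> j < widths CARD('a) ?w a"
    if "W' a i j \<noteq> 0" for a i j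
  proof (cases "a = Suc l")
    case True
    then show ?thesis using that by (auto simp: W'_def widths_def split: if_splits)
  next
    case False
    then have "W a i j \<noteq> 0" using that by (simp add: W'_def)
    from nd(3)[OF this] False show ?thesis by (auto simp: widths_def split: if_splits)
  qed
  have 3: "a \<in> {1..Suc l} \<and> j < ?w" if "v' a j \<noteq> 0" for a j
    using nd(4)[of a j] that by (auto simp: v'_def split: if_splits)
  have "net_data CARD('a) (Suc l) ?w (length gs) (c + length gs * length fs + length fs) W' v'"
    using 1 2 3 cW cv nd(5) by (intro net_dataI) auto
  moreover have "net (widths CARD('a) ?w) W' v' (Suc l) (coords x) i = (gs ! i) x"
    if "i < length gs" for x i
  proof -
    have eq: "net (widths CARD('a) ?w) W' v' l (coords x) j = (fs ! j) x" if "j < length fs" for j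
    proof -
      have "net (widths CARD('a) ?w) W' v' l (coords x) j = net (widths CARD('a) ?w) W v l (coords x) j"
        by (rule net_cong_params) (auto simp: W'_def v'_def)
      also have "\<dots> = net (widths CARD('a) w) W v l (coords x) j"
        by (intro net_data_widen[OF Wv(1)]) (auto simp: widths_def)
      finally show ?thesis using Wv(2) that by simp
    qed
    have "net (widths CARD('a) ?w) W' v' (Suc l) (coords x) i
        = (\<Sum>j<?w. W' (Suc l) i j * max (net (widths CARD('a) ?w) W' v' l (coords x) j - v' (Suc l) j) 0)"
      by (simp add: widths_def)
    also have "\<dots> = (\<Sum>j<length fs. W' (Suc l) i j * max (net (widths CARD('a) ?w) W' v' l (coords x) j - v' (Suc l) j) 0)"
      by (rule sum.mono_neutral_right) (auto simp: W'_def)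
    also have "\<dots> = (\<Sum>j<length fs. A i j * max ((fs ! j) x - b j) 0)"
      using that by (intro sum.cong) (auto simp: W'_def v'_def eq)
    finally show ?thesis using gs[OF that] by simp
  qed
  ultimately show ?thesis
    by (rule computesI)
qed

lemma sum_lessThan_add: "(\<Sum>j<a + b. f j) = (\<Sum>j<a. f j) + (\<Sum>j<b. f (a + j))"
  for f :: "nat \<Rightarrow> 'a::comm_monoid_add"
  by (induction b) (simp_all add: ac_simps)

text \<open>Block diagonal weights; only the input layer is shared.\<close>

lemma computes_append:
  assumes "computes l w1 c1 fs" "computes l w2 c2 gs"
  shows "computes l (w1 + w2) (c1 + c2) (fs @ gs)"
proof -
  let ?d = "CARD('a)" and ?w = "w1 + w2" and ?r = "length fs"
  obtain W1 v1 where 1: "net_data ?d l w1 ?r c1 W1 v1"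
    "\<And>x i. i < ?r \<Longrightarrow> net (widths ?d w1) W1 v1 l (coords x) i = (fs ! i) x"
    using assms(1) unfolding computes_def by blast
  obtain W2 v2 where 2: "net_data ?d l w2 (length gs) c2 W2 v2"
    "\<And>x i. i < length gs \<Longrightarrow> net (widths ?d w2) W2 v2 l (coords x) i = (gs ! i) x"
    using assms(2) unfolding computes_def by blast
  \<comment> \<open>Index at which the second block begins in layer \<open>a\<close>. The shared
    input has offset 0, and the output layer is split after the outputs of the first
    network.\<close>
  define off where "off a = (if a = 0 then 0 else if a = Suc l then ?r else w1)" for a
  define W where "W a i j = (if i < off (Suc a) then W1 a i j
    else if off a \<le> j then W2 a (i - off (Suc a)) (j - off a) else 0)" for a i j
  define v where "v a j = (if j < off a then v1 a j else v2 a (j - off a))" for a j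
  note fin = finite_nonzero[OF 1(1)] finite_nonzero[OF 2(1)]
  have nd1: "\<And>a i j. \<bar>W1 a i j\<bar> \<le> 1" "\<And>a j. \<bar>v1 a j\<bar> \<le> 1"
    "\<And>a i j. W1 a i j \<noteq> 0 \<Longrightarrow> a \<le> l \<and> i < (if a = l then ?r else w1) \<and> j < widths ?d w1 a"
    "\<And>a j. v1 a j \<noteq> 0 \<Longrightarrow> a \<in> {1..l} \<and> j < w1"
    "card {(a, i, j). W1 a i j \<noteq> 0} + card {(a, j). v1 a j \<noteq> 0} \<le> c1"
    using net_dataD[OF 1(1)] by blast+
  have nd2: "\<And>a i j. \<bar>W2 a i j\<bar> \<le> 1" "\<And>a j. \<bar>v2 a j\<bar> \<le> 1"
    "\<And>a i j. W2 a i j \<noteq> 0 \<Longrightarrow> a \<le> l \<and> i < (if a = l then length gs else w2) \<and> j < widths ?d w2 a"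
    "\<And>a j. v2 a j \<noteq> 0 \<Longrightarrow> a \<in> {1..l} \<and> j < w2"
    "card {(a, i, j). W2 a i j \<noteq> 0} + card {(a, j). v2 a j \<noteq> 0} \<le> c2"
    using net_dataD[OF 2(1)] by blast+
  have "{(a, i, j). W a i j \<noteq> 0} \<subseteq> {(a, i, j). W1 a i j \<noteq> 0}
      \<union> (\<lambda>(a, i, j). (a, i + off (Suc a), j + off a)) ` {(a, i, j). W2 a i j \<noteq> 0}"
    by (force simp: W_def image_iff split: if_splits)
  then have "card {(a, i, j). W a i j \<noteq> 0} \<le> card ({(a, i, j). W1 a i j \<noteq> 0}
      \<union> (\<lambda>(a, i, j). (a, i + off (Suc a), j + off a)) ` {(a, i, j). W2 a i j \<noteq> 0})"
    using fin by (intro card_mono) auto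
  also have "\<dots> \<le> card {(a, i, j). W1 a i j \<noteq> 0} + card {(a, i, j). W2 a i j \<noteq> 0}"
    using fin by (intro order_trans[OF card_Un_le] add_left_mono card_image_le)
  finally have cW: "card {(a, i, j). W a i j \<noteq> 0} \<le> card {(a, i, j). W1 a i j \<noteq> 0} + card {(a, i, j). W2 a i j \<noteq> 0}" .
  have "{(a, j). v a j \<noteq> 0} \<subseteq> {(a, j). v1 a j \<noteq> 0} \<union> (\<lambda>(a, j). (a, j + off a)) ` {(a, j). v2 a j \<noteq> 0}"
    by (force simp: v_def image_iff split: if_splits)
  then have "card {(a, j). v a j \<noteq> 0}
      \<le> card ({(a, j). v1 a j \<noteq> 0} \<union> (\<lambda>(a, j). (a, j + off a)) ` {(a, j). v2 a j \<noteq> 0})"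
    using fin by (intro card_mono) auto
  also have "\<dots> \<le> card {(a, j). v1 a j \<noteq> 0} + card {(a, j). v2 a j \<noteq> 0}"
    using fin by (intro order_trans[OF card_Un_le] add_left_mono card_image_le)
  finally have cv: "card {(a, j). v a j \<noteq> 0} \<le> card {(a, j). v1 a j \<noteq> 0} + card {(a, j). v2 a j \<noteq> 0}" .
  have b: "\<bar>W a i j\<bar> \<le> 1" "\<bar>v a j\<bar> \<le> 1" for a i j
    using nd1(1,2) nd2(1,2) by (auto simp: W_def v_def)
  have sW: "a \<le> l \<and> i < (if a = l then length (fs @ gs) else ?w) \<and> j < widths ?d ?w a"
    if "W a i j \<noteq> 0" for a i j
  proof (cases "i < off (Suc a)")
    case True
    then have "W1 a i j \<noteq> 0" using that by (simp add: W_def)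
    from nd1(3)[OF this] show ?thesis by (auto simp: widths_def split: if_splits)
  next
    case False
    then have "W2 a (i - off (Suc a)) (j - off a) \<noteq> 0" "off a \<le> j"
      using that by (auto simp: W_def split: if_splits)
    with nd2(3)[OF this(1)] False show ?thesis by (auto simp: widths_def off_def split: if_splits)
  qed
  have sv: "a \<in> {1..l} \<and> j < ?w" if "v a j \<noteq> 0" for a j
    using nd1(4)[of a j] nd2(4)[of a "j - off a"] that by (auto simp: v_def off_def split: if_splits)
  have "net_data ?d l ?w (length (fs @ gs)) (c1 + c2) W v"
  proof (intro net_dataI)
    show "card {(a, i, j). W a i j \<noteq> 0} + card {(a, j). v a j \<noteq> 0} \<le> c1 + c2"
      using cW cv nd1(5) nd2(5) by linarith
  qed (use b sW sv in blast)+
  moreover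
  have split: "net (widths ?d ?w) W v a x i =
      (if i < off (Suc a) then net (widths ?d w1) W1 v1 a x i
       else net (widths ?d w2) W2 v2 a x (i - off (Suc a)))" if "a \<le> l" for a x i
    using that
  proof (induction a arbitrary: i)
    case 0
    then show ?case by (auto simp: widths_def W_def off_def intro!: sum.cong)
  next
    case (Suc a)
    have oa: "off (Suc a) = w1" using Suc.prems by (simp add: off_def)
    let ?N = "\<lambda>j. net (widths ?d ?w) W v a x j"
    have N: "?N j = net (widths ?d w1) W1 v1 a x j" if "j < w1" for j
      using Suc.IH[of j] Suc.prems that oa by simp
    have N': "?N (w1 + j) = net (widths ?d w2) W2 v2 a x j" for j
      using Suc.IH[of "w1 + j"] Suc.prems oa by simp
    have v: "v (Suc a) j = v1 (Suc a) j" if "j < w1" for j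
      using that oa by (simp add: v_def)
    have v': "v (Suc a) (w1 + j) = v2 (Suc a) j" for j
      using oa by (simp add: v_def)
    have "net (widths ?d ?w) W v (Suc a) x i = (\<Sum>j<w1 + w2. W (Suc a) i j * max (?N j - v (Suc a) j) 0)"
      by (simp add: widths_def)
    also have "\<dots> = (\<Sum>j<w1. W (Suc a) i j * max (?N j - v (Suc a) j) 0)
        + (\<Sum>j<w2. W (Suc a) i (w1 + j) * max (?N (w1 + j) - v (Suc a) (w1 + j)) 0)"
      by (rule sum_lessThan_add)
    also have "\<dots> = (\<Sum>j<w1. W (Suc a) i j * max (net (widths ?d w1) W1 v1 a x j - v1 (Suc a) j) 0)
        + (\<Sum>j<w2. W (Suc a) i (w1 + j) * max (net (widths ?d w2) W2 v2 a x j - v2 (Suc a) j) 0)"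
      using N N' v v'
      by (intro arg_cong2[of _ _ _ _ "(+)"] sum.cong refl arg_cong2[of _ _ _ _ "(*)"]
          arg_cong2[of _ _ _ _ max] arg_cong2[of _ _ _ _ "(-)"]) simp_all
    finally have eq: "net (widths ?d ?w) W v (Suc a) x i = \<dots>" .
    show ?case
    proof (cases "i < off (Suc (Suc a))")
      case True
      have "W1 (Suc a) i (w1 + j) = 0" for j
        using nd1(3)[of "Suc a" i "w1 + j"] by (auto simp: widths_def)
      then show ?thesis
        unfolding eq using True by (simp add: W_def widths_def)
    next
      case False
      then show ?thesis
        unfolding eq by (simp add: W_def widths_def oa)
    qed
  qed
  have "net (widths ?d ?w) W v l (coords x) i = ((fs @ gs) ! i) x" if "i < length (fs @ gs)" for x i
  proof -
    have "off (Suc l) = ?r" by (simp add: off_def)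
    then show ?thesis
      using 1(2)[of i x] 2(2)[of "i - ?r" x] that by (auto simp: split[OF order_refl] nth_append)
  qed
  ultimately show ?thesis
    by (rule computesI)
qed

lemma computes_concat:
  assumes "\<And>fs. fs \<in> set fss \<Longrightarrow> computes l w c fs"
  shows "computes l (length fss * w) (length fss * c) (concat fss)"
  using assms
proof (induction fss)
  case Nil
  then show ?case using computes_zeros[of l 0 0 0] by simp
next
  case (Cons fs fss)
  then have "computes l (w + length fss * w) (c + length fss * c) (fs @ concat fss)"
    by (intro computes_append) auto
  then show ?case by simp
qed

lemma computes_singletons:
  assumes "\<And>f. f \<in> set fs \<Longrightarrow> computes l w c [f]"
  shows "computes l (length fs * w) (length fs * c) fs"
proof -
  have "concat (map (\<lambda>f. [f]) fs) = fs" by (induction fs) auto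
  then show ?thesis
    using computes_concat[of "map (\<lambda>f. [f]) fs" l w c] assms by auto
qed

text \<open>A critic reads only output 0, and rows from \<open>p (Suc L) = 1\<close> on are not
  counted. The further outputs \<open>fs\<close>, such as the negative copy left over from padding,
  may therefore simply be ignored.\<close>

lemma computes_critic:
  fixes f :: "real ^ 'd::finite \<Rightarrow> real"
  assumes "computes L w c (f # fs)" "p 0 = CARD('d)" "p (Suc L) = 1"
    and "\<And>i. i \<in> {1..L} \<Longrightarrow> w \<le> p i" "real c \<le> s"
    and "\<And>x. x \<in> unit_cube \<Longrightarrow> \<bar>f x\<bar> \<le> F"
  shows "f \<in> critics L p s F"
proof -
  let ?d = "CARD('d)"
  obtain W v where Wv: "net_data ?d L w (Suc (length fs)) c W v"
    "\<And>x i. i < Suc (length fs) \<Longrightarrow> net (widths ?d w) W v L (coords x) i = ((f # fs) ! i) x"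
    using assms(1) unfolding computes_def by auto
  note fin = finite_nonzero[OF Wv(1)]
  have eq: "net p W v L (coords x) 0 = f x" for x :: "real ^ 'd"
  proof -
    have "net p W v L (coords x) 0 = net (widths ?d w) W v L (coords x) 0"
      using assms(2,4) by (intro net_data_widen[OF Wv(1)]) (auto simp: widths_def)
    then show ?thesis using Wv(2)[of 0 x] by simp
  qed
  have "card {(l, i, j). l \<le> L \<and> i < p (Suc l) \<and> j < p l \<and> W l i j \<noteq> 0} \<le> card {(a, i, j). W a i j \<noteq> 0}"
    using fin by (intro card_mono) auto
  moreover have "card {(l, j). l \<in> {1..L} \<and> j < p l \<and> v l j \<noteq> 0} \<le> card {(a, j). v a j \<noteq> 0}"
    using fin by (intro card_mono) auto
  ultimately have "num_nonzero L p W v \<le> c"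
    using net_dataD(5)[OF Wv(1)] unfolding num_nonzero_def by linarith
  moreover have "weights_bounded L p W v"
    using net_dataD(1,2)[OF Wv(1)] by (simp add: weights_bounded_def)
  moreover have "\<bar>net p W v L x i\<bar> \<le> F" if x: "\<forall>j<p 0. 0 \<le> x j \<and> x j \<le> 1" and i: "i < p (Suc L)" for x i
  proof -
    \<comment> \<open>The bound in \<open>relu_nets\<close> concerns sequences. On the entries that
      \<open>net\<close> reads, such a sequence agrees with the coordinates of a point
      \<open>X\<close> of the cube.\<close>
    define g where "g = inv_into {..<?d} (from_nat_into (UNIV :: 'd set))"
    define X :: "real ^ 'd" where "X = (\<chi> k. x (g k))"
    have "g k < ?d" for k
      unfolding g_def using inv_into_into[of k "from_nat_into (UNIV :: 'd set)" "{..<?d}"]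
        bij_betw_imp_surj_on[OF bij_coords[where 'd = 'd]] by auto
    then have X: "X \<in> unit_cube"
      using x assms(2) by (simp add: unit_cube_def X_def)
    have "coords X j = x j" if "j < ?d" for j
      using that bij_betw_imp_inj_on[OF bij_coords[where 'd = 'd]]
      by (simp add: coords_def X_def g_def inv_into_f_f)
    then have "net p W v L (coords X) 0 = net p W v L x 0"
      using assms(2) by (intro net_cong_input) auto
    then have "net p W v L x 0 = f X"
      by (simp only: eq)
    then have "\<bar>net p W v L x 0\<bar> \<le> F"
      using assms(6)[OF X] by simp
    then show ?thesis
      using assms(3) i by simp
  qed
  ultimately have "net p W v L \<in> relu_nets L p s F"
    unfolding relu_nets_def using assms(5)
    by (intro CollectI exI[of _ W] exI[of _ v]) (simp del: net.simps)
  moreover have "f = (\<lambda>x. net p W v L (\<lambda>i. x $ from_nat_into UNIV i) 0)"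
    using eq by (auto simp: coords_def)
  ultimately show ?thesis
    unfolding critics_def by blast
qed

lemma computes_layer_list:
  assumes "computes l w c fs"
    and "gs = map (\<lambda>r x. \<Sum>j<length fs. r ! j * max ((fs ! j) x - bs ! j) 0) A"
    and "length bs = length fs" "\<And>b. b \<in> set bs \<Longrightarrow> \<bar>b\<bar> \<le> 1"
    and "\<And>r. r \<in> set A \<Longrightarrow> length r = length fs \<and> (\<forall>a\<in>set r. \<bar>a\<bar> \<le> 1)"
  shows "computes (Suc l) (max w (length fs)) (c + length A * length fs + length fs) gs"
proof -
  have "computes (Suc l) (max w (length fs)) (c + length gs * length fs + length fs) gs"
  proof (rule computes_layer[of l w c fs gs "\<lambda>i j. A ! i ! j" "\<lambda>j. bs ! j"])
    show "\<bar>A ! i ! j\<bar> \<le> 1" if "i < length gs" "j < length fs" for i j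
      using assms(2) assms(5)[of "A ! i"] that by auto
  qed (use assms in auto)
  then show ?thesis
    using assms(2) by simp
qed

section \<open>Networks for ramps and hat functions\<close>

definition clip01 :: "real \<Rightarrow> real" where
  "clip01 t = max 0 (min 1 t)"

text \<open>Rises from 0 to 1 on the support of the hat function at \<open>j / 2 ^ k\<close>. Its
  tent is that hat function, and on the support it is the rescaled distance from the left end; so
  hat functions and monomials both come from ramps.\<close>

definition ramp :: "nat \<Rightarrow> nat \<Rightarrow> real \<Rightarrow> real" where
  "ramp k j t = clip01 ((2 ^ k * t - (real j - 1)) / 2)"

lemma clip01_range: "clip01 t \<in> {0..1}"
  by (auto simp: clip01_def)

lemma ramp_range: "ramp k j t \<in> {0..1}"
  by (simp add: ramp_def clip01_range del: atLeastAtMost_iff)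

text \<open>After division by \<open>2 ^ k\<close> the ramp is a difference of two ReLUs with input
  weight 1/2 and, for \<open>j\<close> up to \<open>2 ^ k\<close>, shifts of absolute value at most
  1. The undivided ramp would need weights of size \<open>2 ^ k\<close>.\<close>

lemma ramp_scaled_eq:
  "ramp k j t / 2 ^ k
    = max (t / 2 - (real j - 1) / (2 * 2 ^ k)) 0 - max (t / 2 - (real j + 1) / (2 * 2 ^ k)) 0"
proof -
  define y where "y = t / 2 - (real j - 1) / (2 * 2 ^ k)"
  have y: "(2 ^ k * t - (real j - 1)) / 2 = 2 ^ k * y" "t / 2 - (real j + 1) / (2 * 2 ^ k) = y - 1 / 2 ^ k"
    by (simp_all add: y_def field_simps)
  have "clip01 (P * y) / P = max y 0 - max (y - 1 / P) 0" if "0 < P" for P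
  proof (cases "y \<le> 1 / P")
    case True
    then have "P * y \<le> 1" using that by (simp add: field_simps)
    with True that show ?thesis by (auto simp: clip01_def max_def zero_le_mult_iff)
  next
    case False
    then have "1 < P * y" using that by (simp add: field_simps)
    moreover have "0 < y" using False that by (smt (verit) zero_less_divide_1_iff)
    ultimately show ?thesis using False by (auto simp: clip01_def max_def diff_divide_distrib)
  qed
  from this[of "2 ^ k"] have "clip01 (2 ^ k * y) / 2 ^ k = max y 0 - max (y - 1 / 2 ^ k) 0"
    by simp
  then show ?thesis
    unfolding ramp_def y y_def[symmetric] .
qed

text \<open>The scaled ramp is carried in two copies. A layer with all weights 1 adds them, so
  \<open>k\<close> layers of width 2 restore the factor \<open>2 ^ k\<close>.\<close>

lemma computes_ramp:
  fixes i :: "'d::finite"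
  assumes "j \<le> 2 ^ k"
  shows "computes (2 + k) 2 (14 + 6 * k)
    [\<lambda>x :: real ^ 'd. ramp k j (clip01 (x $ i)), \<lambda>x. ramp k j (clip01 (x $ i))]"
proof -
  let ?y = "\<lambda>x :: real ^ 'd. ramp k j (clip01 (x $ i)) / 2 ^ k"
  have j: "real j \<le> 2 ^ k"
    using assms by (metis of_nat_le_iff of_nat_numeral of_nat_power)
  have "\<bar>(r - 1) / (2 * P)\<bar> \<le> 1 \<and> \<bar>(r + 1) / (2 * P)\<bar> \<le> 1"
    if "0 \<le> r" "r \<le> P" "1 \<le> P" for r P :: real
    using that by (auto simp: abs_le_iff field_simps)
  from this[of "real j" "2 ^ k"] j
  have shift: "\<bar>(real j - 1) / (2 * 2 ^ k)\<bar> \<le> 1" "\<bar>(real j + 1) / (2 * 2 ^ k)\<bar> \<le> 1"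
    by auto
  have 0: "computes 0 2 2 [\<lambda>x :: real ^ 'd. x $ i, \<lambda>x. x $ i]"
    using computes_coords[of 2 "[i, i]"] by (simp add: numeral_2_eq_2)
  have 1: "computes (Suc 0) 2 8 [\<lambda>x :: real ^ 'd. clip01 (x $ i) / 2, \<lambda>x. clip01 (x $ i) / 2]"
    by (rule computes_mono[OF computes_layer_list[OF 0, of _ "[0, 1]" "[[1/2, -1/2], [1/2, -1/2]]"]])
      (auto simp: fun_eq_iff clip01_def)
  have 2: "computes (Suc (Suc 0)) 2 14 [?y, ?y]"
    by (rule computes_mono[OF computes_layer_list[OF 1,
            of _ "[(real j - 1) / (2 * 2 ^ k), (real j + 1) / (2 * 2 ^ k)]" "[[1, -1], [1, -1]]"]])
      (use shift in \<open>auto simp: fun_eq_iff ramp_scaled_eq\<close>)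
  have "computes (2 + r) 2 (14 + 6 * r) [\<lambda>x. 2 ^ r * ?y x, \<lambda>x. 2 ^ r * ?y x]" for r
  proof (induction r)
    case 0
    then show ?case using 2 by (simp add: numeral_2_eq_2)
  next
    case (Suc r)
    have nn: "max (2 ^ r * ?y x) 0 = 2 ^ r * ?y x" for x
      using ramp_range by (simp add: max_absorb1)
    show ?case
      unfolding add_Suc_right
      by (rule computes_mono[OF computes_layer_list[OF Suc, of _ "[0, 0]" "[[1, 1], [1, 1]]"]])
        (use nn in \<open>auto simp: fun_eq_iff\<close>)
  qed
  from this[of k] show ?thesis by simp
qed

text \<open>Three further layers pass the ramp on unchanged and bring it to the depth of a hat
  function, since all leaves of the product tree must have the same depth.\<close>

lemma computes_ramp_factor:
  fixes i :: "'d::finite"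
  assumes "j \<le> 2 ^ k"
  shows "computes (k + 5) 3 (6 * k + 35) [\<lambda>x :: real ^ 'd. ramp k j (clip01 (x $ i))]"
proof -
  let ?u = "\<lambda>x :: real ^ 'd. ramp k j (clip01 (x $ i))"
  have u: "0 \<le> ?u x" for x using ramp_range by simp
  have 1: "computes (Suc (2 + k)) 2 (18 + 6 * k) [?u]"
    by (rule computes_mono[OF computes_layer_list[OF computes_ramp[OF assms, of i], of _ "[0, 0]" "[[1, 0]]"]])
      (use u in \<open>auto simp: fun_eq_iff\<close>)
  have 2: "computes (Suc (Suc (2 + k))) 2 (20 + 6 * k) [?u]"
    by (rule computes_mono[OF computes_layer_list[OF 1, of _ "[0]" "[[1]]"]])
      (use u in \<open>auto simp: fun_eq_iff\<close>)
  have "computes (Suc (Suc (Suc (2 + k)))) 3 (6 * k + 35) [?u]"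
    by (rule computes_mono[OF computes_layer_list[OF 2, of _ "[0]" "[[1]]"]])
      (use u in \<open>auto simp: fun_eq_iff\<close>)
  then show ?thesis by (simp add: eval_nat_numeral)
qed

lemma computes_hat_factor:
  fixes i :: "'d::finite"
  assumes "j \<le> 2 ^ k"
  shows "computes (k + 5) 3 (6 * k + 35) [\<lambda>x :: real ^ 'd. tent (ramp k j (clip01 (x $ i)))]"
proof -
  let ?u = "\<lambda>x :: real ^ 'd. ramp k j (clip01 (x $ i))"
  let ?z = "\<lambda>x :: real ^ 'd. tent (ramp k j (clip01 (x $ i))) / 2"
  have u: "0 \<le> ?u x" for x using ramp_range by simp
  have z: "0 \<le> ?z x" for x using tent_range[OF ramp_range] by simp
  \<comment> \<open>The tent has coefficients 2 and 4. Half of it is obtained from two copies of the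
    shifted ReLU with weight -1, and adding two copies of the half restores the tent.\<close>
  have z_eq: "?z x = ?u x - 2 * max (?u x - 1/2) 0" for x
    by (auto simp: tent_def abs_if max_def)
  have 1: "computes (Suc (2 + k)) 2 (22 + 6 * k) [?u, ?u, ?u]"
    by (rule computes_mono[OF computes_layer_list[OF computes_ramp[OF assms, of i], of _ "[0, 0]"
            "[[1, 0], [1, 0], [1, 0]]"]])
      (use u in \<open>auto simp: fun_eq_iff\<close>)
  have 2: "computes (Suc (Suc (2 + k))) 3 (31 + 6 * k) [?z, ?z]"
    by (rule computes_mono[OF computes_layer_list[OF 1, of _ "[0, 1/2, 1/2]" "[[1, -1, -1], [1, -1, -1]]"]])
      (use u in \<open>auto simp: fun_eq_iff z_eq\<close>)
  have "computes (Suc (Suc (Suc (2 + k)))) 3 (6 * k + 35) [\<lambda>x. tent (?u x)]"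
    by (rule computes_mono[OF computes_layer_list[OF 2, of _ "[0, 0]" "[[1, 1]]"]])
      (use z in \<open>auto simp: fun_eq_iff\<close>)
  then show ?thesis by (simp add: eval_nat_numeral)
qed

text \<open>There are no output biases; the constant arises from a zero pre-activation with shift
  -1.\<close>

lemma computes_one: "computes (Suc l) 1 2 [\<lambda>_. 1]"
  by (rule computes_mono[OF computes_layer_list[OF computes_zeros[of l 0 0 1], of _ "[-1]" "[[1]]"]])
    (auto simp: fun_eq_iff)

section \<open>Networks for approximate products and their sums\<close>

lemma tent_iter_step:
  assumes "w \<in> {0..1}"
  shows "(tent ^^ Suc s) w / 4 ^ Suc s
    = ((tent ^^ s) w / 4 ^ s) / 2 - max ((tent ^^ s) w / 4 ^ s - 1 / (2 * 4 ^ s)) 0"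
proof -
  define t where "t = (tent ^^ s) w"
  have "max (t / 4 ^ s - 1 / (2 * 4 ^ s)) 0 = max (t - 1/2) 0 / 4 ^ s"
    by (auto simp: max_def field_simps)
  moreover have "tent t = 2 * t - 4 * max (t - 1/2) 0"
    by (auto simp: tent_def max_def abs_if)
  ultimately show ?thesis
    by (simp add: t_def[symmetric] field_simps)
qed

text \<open>Scaling the s-th sawtooth by \<open>4 ^ -s\<close> turns the coefficients 2 and 4 of the
  tent into 1/2 and 1. Each of the two sawtooth sequences is kept twice, because it enters the next
  layer with two different shifts. The fifth channel accumulates the difference of the squares; by
  \<open>sq_mono\<close> it is nonnegative, so the ReLU passes it unchanged.\<close>

lemma computes_mult:
  assumes "computes l w c [a, b]" "\<And>x. a x \<in> {0..1}" "\<And>x. b x \<in> {0..1}"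
  shows "computes (l + (m + 3)) (max w 5) (c + 40 * (m + 3)) [\<lambda>x. approx_mult m (a x) (b x)]"
proof -
  let ?p = "\<lambda>x. (a x + b x) / 2" and ?q = "\<lambda>x. \<bar>a x - b x\<bar> / 2"
  have ab: "0 \<le> a x" "0 \<le> b x" for x using assms(2,3) by simp_all
  have p: "?p x \<in> {0..1}" and q: "?q x \<in> {0..1}" and qp: "?q x \<le> ?p x" for x
    using assms(2)[of x] assms(3)[of x] by (auto simp: abs_if)
  have mx: "max (b x - a x) 0 = \<bar>a x - b x\<bar> - max (a x - b x) 0" for x
    by (auto simp: max_def abs_if)
  have 1: "computes (Suc l) (max w 2) (c + 10) [a, b, \<lambda>x. a x - b x, \<lambda>x. b x - a x]"
    by (rule computes_mono[OF computes_layer_list[OF assms(1), of _ "[0, 0]" "[[1, 0], [0, 1], [1, -1], [-1, 1]]"]])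
      (use ab in \<open>auto simp: fun_eq_iff\<close>)
  have 2: "computes (Suc (Suc l)) (max w 5) (c + 34) [?p, ?p, ?q, ?q, \<lambda>x. ?p x - ?q x]"
    by (rule computes_mono[OF computes_layer_list[OF 1, of _ "[0, 0, 0, 0]"
            "[[1/2, 1/2, 0, 0], [1/2, 1/2, 0, 0], [0, 0, 1/2, 1/2], [0, 0, 1/2, 1/2], [1/2, 1/2, -1/2, -1/2]]"]])
      (use ab in \<open>auto simp: fun_eq_iff mx field_simps\<close>)
  define T where "T s u = (tent ^^ s) u / 4 ^ s" for s u
  have T: "0 \<le> T s u" if "u \<in> {0..1}" for s u
    using tent_iter_range[OF that, of s] by (simp add: T_def)
  have T_Suc: "T (Suc s) u = T s u / 2 - max (T s u - 1 / (2 * 4 ^ s)) 0" if "u \<in> {0..1}" for s u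
    unfolding T_def by (rule tent_iter_step[OF that])
  have sq: "sq (Suc s) u = sq s u - T (Suc s) u" for s u
    by (simp add: sq_def T_def del: funpow.simps)
  have st: "computes (Suc (Suc l) + s) (max w 5) (c + 34 + 30 * s)
      [\<lambda>x. T s (?p x), \<lambda>x. T s (?p x), \<lambda>x. T s (?q x), \<lambda>x. T s (?q x), \<lambda>x. sq s (?p x) - sq s (?q x)]" for s
  proof (induction s)
    case 0
    then show ?case using 2 by (simp add: sq_0 T_def)
  next
    case (Suc s)
    have nn: "max (sq s (?p x) - sq s (?q x)) 0 = sq s (?p x) - sq s (?q x)"
      "max (T s (?p x)) 0 = T s (?p x)" "max (T s (?q x)) 0 = T s (?q x)" for x
      using sq_mono[of "?q x" "?p x" s] p[of x] q[of x] qp[of x] T[OF p] T[OF q] by simp_all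
    have shift: "\<bar>1 / (2 * 4 ^ s) :: real\<bar> \<le> 1"
      using one_le_power[of "4 :: real" s] by (simp add: field_simps del: one_le_power)
    show ?case
      unfolding add_Suc_right
      by (rule computes_mono[OF computes_layer_list[OF Suc, of _ "[0, 1 / (2 * 4 ^ s), 0, 1 / (2 * 4 ^ s), 0]"
              "[[1/2, -1, 0, 0, 0], [1/2, -1, 0, 0, 0], [0, 0, 1/2, -1, 0], [0, 0, 1/2, -1, 0], [-1/2, 1, 1/2, -1, 1]]"]])
        (use shift nn in \<open>auto simp: fun_eq_iff T_Suc[OF p] T_Suc[OF q] sq\<close>)
  qed
  have nn: "0 \<le> sq m (?p x) - sq m (?q x)" for x
    using sq_mono[of "?q x" "?p x" m] p[of x] q[of x] qp[of x] by simp
  have "computes (Suc (Suc (Suc l) + m)) (max w 5) (c + 40 * (m + 3)) [\<lambda>x. approx_mult m (a x) (b x)]"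
    by (rule computes_mono[OF computes_layer_list[OF st[of m], of _ "[0, 0, 0, 0, 0]" "[[0, 0, 0, 0, 1]]"]])
      (use nn in \<open>auto simp: fun_eq_iff approx_mult_def\<close>)
  then show ?thesis by (simp add: eval_nat_numeral)
qed

text \<open>The cost counts \<open>2 ^ k\<close> leaves of cost \<open>c\<close> and
  \<open>2 ^ k - 1\<close> inner nodes of cost \<open>40 * (m + 3)\<close>.\<close>

lemma computes_ptree:
  assumes "length fs = 2 ^ k" "\<And>f. f \<in> set fs \<Longrightarrow> computes l w c [f]"
    and "\<And>f x. f \<in> set fs \<Longrightarrow> f x \<in> {0..1}"
  shows "computes (l + k * (m + 3)) (2 ^ k * (w + 5)) (2 ^ k * (c + 40 * (m + 3)) - 40 * (m + 3))
    [\<lambda>x. ptree m k (map (\<lambda>f. f x) fs)]"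
  using assms
proof (induction k arbitrary: fs)
  case 0
  then obtain f where "fs = [f]" by (cases fs) auto
  with 0 show ?case by (auto intro: computes_mono[of l w c])
next
  case (Suc k)
  let ?D = "40 * (m + 3)"
  let ?t = "\<lambda>fs x. ptree m k (map (\<lambda>f. f x) fs)"
  let ?l = "take (2 ^ k) fs" and ?r = "drop (2 ^ k) fs"
  have sub: "set ?l \<subseteq> set fs" "set ?r \<subseteq> set fs"
    by (rule set_take_subset set_drop_subset)+
  note len = length_halves[OF Suc.prems(1)]
  have rng: "?t gs x \<in> {0..1}" if "length gs = 2 ^ k" "set gs \<subseteq> set fs" for gs x
    by (rule ptree_range) (use that Suc.prems(3) in auto)
  have "computes (l + k * (m + 3)) (2 ^ k * (w + 5)) (2 ^ k * (c + ?D) - ?D) [?t ?l]"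
    "computes (l + k * (m + 3)) (2 ^ k * (w + 5)) (2 ^ k * (c + ?D) - ?D) [?t ?r]"
    using sub Suc.prems(2,3) by (intro Suc.IH len; blast)+
  from computes_append[OF this] have "computes (l + k * (m + 3)) (2 ^ Suc k * (w + 5))
      (2 * (2 ^ k * (c + ?D) - ?D)) [?t ?l, ?t ?r]"
    by (simp add: mult_2 distrib_right)
  from computes_mult[OF this rng[OF len(1) sub(1)] rng[OF len(2) sub(2)], of m]
  have "computes (l + k * (m + 3) + (m + 3)) (max (2 ^ Suc k * (w + 5)) 5)
      (2 * (2 ^ k * (c + ?D) - ?D) + ?D) [\<lambda>x. approx_mult m (?t ?l x) (?t ?r x)]" .
  moreover have "l + k * (m + 3) + (m + 3) = l + Suc k * (m + 3)" by simp
  moreover have "max (2 ^ Suc k * (w + 5)) 5 = 2 ^ Suc k * (w + 5)"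
  proof -
    have "1 * 5 \<le> 2 ^ Suc k * (w + 5)" by (intro mult_le_mono) auto
    then show ?thesis by simp
  qed
  moreover have "2 * (2 ^ k * (c + ?D) - ?D) + ?D = 2 ^ Suc k * (c + ?D) - ?D"
  proof -
    have "1 * ?D \<le> 2 ^ k * (c + ?D)" by (intro mult_le_mono) auto
    then show ?thesis by simp
  qed
  ultimately show ?case
    by (simp only: ptree.simps take_map drop_map)
qed

text \<open>The negative is produced as well, because a signed value survives a further ReLU layer
  only as the difference of its positive and its negative part.\<close>

lemma computes_sum:
  assumes "finite I" "\<And>i. i \<in> I \<Longrightarrow> computes l w c [f i]"
    and "\<And>i x. i \<in> I \<Longrightarrow> 0 \<le> f i x" "\<And>i. i \<in> I \<Longrightarrow> \<bar>cf i\<bar> \<le> 1"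
  shows "computes (Suc l) (card I * (w + 1)) (card I * (c + 3))
    [\<lambda>x. \<Sum>i\<in>I. cf i * f i x, \<lambda>x. - (\<Sum>i\<in>I. cf i * f i x)]"
proof -
  obtain xs where xs: "set xs = I" "distinct xs"
    using finite_distinct_list[OF assms(1)] by blast
  have len: "length xs = card I" using distinct_card[OF xs(2)] xs(1) by simp
  have bij: "bij_betw ((!) xs) {..<card I} I"
    using bij_betw_nth[OF xs(2)] xs(1) len by simp
  have fs: "computes l (card I * w) (card I * c) (map f xs)"
    using computes_singletons[of "map f xs" l w c] assms(2) xs(1) len by fastforce
  have sum: "(\<Sum>j<card I. cf (xs ! j) * f (xs ! j) x) = (\<Sum>i\<in>I. cf i * f i x)" for x
    using sum.reindex_bij_betw[OF bij, of "\<lambda>i. cf i * f i x"] .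
  have mx: "max (f (xs ! j) x) 0 = f (xs ! j) x" if "j < card I" for j x
    using assms(3)[of "xs ! j" x] xs(1) len that nth_mem by (metis max_absorb1)
  have "length r = length (map f xs) \<and> (\<forall>a\<in>set r. \<bar>a\<bar> \<le> 1)"
    if "r \<in> set [map cf xs, map (\<lambda>i. - cf i) xs]" for r
    using that assms(4) xs(1) by auto
  from computes_layer_list[OF fs refl _ _ this, of "replicate (card I) 0" "[map cf xs, map (\<lambda>i. - cf i) xs]"]
  have "computes (Suc l) (max (card I * w) (card I)) (card I * c + 2 * card I + card I)
    (map (\<lambda>r x. \<Sum>j<card I. r ! j * max ((map f xs ! j) x - replicate (card I) 0 ! j) 0)
      [map cf xs, map (\<lambda>i. - cf i) xs])"
    by (simp add: len mult_2 add.assoc)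
  then have "computes (Suc l) (max (card I * w) (card I)) (card I * c + 2 * card I + card I)
    [\<lambda>x. \<Sum>i\<in>I. cf i * f i x, \<lambda>x. - (\<Sum>i\<in>I. cf i * f i x)]"
    by (simp add: len mx sum sum_negf cong: sum.cong_simp)
  then show ?thesis
    by (rule computes_mono) (auto simp: algebra_simps)
qed

text \<open>The depth of the critic class is prescribed, so surplus layers have to transport the
  value; a full 2 by 2 matrix and two shifts give the cost 6.\<close>

lemma computes_pad:
  assumes "computes l w c [f, \<lambda>x. - f x]"
  shows "computes (l + n) (max w 2) (c + 6 * n) [f, \<lambda>x. - f x]"
proof (induction n)
  case 0
  then show ?case using assms by (auto intro: computes_mono)
next
  case (Suc n)
  show ?case
    unfolding add_Suc_right
    by (rule computes_mono[OF computes_layer_list[OF Suc, of _ "[0, 0]" "[[1, -1], [-1, 1]]"]])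
      (auto simp: fun_eq_iff max_def)
qed

section \<open>Taylor expansion in Hoelder classes\<close>

lemma multi_indices_subset: "{\<alpha> :: 'd::finite \<Rightarrow> nat. mi_abs \<alpha> < m} \<subseteq> (\<Pi>\<^sub>E i\<in>UNIV. {..<m})"
proof (rule subsetI)
  fix \<alpha> :: "'d \<Rightarrow> nat" assume "\<alpha> \<in> {\<alpha>. mi_abs \<alpha> < m}"
  moreover have "\<alpha> i \<le> mi_abs \<alpha>" for i
    unfolding mi_abs_def by (rule member_le_sum) auto
  ultimately show "\<alpha> \<in> (\<Pi>\<^sub>E i\<in>UNIV. {..<m})"
    by (auto simp: PiE_UNIV_domain intro: le_less_trans)
qed

lemma finite_multi_indices: "finite {\<alpha> :: 'd::finite \<Rightarrow> nat. mi_abs \<alpha> < m}"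
  by (rule finite_subset[OF multi_indices_subset]) (intro finite_PiE; simp)

lemma card_multi_indices: "card {\<alpha> :: 'd::finite \<Rightarrow> nat. mi_abs \<alpha> < m} \<le> m ^ CARD('d)"
proof -
  have "card {\<alpha> :: 'd \<Rightarrow> nat. mi_abs \<alpha> < m} \<le> card (\<Pi>\<^sub>E i\<in>(UNIV :: 'd set). {..<m})"
    by (rule card_mono[OF _ multi_indices_subset]) (intro finite_PiE; simp)
  then show ?thesis by (simp add: card_PiE)
qed

lemma mi_abs_upd: "mi_abs (\<alpha>(i := Suc (\<alpha> i))) = Suc (mi_abs \<alpha>)"
  unfolding mi_abs_def by (subst (1 2) sum.remove[of _ i]) auto

lemma mi_abs_0: "mi_abs (\<lambda>_. 0) = 0"
  by (simp add: mi_abs_def)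

lemma holder_norm_bound:
  fixes D :: "('d::finite \<Rightarrow> nat) \<Rightarrow> real ^ 'd \<Rightarrow> real"
  assumes "holder_norm T \<beta> D \<le> ennreal K" "0 \<le> K" "mi_abs \<alpha> < \<beta>" "x \<in> T"
  shows "\<bar>D \<alpha> x\<bar> \<le> K"
proof -
  have "ennreal \<bar>D \<alpha> x\<bar> \<le> (SUP x\<in>T. ennreal \<bar>D \<alpha> x\<bar>)"
    using assms(4) by (rule SUP_upper)
  also have "\<dots> \<le> (\<Sum>\<alpha> | mi_abs \<alpha> < \<beta>. SUP x\<in>T. ennreal \<bar>D \<alpha> x\<bar>)"
    using assms(3) finite_multi_indices by (intro member_le_sum) auto
  also have "\<dots> \<le> holder_norm T \<beta> D"
    unfolding holder_norm_def by simp
  also have "\<dots> \<le> ennreal K" by fact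
  finally show ?thesis using assms(2) by simp
qed

lemma holder_norm_lipschitz:
  fixes D :: "('d::finite \<Rightarrow> nat) \<Rightarrow> real ^ 'd \<Rightarrow> real"
  assumes "holder_norm T \<beta> D \<le> ennreal K" "0 \<le> K" "mi_abs \<alpha> = \<beta> - 1" "x \<in> T" "y \<in> T"
  shows "\<bar>D \<alpha> x - D \<alpha> y\<bar> \<le> K * infnorm (x - y)"
proof (cases "x = y")
  case False
  let ?S = "{(x, y). x \<in> T \<and> y \<in> T \<and> x \<noteq> y}"
  let ?q = "\<lambda>\<alpha> (x, y). ennreal (\<bar>D \<alpha> x - D \<alpha> y\<bar> / infnorm (x - y))"
  have fin: "finite {\<alpha> :: 'd \<Rightarrow> nat. mi_abs \<alpha> = \<beta> - 1}"
    by (rule finite_subset[OF _ finite_multi_indices[of "Suc \<beta>"]]) auto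
  have "?q \<alpha> (x, y) \<le> (SUP z\<in>?S. ?q \<alpha> z)"
    by (rule SUP_upper) (use False assms in auto)
  also have "\<dots> \<le> (\<Sum>\<alpha> | mi_abs \<alpha> = \<beta> - 1. SUP z\<in>?S. ?q \<alpha> z)"
    using assms(3) fin by (intro member_le_sum) auto
  also have "\<dots> \<le> holder_norm T \<beta> D"
    unfolding holder_norm_def by simp
  also have "\<dots> \<le> ennreal K" by fact
  finally have "\<bar>D \<alpha> x - D \<alpha> y\<bar> / infnorm (x - y) \<le> K"
    using assms(2) by simp
  moreover have "0 < infnorm (x - y)"
    using False infnorm_pos_lt[of "x - y"] by simp
  ultimately show ?thesis
    by (simp add: field_simps)
qed (simp add: infnorm_0)

text \<open>Only partial derivatives within the cube are given, so \<open>a\<close> is joined to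
  \<open>x\<close> by changing one coordinate after the other. On this path every coordinate lies
  between those of \<open>a\<close> and \<open>x\<close>; hence the path stays in the cube and never
  farther from \<open>a\<close> than \<open>x\<close>.\<close>

lemma axis_path_bound:
  fixes G :: "real ^ 'd::finite \<Rightarrow> real"
  assumes deriv: "\<And>i z. z \<in> unit_cube \<Longrightarrow>
      ((\<lambda>t. G (z + t *\<^sub>R axis i 1)) has_real_derivative G' i z) (at 0 within {t. z + t *\<^sub>R axis i 1 \<in> unit_cube})"
    and bound: "\<And>i z. z \<in> unit_cube \<Longrightarrow> norm (z - a) \<le> norm (x - a) \<Longrightarrow> \<bar>G' i z\<bar> \<le> B"
    and a: "a \<in> unit_cube" and x: "x \<in> unit_cube"
  shows "\<bar>G x - G a\<bar> \<le> real CARD('d) * B * norm (x - a)"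
proof -
  define z where "z S = (\<chi> i. if i \<in> S then x $ i else a $ i)" for S
  have "\<bar>G' undefined a\<bar> \<le> B" by (rule bound[OF a]) simp
  then have B: "0 \<le> B" by linarith
  have "\<bar>G (z S) - G a\<bar> \<le> real (card S) * B * norm (x - a)" if "finite S" for S
    using that
  proof (induction S)
    case empty
    have "z {} = a" by (simp add: z_def vec_eq_iff)
    then show ?case by simp
  next
    case (insert i S)
    define \<delta> where "\<delta> = x $ i - a $ i"
    let ?p = "\<lambda>t. z S + t *\<^sub>R axis i 1"
    have comp: "?p t $ j = (if j = i then a $ i + t else if j \<in> S then x $ j else a $ j)" for t j
      using insert.hyps by (simp add: z_def axis_def)
    have cube: "?p t \<in> unit_cube" if t: "t \<in> closed_segment 0 \<delta>" for t
    proof -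
      have "a $ i + t \<in> closed_segment (a $ i + 0) (a $ i + \<delta>)"
        using t by (simp only: closed_segment_translation_eq)
      also have "\<dots> \<subseteq> {0..1}"
        using a x by (intro closed_segment_subset) (auto simp: unit_cube_def \<delta>_def)
      finally have "0 \<le> a $ i + t \<and> a $ i + t \<le> 1" by simp
      then show ?thesis
        using a x unfolding unit_cube_def mem_Collect_eq comp by simp
    qed
    have near: "norm (?p t - a) \<le> norm (x - a)" if t: "t \<in> closed_segment 0 \<delta>" for t
    proof (rule norm_le_componentwise_cart)
      fix j
      have "\<bar>t\<bar> \<le> \<bar>x $ i - a $ i\<bar>"
        using segment_bound1[OF t] by (simp add: \<delta>_def)
      then show "norm ((?p t - a) $ j) \<le> norm ((x - a) $ j)"
        unfolding vector_minus_component comp by simp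
    qed
    have "norm (G (?p \<delta>) - G (?p 0)) \<le> B * norm (\<delta> - 0)"
    proof (rule field_differentiable_bound[of "closed_segment 0 \<delta>" _ "\<lambda>t. G' i (?p t)"])
      fix t assume t: "t \<in> closed_segment 0 \<delta>"
      \<comment> \<open>\<open>deriv\<close> is stated at increment 0 for each base point;
        composition with the translation by \<open>t\<close> turns it into the derivative at
        \<open>t\<close> along the edge.\<close>
      have shift: "?p t + (u - t) *\<^sub>R axis i 1 = ?p u" for u
        by (simp add: algebra_simps)
      have "((\<lambda>u. G (?p t + u *\<^sub>R axis i 1)) has_real_derivative G' i (?p t))
          (at 0 within (\<lambda>u. u - t) ` closed_segment 0 \<delta>)"
        by (rule has_field_derivative_subset[OF deriv[OF cube[OF t], of i]])
          (use cube in \<open>auto simp only: shift mem_Collect_eq\<close>)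
      then have "((\<lambda>u. G (?p t + u *\<^sub>R axis i 1)) has_real_derivative G' i (?p t))
          (at ((\<lambda>u. u - t) t) within (\<lambda>u. u - t) ` closed_segment 0 \<delta>)"
        by simp
      moreover have "((\<lambda>u. u - t) has_real_derivative 1) (at t within closed_segment 0 \<delta>)"
        by (auto intro!: derivative_eq_intros)
      ultimately
      have "((\<lambda>u. G (?p t + u *\<^sub>R axis i 1)) \<circ> (\<lambda>u. u - t) has_real_derivative G' i (?p t))
          (at t within closed_segment 0 \<delta>)"
        using DERIV_image_chain by fastforce
      then show "((\<lambda>t. G (?p t)) has_real_derivative G' i (?p t)) (at t within closed_segment 0 \<delta>)"
        by (simp add: o_def shift)
      show "norm (G' i (?p t)) \<le> B"
        using bound[OF cube[OF t] near[OF t]] by simp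
    qed auto
    moreover have "?p \<delta> = z (insert i S)" "?p 0 = z S"
      unfolding vec_eq_iff comp using insert.hyps by (simp_all add: z_def \<delta>_def)
    ultimately have "\<bar>G (z (insert i S)) - G (z S)\<bar> \<le> B * \<bar>\<delta>\<bar>" by simp
    also have "\<dots> \<le> B * norm (x - a)"
      unfolding \<delta>_def using component_le_norm_cart[of "x - a" i] B by (intro mult_left_mono) auto
    finally show ?case
      using insert by (simp add: algebra_simps)
  qed
  from this[of UNIV] show ?thesis
    by (simp add: z_def)
qed

text \<open>At top order this is the Hoelder quotient, as \<open>infnorm\<close> is at most the
  Euclidean norm; at lower orders it follows from the bound on the derivatives of the next
  order.\<close>

lemma partial_derivs_lipschitz:
  fixes D :: "('d::finite \<Rightarrow> nat) \<Rightarrow> real ^ 'd \<Rightarrow> real"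
  assumes D: "partial_derivs unit_cube (\<gamma> - 1) f D" and K: "holder_norm unit_cube \<gamma> D \<le> ennreal K" "0 \<le> K"
    and \<alpha>: "mi_abs \<alpha> < \<gamma>" and xy: "x \<in> unit_cube" "y \<in> unit_cube"
  shows "\<bar>D \<alpha> x - D \<alpha> y\<bar> \<le> real CARD('d) * K * norm (x - y)"
proof (cases "mi_abs \<alpha> = \<gamma> - 1")
  case True
  have "\<bar>D \<alpha> x - D \<alpha> y\<bar> \<le> K * infnorm (x - y)"
    by (rule holder_norm_lipschitz[OF K True xy])
  also have "\<dots> \<le> (real CARD('d) * K) * norm (x - y)"
    using K(2) infnorm_le_norm[of "x - y"] infnorm_pos_le[of "x - y"]
    by (intro mult_mono) (auto simp: mult_le_cancel_right1 Suc_leI)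
  finally show ?thesis .
next
  case False
  with \<alpha> have lt: "mi_abs \<alpha> < \<gamma> - 1" by simp
  show ?thesis
  proof (rule axis_path_bound[where G' = "\<lambda>i. D (\<alpha>(i := Suc (\<alpha> i)))"])
    show "\<bar>D (\<alpha>(i := Suc (\<alpha> i))) z\<bar> \<le> K" if "z \<in> unit_cube" for i z
      using holder_norm_bound[OF K _ that] lt by (simp add: mi_abs_upd)
  qed (use D lt xy in \<open>auto simp: partial_derivs_def\<close>)
qed

section \<open>Taylor polynomials and the remainder\<close>

definition taylor_monom :: "real ^ 'd \<Rightarrow> ('d::finite \<Rightarrow> nat) \<Rightarrow> real ^ 'd \<Rightarrow> real" where
  "taylor_monom a \<beta> x = (\<Prod>j\<in>UNIV. (x $ j - a $ j) ^ \<beta> j / fact (\<beta> j))"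

definition taylor ::
  "(('d::finite \<Rightarrow> nat) \<Rightarrow> real ^ 'd \<Rightarrow> real) \<Rightarrow> nat \<Rightarrow> ('d \<Rightarrow> nat) \<Rightarrow> real ^ 'd \<Rightarrow> real ^ 'd \<Rightarrow> real" where
  "taylor D m \<alpha> a x = (\<Sum>\<beta> | mi_abs \<beta> < m. D (\<lambda>j. \<alpha> j + \<beta> j) a * taylor_monom a \<beta> x)"

lemma taylor_monom_deriv:
  "((\<lambda>t. taylor_monom a \<beta> (x + t *\<^sub>R axis i 1)) has_real_derivative
     (if \<beta> i = 0 then 0 else taylor_monom a (\<beta>(i := \<beta> i - 1)) x)) (at 0 within S)"
proof -
  let ?R = "\<Prod>j\<in>UNIV - {i}. (x $ j - a $ j) ^ \<beta> j / fact (\<beta> j)"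
  have "taylor_monom a \<beta> (x + t *\<^sub>R axis i 1) = (x $ i + t - a $ i) ^ \<beta> i / fact (\<beta> i) * ?R" for t
    unfolding taylor_monom_def by (subst prod.remove[of _ i]) (auto simp: axis_def)
  moreover have "taylor_monom a (\<beta>(i := \<beta> i - 1)) x = (x $ i - a $ i) ^ (\<beta> i - 1) / fact (\<beta> i - 1) * ?R"
    unfolding taylor_monom_def by (subst prod.remove[of _ i]) auto
  moreover have "((\<lambda>t. (x $ i + t - a $ i) ^ \<beta> i / fact (\<beta> i) * ?R) has_real_derivative
     (if \<beta> i = 0 then 0 else (x $ i - a $ i) ^ (\<beta> i - 1) / fact (\<beta> i - 1) * ?R)) (at 0 within S)"
  proof (cases "\<beta> i")
    case 0
    then show ?thesis by simp
  next
    case (Suc n)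
    have "((\<lambda>t. x $ i + t - a $ i) has_real_derivative 1) (at 0 within S)"
      by (auto intro!: derivative_eq_intros)
    from DERIV_power[OF this, of "Suc n"]
    have "((\<lambda>t. (x $ i + t - a $ i) ^ Suc n) has_real_derivative (1 + real n) * (x $ i - a $ i) ^ n) (at 0 within S)"
      by simp
    then have "((\<lambda>t. (x $ i + t - a $ i) ^ Suc n / fact (Suc n) * ?R) has_real_derivative
        (1 + real n) * (x $ i - a $ i) ^ n / fact (Suc n) * ?R) (at 0 within S)"
      by (intro DERIV_cmult_right DERIV_cdivide)
    moreover have "(1 + real n) * (x $ i - a $ i) ^ n / fact (Suc n) = (x $ i - a $ i) ^ n / fact n"
      unfolding fact_Suc of_nat_Suc by (simp add: add_nonneg_eq_0_iff)
    ultimately show ?thesis using Suc by simp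
  qed
  ultimately show ?thesis by (simp only:)
qed

text \<open>Differentiation moves one unit from the exponent of the monomial to the index of
  \<open>D\<close>. The remainders of all the derivatives are thereby linked in the same way as the
  derivatives themselves.\<close>

lemma taylor_deriv:
  "((\<lambda>t. taylor D (Suc m) \<alpha> a (x + t *\<^sub>R axis i 1)) has_real_derivative
     taylor D m (\<alpha>(i := Suc (\<alpha> i))) a x) (at 0 within S)"
proof -
  let ?u = "\<lambda>\<beta>. \<beta>(i := Suc (\<beta> i))"
  let ?g = "\<lambda>\<beta>. D (\<lambda>j. \<alpha> j + \<beta> j) a * (if \<beta> i = 0 then 0 else taylor_monom a (\<beta>(i := \<beta> i - 1)) x)"
  have "(\<Sum>\<beta> | mi_abs \<beta> < Suc m. ?g \<beta>) = (\<Sum>\<beta> | mi_abs \<beta> < Suc m \<and> \<beta> i \<noteq> 0. ?g \<beta>)"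
    using finite_multi_indices by (intro sum.mono_neutral_right) auto
  also have "\<dots> = (\<Sum>\<beta> | mi_abs \<beta> < m. ?g (?u \<beta>))"
  proof (rule sum.reindex_bij_witness[of _ ?u "\<lambda>\<beta>. \<beta>(i := \<beta> i - 1)"])
    fix \<beta> assume "\<beta> \<in> {\<beta>. mi_abs \<beta> < Suc m \<and> \<beta> i \<noteq> 0}"
    then show "?u (\<beta>(i := \<beta> i - 1)) = \<beta>" "\<beta>(i := \<beta> i - 1) \<in> {\<beta>. mi_abs \<beta> < m}"
      using mi_abs_upd[of "\<beta>(i := \<beta> i - 1)" i] by (auto simp: fun_eq_iff)
  qed (auto simp: mi_abs_upd fun_eq_iff)
  also have "\<dots> = taylor D m (?u \<alpha>) a x"
    unfolding taylor_def
  proof (rule sum.cong)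
    fix \<beta> :: "'a \<Rightarrow> nat"
    have "(\<lambda>j. \<alpha> j + ?u \<beta> j) = (\<lambda>j. ?u \<alpha> j + \<beta> j)" by auto
    then show "?g (?u \<beta>) = D (\<lambda>j. ?u \<alpha> j + \<beta> j) a * taylor_monom a \<beta> x" by simp
  qed simp
  finally have "taylor D m (?u \<alpha>) a x = (\<Sum>\<beta> | mi_abs \<beta> < Suc m. ?g \<beta>)" ..
  then show ?thesis
    unfolding taylor_def[of D "Suc m"] by (auto intro!: DERIV_sum DERIV_cmult taylor_monom_deriv)
qed

lemma taylor_at_base:
  fixes D :: "('d::finite \<Rightarrow> nat) \<Rightarrow> real ^ 'd \<Rightarrow> real"
  assumes m: "0 < m"
  shows "taylor D m \<alpha> a a = D \<alpha> a"
proof -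
  have "taylor D m \<alpha> a a = (\<Sum>\<beta> :: 'd \<Rightarrow> nat | mi_abs \<beta> < m. if \<beta> = (\<lambda>_. 0) then D \<alpha> a else 0)"
    unfolding taylor_def
  proof (rule sum.cong)
    fix \<beta> :: "'d \<Rightarrow> nat"
    show "D (\<lambda>j. \<alpha> j + \<beta> j) a * taylor_monom a \<beta> a = (if \<beta> = (\<lambda>_. 0) then D \<alpha> a else 0)"
    proof (cases "\<beta> = (\<lambda>_. 0)")
      case False
      then obtain j where "\<beta> j \<noteq> 0" by auto
      then have "taylor_monom a \<beta> a = 0"
        unfolding taylor_monom_def by (intro prod_zero) auto
      with False show ?thesis by simp
    qed (simp add: taylor_monom_def)
  qed simp
  also have "\<dots> = D \<alpha> a"
    using finite_multi_indices m by (subst sum.delta) (auto simp: mi_abs_0)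
  finally show ?thesis .
qed

text \<open>Induction on \<open>m\<close>, downwards in the order of \<open>\<alpha>\<close>: a
  partial derivative of the remainder is the remainder for \<open>\<alpha>\<close> raised by one,
  and the remainder vanishes at \<open>a\<close>. Each application of \<open>axis_path_bound\<close>
  contributes one more factor \<open>CARD('d) * norm (x - a)\<close>.\<close>

lemma taylor_remainder:
  fixes D :: "('d::finite \<Rightarrow> nat) \<Rightarrow> real ^ 'd \<Rightarrow> real"
  assumes D: "partial_derivs unit_cube (\<gamma> - 1) f D" and K: "holder_norm unit_cube \<gamma> D \<le> ennreal K" "0 \<le> K"
    and a: "a \<in> unit_cube"
  shows "mi_abs \<alpha> + Suc m = \<gamma> \<Longrightarrow> x \<in> unit_cube \<Longrightarrow>
    \<bar>D \<alpha> x - taylor D (Suc m) \<alpha> a x\<bar> \<le> K * (real CARD('d) * norm (x - a)) ^ Suc m"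
proof (induction m arbitrary: \<alpha> x)
  case 0
  have "taylor D (Suc 0) \<alpha> a x = D \<alpha> a"
  proof -
    have "{\<beta> :: 'd \<Rightarrow> nat. mi_abs \<beta> < Suc 0} = {\<lambda>_. 0}"
      by (auto simp: mi_abs_def)
    then show ?thesis by (simp add: taylor_def taylor_monom_def)
  qed
  then show ?case
    using partial_derivs_lipschitz[OF D K, of \<alpha> x a] 0 a by (simp add: algebra_simps)
next
  case (Suc m)
  let ?u = "\<lambda>i. \<alpha>(i := Suc (\<alpha> i))"
  let ?G = "\<lambda>x. D \<alpha> x - taylor D (Suc (Suc m)) \<alpha> a x"
  let ?d = "real CARD('d)"
  have "\<bar>?G x - ?G a\<bar> \<le> ?d * (K * (?d * norm (x - a)) ^ Suc m) * norm (x - a)"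
  proof (rule axis_path_bound[where G' = "\<lambda>i z. D (?u i) z - taylor D (Suc m) (?u i) a z"])
    fix i and z :: "real ^ 'd" assume z: "z \<in> unit_cube"
    show "((\<lambda>t. ?G (z + t *\<^sub>R axis i 1)) has_real_derivative D (?u i) z - taylor D (Suc m) (?u i) a z)
        (at 0 within {t. z + t *\<^sub>R axis i 1 \<in> unit_cube})"
      using D Suc.prems z by (intro DERIV_diff taylor_deriv) (auto simp: partial_derivs_def)
    assume near: "norm (z - a) \<le> norm (x - a)"
    have "\<bar>D (?u i) z - taylor D (Suc m) (?u i) a z\<bar> \<le> K * (?d * norm (z - a)) ^ Suc m"
      using Suc.prems z mi_abs_upd[of \<alpha> i] by (intro Suc.IH[of "?u i"]) linarith+
    also have "\<dots> \<le> K * (?d * norm (x - a)) ^ Suc m"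
      using near K(2) by (intro mult_left_mono power_mono) auto
    finally show "\<bar>D (?u i) z - taylor D (Suc m) (?u i) a z\<bar> \<le> K * (?d * norm (x - a)) ^ Suc m" .
  qed (use a Suc.prems in auto)
  moreover have "?G a = 0" by (simp add: taylor_at_base)
  ultimately show ?case by (simp add: algebra_simps)
qed

section \<open>Blended Taylor polynomials and their networks\<close>

lemma clip01_diff: "\<bar>clip01 s - clip01 t\<bar> \<le> \<bar>s - t\<bar>"
  by (auto simp: clip01_def)

lemma clip01_eq: "t \<in> {0..1} \<Longrightarrow> clip01 t = t"
  by (auto simp: clip01_def)

lemma ramp_diff: "\<bar>ramp k j s - ramp k j t\<bar> \<le> 2 ^ k / 2 * \<bar>s - t\<bar>"
proof -
  have "\<bar>ramp k j s - ramp k j t\<bar> \<le> \<bar>(2 ^ k * s - (real j - 1)) / 2 - (2 ^ k * t - (real j - 1)) / 2\<bar>"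
    unfolding ramp_def by (rule clip01_diff)
  also have "\<dots> = \<bar>2 ^ k / 2 * (s - t)\<bar>"
    by (rule arg_cong[of _ _ abs]) (simp add: field_simps)
  finally show ?thesis by (simp add: abs_mult)
qed

lemma tent_ramp_diff: "\<bar>tent (ramp k j s) - tent (ramp k j t)\<bar> \<le> 2 ^ k * \<bar>s - t\<bar>"
  using tent_lipschitz[of "ramp k j s" "ramp k j t"] mult_left_mono[OF ramp_diff[of k j s t], of 2] by simp

lemma tent_ramp_range: "tent (ramp k j t) \<in> {0..1}"
  by (rule tent_range[OF ramp_range])

lemma tent_ramp_eq: "tent (ramp k j t) = max 0 (1 - \<bar>2 ^ k * t - real j\<bar>)"
proof -
  have "tent (clip01 v) = max 0 (1 - \<bar>2 * v - 1\<bar>)" for v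
    by (auto simp: tent_def clip01_def max_def min_def abs_if)
  moreover have "2 * ((2 ^ k * t - (real j - 1)) / 2) - 1 = 2 ^ k * t - real j"
    by (simp add: field_simps)
  ultimately show ?thesis
    unfolding ramp_def by (simp only:)
qed

text \<open>Hat functions added from the left form a plateau of height 1 up to \<open>J\<close> that
  falls linearly to 0 at \<open>J + 1\<close>; this closed form is what the induction needs.\<close>

lemma hat_sum:
  assumes "0 \<le> r"
  shows "(\<Sum>j\<le>J. max 0 (1 - \<bar>r - real j\<bar>)) = clip01 (real J + 1 - r)"
proof (induction J)
  case 0
  then show ?case using assms by (auto simp: clip01_def max_def min_def)
next
  case (Suc J)
  then show ?case using assms by (auto simp: clip01_def max_def min_def abs_if)
qed

lemma tent_ramp_sum:
  assumes "t \<in> {0..1}"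
  shows "(\<Sum>j\<le>2 ^ k. tent (ramp k j t)) = 1"
proof -
  have "(\<Sum>j\<le>2 ^ k. tent (ramp k j t)) = clip01 (real (2 ^ k) + 1 - 2 ^ k * t)"
    unfolding tent_ramp_eq using assms by (intro hat_sum) simp
  also have "2 ^ k * t \<le> 2 ^ k" using assms by simp
  then have "clip01 (real (2 ^ k) + 1 - 2 ^ k * t) = 1"
    by (simp add: clip01_def)
  finally show ?thesis .
qed

definition grid :: "nat \<Rightarrow> ('d::finite \<Rightarrow> nat) set" where
  "grid k = (\<Pi>\<^sub>E i\<in>UNIV. {..2 ^ k})"

lemma finite_grid: "finite (grid k)"
  unfolding grid_def by (intro finite_PiE) auto

lemma card_grid: "card (grid k :: ('d::finite \<Rightarrow> nat) set) = (2 ^ k + 1) ^ CARD('d)"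
  unfolding grid_def by (subst card_PiE) auto

definition bump :: "nat \<Rightarrow> ('d::finite \<Rightarrow> nat) \<Rightarrow> real ^ 'd \<Rightarrow> real" where
  "bump k q x = (\<Prod>i\<in>UNIV. tent (ramp k (q i) (x $ i)))"

text \<open>The Taylor expansions are based at the lower corner of the support of the bump function. For
  \<open>q i = 0\<close> this corner is moved into the cube, hence \<open>max (q i) 1\<close>.\<close>

definition base :: "nat \<Rightarrow> ('d::finite \<Rightarrow> nat) \<Rightarrow> real ^ 'd" where
  "base k q = (\<chi> i. (real (max (q i) 1) - 1) / 2 ^ k)"

text \<open>Where \<open>bump k q\<close> is nonzero in the cube, the ramp is
  \<open>x $ i - base k q $ i\<close> times \<open>2 ^ k / 2\<close>. Elsewhere it is clipped, so
  that all factors stay in [0, 1].\<close>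

definition scaled_monom :: "nat \<Rightarrow> ('d::finite \<Rightarrow> nat) \<Rightarrow> ('d \<Rightarrow> nat) \<Rightarrow> real ^ 'd \<Rightarrow> real" where
  "scaled_monom k q \<alpha> x = (\<Prod>i\<in>UNIV. ramp k (max (q i) 1) (x $ i) ^ \<alpha> i)"

lemma bump_sum:
  assumes "x \<in> unit_cube"
  shows "(\<Sum>q\<in>grid k. bump k q x) = 1"
proof -
  have "(\<Sum>q\<in>grid k. bump k q x) = (\<Prod>i\<in>UNIV. \<Sum>j\<le>2 ^ k. tent (ramp k j (x $ i)))"
    unfolding grid_def bump_def by (rule prod_sum_PiE[symmetric]) auto
  also have "\<dots> = 1"
    using assms by (intro prod.neutral) (auto simp: unit_cube_def tent_ramp_sum)
  finally show ?thesis .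
qed

lemma bump_range: "bump k q x \<in> {0..1}"
  using tent_ramp_range by (auto simp: bump_def intro!: prod_nonneg prod_le_1)

lemma bump_diff:
  fixes x y :: "real ^ 'd::finite"
  shows "\<bar>bump k q x - bump k q y\<bar> \<le> real CARD('d) * 2 ^ k * norm (x - y)"
proof -
  have r: "\<bar>tent (ramp k (q i) t)\<bar> \<le> 1" for i t
    using tent_ramp_range[of k "q i" t] by auto
  have "\<bar>bump k q x - bump k q y\<bar>
      \<le> (\<Sum>i\<in>UNIV. \<bar>tent (ramp k (q i) (x $ i)) - tent (ramp k (q i) (y $ i))\<bar>)"
    unfolding bump_def by (intro norm_prod_diff[where 'a = real, simplified] r)
  also have "\<dots> \<le> (\<Sum>i\<in>(UNIV :: 'd set). 2 ^ k * norm (x - y))"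
  proof (rule sum_mono)
    fix i
    have "2 ^ k * \<bar>x $ i - y $ i\<bar> \<le> 2 ^ k * norm (x - y)"
      using component_le_norm_cart[of "x - y" i] by simp
    then show "\<bar>tent (ramp k (q i) (x $ i)) - tent (ramp k (q i) (y $ i))\<bar> \<le> 2 ^ k * norm (x - y)"
      using tent_ramp_diff order_trans by blast
  qed
  finally show ?thesis by simp
qed

lemma bump_support:
  assumes "bump k q x \<noteq> 0"
  shows "\<bar>2 ^ k * x $ i - real (q i)\<bar> < 1"
proof -
  have "tent (ramp k (q i) (x $ i)) \<noteq> 0"
    using assms unfolding bump_def by auto
  then show ?thesis
    unfolding tent_ramp_eq by (auto simp: max_def split: if_splits)
qed

lemma card_active:
  fixes x :: "real ^ 'd::finite"
  assumes "x \<in> unit_cube"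
  shows "card {q \<in> grid k. bump k q x \<noteq> 0} \<le> 2 ^ CARD('d)"
proof -
  let ?B = "\<lambda>i. {nat \<lfloor>2 ^ k * x $ i\<rfloor>, Suc (nat \<lfloor>2 ^ k * x $ i\<rfloor>)}"
  have "q i \<in> ?B i" if "bump k q x \<noteq> 0" for q i
  proof -
    have "0 \<le> 2 ^ k * x $ i" using assms by (auto simp: unit_cube_def)
    moreover have "\<bar>2 ^ k * x $ i - real (q i)\<bar> < 1" by (rule bump_support[OF that])
    ultimately have "int (q i) = \<lfloor>2 ^ k * x $ i\<rfloor> \<or> int (q i) = \<lfloor>2 ^ k * x $ i\<rfloor> + 1" "0 \<le> \<lfloor>2 ^ k * x $ i\<rfloor>"
      by linarith+
    then show ?thesis by auto
  qed
  then have "{q \<in> grid k. bump k q x \<noteq> 0} \<subseteq> (\<Pi>\<^sub>E i\<in>UNIV. ?B i)"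
    unfolding PiE_UNIV_domain by blast
  then have "card {q \<in> grid k. bump k q x \<noteq> 0} \<le> card (\<Pi>\<^sub>E i\<in>UNIV. ?B i)"
    by (rule card_mono[rotated]) (intro finite_PiE; simp)
  also have "\<dots> = (\<Prod>i\<in>(UNIV :: 'd set). card (?B i))"
    by (rule card_PiE) simp
  also have "\<dots> = 2 ^ CARD('d)"
    by (simp add: numeral_2_eq_2)
  finally show ?thesis .
qed

lemma sum_active_bound:
  fixes x y :: "real ^ 'd::finite" and h :: "('d \<Rightarrow> nat) \<Rightarrow> real"
  assumes "x \<in> unit_cube" "y \<in> unit_cube" "0 \<le> B"
    and "\<And>q. bump k q x = 0 \<Longrightarrow> bump k q y = 0 \<Longrightarrow> h q = 0" "\<And>q. q \<in> grid k \<Longrightarrow> \<bar>h q\<bar> \<le> B"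
  shows "\<bar>\<Sum>q\<in>grid k. h q\<bar> \<le> 2 * 2 ^ CARD('d) * B"
proof -
  let ?A = "\<lambda>x. {q \<in> grid k. bump k q x \<noteq> 0}"
  have "(\<Sum>q\<in>grid k. h q) = (\<Sum>q\<in>?A x \<union> ?A y. h q)"
    using assms(4) finite_grid by (intro sum.mono_neutral_right) auto
  also have "\<bar>\<dots>\<bar> \<le> (\<Sum>q\<in>?A x \<union> ?A y. \<bar>h q\<bar>)"
    by (rule sum_abs)
  also have "\<dots> \<le> real (card (?A x \<union> ?A y)) * B"
    using assms(5) by (intro sum_bounded_above) auto
  also have "\<dots> \<le> real (2 * 2 ^ CARD('d)) * B"
  proof -
    have "card (?A x \<union> ?A y) \<le> 2 * 2 ^ CARD('d)"
      using card_Un_le[of "?A x" "?A y"] card_active[OF assms(1), of k] card_active[OF assms(2), of k]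
      by linarith
    then show ?thesis
      using assms(3) by (intro mult_right_mono) (simp_all only: of_nat_le_iff)
  qed
  finally show ?thesis by simp
qed

lemma base_in_cube:
  assumes "q \<in> grid k"
  shows "base k q \<in> unit_cube"
proof -
  have "real (max (q i) 1) \<le> 2 ^ k + 1" for i
  proof -
    have "max (q i) 1 \<le> 2 ^ k + 1"
      using assms by (auto simp: grid_def PiE_UNIV_domain Pi_iff le_SucI)
    then have "real (max (q i) 1) \<le> real (2 ^ k + 1)"
      by (simp only: of_nat_le_iff)
    then show ?thesis by simp
  qed
  then show ?thesis
    by (auto simp: unit_cube_def base_def field_simps)
qed

lemma ramp_on_support:
  assumes "x \<in> unit_cube" "bump k q x \<noteq> 0"
  shows "2 / 2 ^ k * ramp k (max (q i) 1) (x $ i) = x $ i - base k q $ i"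
    and "\<bar>x $ i - base k q $ i\<bar> \<le> 2 / 2 ^ k"
proof -
  define j where "j = max (q i) 1"
  define v where "v = 2 ^ k * x $ i - (real j - 1)"
  \<comment> \<open>For \<open>q i = 0\<close> the base has been moved to 0, and
    \<open>0 \<le> v\<close> then holds only because \<open>x\<close> is in the cube.\<close>
  have "0 \<le> 2 ^ k * x $ i" using assms(1) by (auto simp: unit_cube_def)
  moreover have "\<bar>2 ^ k * x $ i - real (q i)\<bar> < 1" by (rule bump_support[OF assms(2)])
  ultimately have v: "0 \<le> v" "v \<le> 2"
    by (auto simp: v_def j_def max_def not_le split: if_splits)
  have b: "x $ i - base k q $ i = v / 2 ^ k"
    by (simp add: base_def v_def j_def field_simps)
  have r: "ramp k j (x $ i) = v / 2"
    using v by (simp add: ramp_def v_def[symmetric] clip01_eq)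
  show "2 / 2 ^ k * ramp k (max (q i) 1) (x $ i) = x $ i - base k q $ i"
    unfolding b j_def[symmetric] r by simp
  show "\<bar>x $ i - base k q $ i\<bar> \<le> 2 / 2 ^ k"
    unfolding b using v by (simp add: divide_right_mono)
qed

lemma norm_base_le:
  fixes x :: "real ^ 'd::finite"
  assumes "x \<in> unit_cube" "bump k q x \<noteq> 0"
  shows "norm (x - base k q) \<le> real CARD('d) * (2 / 2 ^ k)"
proof -
  have "norm (x - base k q) \<le> (\<Sum>i\<in>UNIV. \<bar>(x - base k q) $ i\<bar>)"
    by (rule norm_le_l1_cart)
  also have "\<dots> \<le> (\<Sum>i\<in>(UNIV :: 'd set). 2 / 2 ^ k)"
    using ramp_on_support(2)[OF assms] by (intro sum_mono) simp
  finally show ?thesis by simp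
qed

lemma scaled_monom_diff:
  fixes x y :: "real ^ 'd::finite"
  shows "\<bar>scaled_monom k q \<alpha> x - scaled_monom k q \<alpha> y\<bar> \<le> real (mi_abs \<alpha>) * (2 ^ k / 2 * norm (x - y))"
proof -
  let ?u = "\<lambda>x i. ramp k (max (q i) 1) (x $ i)"
  have r: "\<bar>?u x i\<bar> \<le> 1" for x :: "real ^ 'd" and i
    using ramp_range[of k "max (q i) 1" "x $ i"] by simp
  have "\<bar>scaled_monom k q \<alpha> x - scaled_monom k q \<alpha> y\<bar> \<le> (\<Sum>i\<in>UNIV. \<bar>?u x i ^ \<alpha> i - ?u y i ^ \<alpha> i\<bar>)"
    unfolding scaled_monom_def using r
    by (intro norm_prod_diff[where 'a = real, simplified]) (auto simp: power_abs power_le_one)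
  also have "\<dots> \<le> (\<Sum>i\<in>UNIV. real (\<alpha> i) * (2 ^ k / 2 * norm (x - y)))"
  proof (rule sum_mono)
    fix i
    have "\<bar>?u x i ^ \<alpha> i - ?u y i ^ \<alpha> i\<bar> \<le> real (\<alpha> i) * \<bar>?u x i - ?u y i\<bar>"
      using norm_power_diff[of "?u x i" "?u y i" "\<alpha> i"] r by simp
    also have "\<bar>?u x i - ?u y i\<bar> \<le> 2 ^ k / 2 * \<bar>x $ i - y $ i\<bar>"
      by (rule ramp_diff)
    also have "\<dots> \<le> 2 ^ k / 2 * norm (x - y)"
      using component_le_norm_cart[of "x - y" i] by simp
    finally show "\<bar>?u x i ^ \<alpha> i - ?u y i ^ \<alpha> i\<bar> \<le> real (\<alpha> i) * (2 ^ k / 2 * norm (x - y))"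
      by (simp add: mult_left_mono)
  qed
  also have "\<dots> = real (mi_abs \<alpha>) * (2 ^ k / 2 * norm (x - y))"
    by (simp add: mi_abs_def sum_distrib_right)
  finally show ?thesis .
qed

section \<open>Constants of the estimates, and clipping to the cube\<close>

definition err_taylor :: "nat \<Rightarrow> nat \<Rightarrow> real" where
  "err_taylor d \<gamma> = (2 * real d ^ 2) ^ \<gamma>"

definition lip_poly :: "nat \<Rightarrow> nat \<Rightarrow> real" where
  "lip_poly d \<gamma> = real \<gamma> ^ d * (2 ^ \<gamma> * real \<gamma>)"

definition lip_blend :: "nat \<Rightarrow> nat \<Rightarrow> real" where
  "lip_blend d \<gamma> = lip_poly d \<gamma> + 2 * 2 ^ d * (lip_poly d \<gamma> + real d + real d * err_taylor d \<gamma>)"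

definition err_approx :: "nat \<Rightarrow> nat \<Rightarrow> nat \<Rightarrow> real" where
  "err_approx d \<gamma> \<kappa> = err_taylor d \<gamma> + 2 * 2 ^ d * (real \<gamma> ^ d * (2 ^ \<gamma> * 2 ^ \<kappa>))"

definition lip_approx :: "nat \<Rightarrow> nat \<Rightarrow> nat \<Rightarrow> real" where
  "lip_approx d \<gamma> \<kappa> = lip_blend d \<gamma> + 2 * 2 ^ d * (real \<gamma> ^ d * (2 ^ \<gamma> * ptree_lip \<kappa>))"

text \<open>Bounds the number of pairs of a grid point and a multi-index of order below
  \<open>\<gamma>\<close>.\<close>

definition num_pieces :: "nat \<Rightarrow> nat \<Rightarrow> nat \<Rightarrow> nat" where
  "num_pieces d \<gamma> k = (2 ^ k + 1) ^ d * \<gamma> ^ d"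

lemma num_pieces_le: "real (num_pieces d \<gamma> k) \<le> (2 * real \<gamma>) ^ d * (2 ^ k) ^ d"
proof -
  have "num_pieces d \<gamma> k \<le> (2 * 2 ^ k) ^ d * \<gamma> ^ d"
    unfolding num_pieces_def by (intro mult_le_mono power_mono) auto
  then have "real (num_pieces d \<gamma> k) \<le> real ((2 * 2 ^ k) ^ d * \<gamma> ^ d)"
    by (simp only: of_nat_le_iff)
  then show ?thesis by (simp add: power_mult_distrib mult_ac)
qed

definition clip_vec :: "real ^ 'd \<Rightarrow> real ^ 'd" where
  "clip_vec x = (\<chi> i. clip01 (x $ i))"

lemma clip_vec_cube: "clip_vec x \<in> unit_cube"
  using clip01_range by (simp add: clip_vec_def unit_cube_def)

lemma clip_vec_eq: "x \<in> unit_cube \<Longrightarrow> clip_vec x = x"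
  by (simp add: clip_vec_def unit_cube_def vec_eq_iff clip01_eq)

lemma clip_vec_diff: "norm (clip_vec x - clip_vec y) \<le> norm (x - y)"
  by (rule norm_le_componentwise_cart) (simp add: clip_vec_def clip01_diff)

text \<open>The \<open>2 ^ \<kappa>\<close> leaves of a product tree have room for one hat function
  per coordinate and a monomial of degree below \<open>\<gamma>\<close>. The enumeration
  \<open>es\<close> of the coordinates is there because the trees take lists.\<close>

locale holder_interpolation =
  fixes \<gamma> :: nat and f :: "real ^ 'd::finite \<Rightarrow> real" and D :: "('d \<Rightarrow> nat) \<Rightarrow> real ^ 'd \<Rightarrow> real"
    and K :: real and k :: nat and \<kappa> :: nat and es :: "'d list"
  assumes \<gamma>: "1 \<le> \<gamma>" and D: "partial_derivs unit_cube (\<gamma> - 1) f D"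
    and K: "holder_norm unit_cube \<gamma> D \<le> ennreal K" "0 \<le> K"
    and \<kappa>: "CARD('d) + \<gamma> \<le> 2 ^ \<kappa>" and es: "set es = UNIV" "distinct es"
begin

section \<open>Local Taylor polynomials and their blend\<close>

definition coef :: "('d \<Rightarrow> nat) \<Rightarrow> ('d \<Rightarrow> nat) \<Rightarrow> real" where
  "coef q \<alpha> = D \<alpha> (base k q) * (2 / 2 ^ k) ^ mi_abs \<alpha> / (\<Prod>i\<in>UNIV. fact (\<alpha> i))"

definition local_poly :: "('d \<Rightarrow> nat) \<Rightarrow> real ^ 'd \<Rightarrow> real" where
  "local_poly q x = (\<Sum>\<alpha> | mi_abs \<alpha> < \<gamma>. coef q \<alpha> * scaled_monom k q \<alpha> x)"

definition blend :: "real ^ 'd \<Rightarrow> real" where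
  "blend x = (\<Sum>q\<in>grid k. bump k q x * local_poly q x)"

lemma D_0: "x \<in> unit_cube \<Longrightarrow> D (\<lambda>_. 0) x = f x"
  using D by (simp add: partial_derivs_def)

lemma f_diff:
  assumes "x \<in> unit_cube" "y \<in> unit_cube"
  shows "\<bar>f x - f y\<bar> \<le> real CARD('d) * K * norm (x - y)"
  using partial_derivs_lipschitz[OF D K _ assms, of "\<lambda>_. 0"] \<gamma> assms by (simp add: mi_abs_0 D_0)

lemma coef_bound:
  assumes "q \<in> grid k" "mi_abs \<alpha> < \<gamma>"
  shows "\<bar>coef q \<alpha>\<bar> \<le> K * (2 / 2 ^ k) ^ mi_abs \<alpha>"
proof -
  have D': "\<bar>D \<alpha> (base k q)\<bar> \<le> K"
    using holder_norm_bound[OF K assms(2) base_in_cube[OF assms(1)]] .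
  have "1 \<le> (\<Prod>i\<in>UNIV. fact (\<alpha> i) :: real)"
    by (intro prod_ge_1) auto
  then have "\<bar>coef q \<alpha>\<bar> \<le> \<bar>D \<alpha> (base k q)\<bar> * (2 / 2 ^ k) ^ mi_abs \<alpha> / 1"
    unfolding coef_def abs_divide abs_mult by (intro frac_le) auto
  also have "\<dots> \<le> K * (2 / 2 ^ k) ^ mi_abs \<alpha>"
    using D' by (simp add: mult_right_mono)
  finally show ?thesis .
qed

lemma coef_bound':
  assumes "q \<in> grid k" "mi_abs \<alpha> < \<gamma>"
  shows "\<bar>coef q \<alpha>\<bar> \<le> K * 2 ^ \<gamma>"
proof -
  have "(2 / 2 ^ k) ^ mi_abs \<alpha> \<le> (2 :: real) ^ mi_abs \<alpha>"
    by (intro power_mono) (auto simp: field_simps)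
  also have "\<dots> \<le> 2 ^ \<gamma>"
    using assms(2) by (intro power_increasing) auto
  finally have "K * (2 / 2 ^ k) ^ mi_abs \<alpha> \<le> K * 2 ^ \<gamma>"
    using K(2) by (rule mult_left_mono)
  with coef_bound[OF assms] show ?thesis by linarith
qed

text \<open>Applied to the scale \<open>r = 2 / 2 ^ k\<close> in a coefficient and the slope
  \<open>s = 2 ^ k / 2\<close> of a ramp. One factor \<open>r\<close> cancels the slope; for
  \<open>n = 0\<close> there is no such factor, but then the monomial is constant.\<close>

lemma power_mult_inverse_le:
  fixes r s :: real
  assumes "r * s = 1" "0 \<le> r" "r \<le> 2" "n < N"
  shows "r ^ n * s * real n \<le> 2 ^ N * real N"
proof (cases n)
  case (Suc p)
  have "r ^ n * s = r ^ p * (r * s)"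
    unfolding Suc power_Suc2 by (rule mult.assoc)
  also have "\<dots> \<le> 2 ^ p"
    using assms by (simp add: power_mono)
  also have "\<dots> \<le> 2 ^ N"
    using assms(4) Suc by (intro power_increasing) auto
  finally show ?thesis
    using assms(4) by (intro mult_mono) auto
qed simp

lemma local_poly_diff:
  assumes "q \<in> grid k"
  shows "\<bar>local_poly q x - local_poly q y\<bar> \<le> lip_poly CARD('d) \<gamma> * K * norm (x - y)"
proof -
  define r s where "r = (2 :: real) / 2 ^ k" and "s = (2 :: real) ^ k / 2"
  have rs: "r * s = 1" "0 \<le> r" "r \<le> 2"
    by (simp_all add: r_def s_def field_simps)
  let ?I = "{\<alpha> :: 'd \<Rightarrow> nat. mi_abs \<alpha> < \<gamma>}"
  let ?t = "\<lambda>\<alpha>. coef q \<alpha> * (scaled_monom k q \<alpha> x - scaled_monom k q \<alpha> y)"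
  let ?B = "K * norm (x - y) * (2 ^ \<gamma> * real \<gamma>)"
  have bound: "\<bar>?t \<alpha>\<bar> \<le> ?B" if "\<alpha> \<in> ?I" for \<alpha>
  proof -
    have \<alpha>: "mi_abs \<alpha> < \<gamma>" using that by simp
    have c: "\<bar>coef q \<alpha>\<bar> \<le> K * r ^ mi_abs \<alpha>"
      unfolding r_def by (rule coef_bound[OF assms \<alpha>])
    have m: "\<bar>scaled_monom k q \<alpha> x - scaled_monom k q \<alpha> y\<bar> \<le> real (mi_abs \<alpha>) * (s * norm (x - y))"
      unfolding s_def by (rule scaled_monom_diff)
    have "\<bar>?t \<alpha>\<bar> \<le> K * r ^ mi_abs \<alpha> * (real (mi_abs \<alpha>) * (s * norm (x - y)))"
      unfolding abs_mult using K(2) rs(2) by (intro mult_mono[OF c m]) simp_all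
    also have "\<dots> = K * norm (x - y) * (r ^ mi_abs \<alpha> * s * real (mi_abs \<alpha>))"
      by (simp only: mult_ac)
    also have "\<dots> \<le> ?B"
      using K(2) by (intro mult_left_mono power_mult_inverse_le rs \<alpha>) simp_all
    finally show ?thesis .
  qed
  have "local_poly q x - local_poly q y = (\<Sum>\<alpha>\<in>?I. ?t \<alpha>)"
    by (simp add: local_poly_def sum_subtractf right_diff_distrib)
  then have "\<bar>local_poly q x - local_poly q y\<bar> \<le> (\<Sum>\<alpha>\<in>?I. \<bar>?t \<alpha>\<bar>)"
    by (simp only: sum_abs)
  also have "\<dots> \<le> real (card ?I) * ?B"
    using sum_bounded_above[of ?I "\<lambda>\<alpha>. \<bar>?t \<alpha>\<bar>" ?B] bound by blast
  also have "\<dots> \<le> real (\<gamma> ^ CARD('d)) * ?B"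
    using K(2) card_multi_indices[where 'd = 'd, of \<gamma>]
    by (intro mult_right_mono) (simp_all only: of_nat_le_iff zero_le_mult_iff, simp_all)
  also have "\<dots> = lip_poly CARD('d) \<gamma> * K * norm (x - y)"
    unfolding lip_poly_def of_nat_power by (simp only: mult_ac)
  finally show ?thesis .
qed

lemma local_poly_eq_taylor:
  assumes "x \<in> unit_cube" "bump k q x \<noteq> 0"
  shows "local_poly q x = taylor D \<gamma> (\<lambda>_. 0) (base k q) x"
  unfolding local_poly_def taylor_def
proof (rule sum.cong)
  fix \<alpha> :: "'d \<Rightarrow> nat"
  have "(2 / 2 ^ k) ^ mi_abs \<alpha> * scaled_monom k q \<alpha> x
      = (\<Prod>i\<in>UNIV. (2 / 2 ^ k * ramp k (max (q i) 1) (x $ i)) ^ \<alpha> i)"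
    by (simp only: mi_abs_def scaled_monom_def power_sum prod.distrib[symmetric] power_mult_distrib)
  also have "\<dots> = (\<Prod>i\<in>UNIV. (x $ i - base k q $ i) ^ \<alpha> i)"
    by (simp only: ramp_on_support(1)[OF assms])
  finally have *: "(2 / 2 ^ k) ^ mi_abs \<alpha> * scaled_monom k q \<alpha> x = (\<Prod>i\<in>UNIV. (x $ i - base k q $ i) ^ \<alpha> i)" .
  have "coef q \<alpha> * scaled_monom k q \<alpha> x
      = D \<alpha> (base k q) * (((2 / 2 ^ k) ^ mi_abs \<alpha> * scaled_monom k q \<alpha> x) / (\<Prod>i\<in>UNIV. fact (\<alpha> i)))"
    by (simp add: coef_def)
  also have "\<dots> = D (\<lambda>j. 0 + \<alpha> j) (base k q) * taylor_monom (base k q) \<alpha> x"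
    unfolding * by (simp add: taylor_monom_def prod_dividef)
  finally show "coef q \<alpha> * scaled_monom k q \<alpha> x = D (\<lambda>j. 0 + \<alpha> j) (base k q) * taylor_monom (base k q) \<alpha> x" .
qed simp

lemma local_poly_error:
  assumes "x \<in> unit_cube" "q \<in> grid k" "bump k q x \<noteq> 0"
  shows "\<bar>local_poly q x - f x\<bar> \<le> K * err_taylor CARD('d) \<gamma> / (2 ^ k) ^ \<gamma>"
proof -
  have "\<bar>D (\<lambda>_. 0) x - taylor D (Suc (\<gamma> - 1)) (\<lambda>_. 0) (base k q) x\<bar>
      \<le> K * (real CARD('d) * norm (x - base k q)) ^ Suc (\<gamma> - 1)"
    using \<gamma> assms(1) base_in_cube[OF assms(2)] by (intro taylor_remainder[OF D K]) (auto simp: mi_abs_0)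
  also have "\<dots> \<le> K * (real CARD('d) * (real CARD('d) * (2 / 2 ^ k))) ^ Suc (\<gamma> - 1)"
    using norm_base_le[OF assms(1,3)] K(2) by (intro mult_left_mono power_mono) auto
  also have "real CARD('d) * (real CARD('d) * (2 / 2 ^ k)) = (2 * real CARD('d) ^ 2) / 2 ^ k"
    by (simp add: power2_eq_square)
  finally show ?thesis
    using \<gamma> assms(1) by (simp add: local_poly_eq_taylor[OF assms(1,3)] D_0 err_taylor_def power_divide abs_minus_commute)
qed

text \<open>A single power of \<open>2 ^ -k\<close> is what \<open>blend_diff\<close> needs against
  the slope of the bump functions.\<close>

lemma err_taylor_scaled_le: "K * err_taylor CARD('d) \<gamma> / (2 ^ k) ^ \<gamma> \<le> K * err_taylor CARD('d) \<gamma> / 2 ^ k"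
proof -
  have "(2 ^ k) ^ 1 \<le> ((2 :: real) ^ k) ^ \<gamma>"
    using \<gamma> by (intro power_increasing) auto
  then show ?thesis
    using K(2) by (intro divide_left_mono) (auto simp: err_taylor_def)
qed

lemma blend_error:
  assumes "x \<in> unit_cube"
  shows "\<bar>blend x - f x\<bar> \<le> K * err_taylor CARD('d) \<gamma> / (2 ^ k) ^ \<gamma>"
proof -
  let ?E = "K * err_taylor CARD('d) \<gamma> / (2 ^ k) ^ \<gamma>"
  have "blend x - f x = (\<Sum>q\<in>grid k. bump k q x * (local_poly q x - f x))"
    using bump_sum[OF assms, of k]
    by (simp add: blend_def right_diff_distrib sum_subtractf sum_distrib_right[symmetric])
  also have "\<bar>\<dots>\<bar> \<le> (\<Sum>q\<in>grid k. \<bar>bump k q x * (local_poly q x - f x)\<bar>)"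
    by (rule sum_abs)
  also have "\<dots> \<le> (\<Sum>q\<in>grid k. bump k q x * ?E)"
  proof (rule sum_mono)
    fix q assume q: "q \<in> (grid k :: ('d \<Rightarrow> nat) set)"
    show "\<bar>bump k q x * (local_poly q x - f x)\<bar> \<le> bump k q x * ?E"
    proof (cases "bump k q x = 0")
      case False
      then show ?thesis
        unfolding abs_mult using local_poly_error[OF assms q] bump_range[of k q x] by (intro mult_mono) auto
    qed simp
  qed
  also have "\<dots> = ?E"
    using bump_sum[OF assms, of k] by (simp only: sum_distrib_right[symmetric] mult_1_left)
  finally show ?thesis .
qed

lemma err_taylor_nonneg: "0 \<le> err_taylor CARD('d) \<gamma>"
  by (simp add: err_taylor_def)

lemma lip_poly_nonneg: "0 \<le> lip_poly CARD('d) \<gamma>"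
  by (simp add: lip_poly_def)

text \<open>The gradients of the bump functions, of size \<open>2 ^ k\<close>, sum to zero, so they only see the
  differences of the local polynomials from \<open>f\<close>.\<close>

lemma blend_diff:
  assumes x: "x \<in> unit_cube" and y: "y \<in> unit_cube"
  shows "\<bar>blend x - blend y\<bar> \<le> lip_blend CARD('d) \<gamma> * K * norm (x - y)"
proof -
  define d \<rho> where "d = real CARD('d)" and "\<rho> = norm (x - y)"
  let ?b = "\<lambda>q. bump k q x - bump k q y"
  define e where "e = K * err_taylor CARD('d) \<gamma> / 2 ^ k"
  define s where "s = (lip_poly CARD('d) \<gamma> + d) * K * \<rho>"
  define t where "t = d * err_taylor CARD('d) \<gamma> * K * \<rho>"
  have nn: "0 \<le> e" "0 \<le> s" "0 \<le> t"
    using K(2) err_taylor_nonneg lip_poly_nonneg by (simp_all add: e_def s_def t_def d_def \<rho>_def)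
  have te: "d * 2 ^ k * \<rho> * e = t"
    by (simp add: e_def t_def)
  have b: "\<bar>?b q\<bar> * e \<le> t" for q
    using mult_right_mono[OF bump_diff[of k q x y] nn(1)] te by (simp only: d_def \<rho>_def)
  have b1: "\<bar>?b q\<bar> \<le> 1" for q
    using bump_range[of k q x] bump_range[of k q y] by auto
  have term_le: "\<bar>?b q * (local_poly q y - f y)\<bar> \<le> s + t" if q: "q \<in> grid k" for q
  proof -
    have err: "\<bar>local_poly q z - f z\<bar> \<le> e" if "z \<in> unit_cube" "bump k q z \<noteq> 0" for z
      using local_poly_error[OF that(1) q that(2)] err_taylor_scaled_le unfolding e_def by linarith
    consider "bump k q y \<noteq> 0" | "bump k q y = 0" "bump k q x = 0" | "bump k q y = 0" "bump k q x \<noteq> 0"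
      by blast
    then show ?thesis
    proof cases
      case 1
      have "\<bar>?b q * (local_poly q y - f y)\<bar> \<le> \<bar>?b q\<bar> * e"
        unfolding abs_mult using err[OF y 1] by (intro mult_left_mono) auto
      with b[of q] nn show ?thesis by linarith
    next
      case 2
      with nn show ?thesis by simp
    next
      case 3
      \<comment> \<open>The Taylor error is available only where the bump function is nonzero, here
        at \<open>x\<close>; it is carried over to \<open>y\<close> by the Lipschitz bounds of the
        local polynomial and of \<open>f\<close>.\<close>
      have "local_poly q y - f y = (local_poly q y - local_poly q x) + (local_poly q x - f x) + (f x - f y)"
        by simp
      then have "\<bar>local_poly q y - f y\<bar> \<le> \<bar>local_poly q y - local_poly q x\<bar> + \<bar>local_poly q x - f x\<bar> + \<bar>f x - f y\<bar>"
        by linarith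
      also have "\<dots> \<le> lip_poly CARD('d) \<gamma> * K * \<rho> + e + d * K * \<rho>"
        using local_poly_diff[OF q, of y x] err[OF x 3(2)] f_diff[OF x y]
        unfolding d_def \<rho>_def by (simp only: norm_minus_commute[of y x])
      also have "\<dots> = s + e"
        by (simp add: s_def distrib_right)
      finally have "\<bar>?b q * (local_poly q y - f y)\<bar> \<le> \<bar>?b q\<bar> * (s + e)"
        unfolding abs_mult by (rule mult_left_mono) simp
      also have "\<dots> = \<bar>?b q\<bar> * s + \<bar>?b q\<bar> * e"
        by (rule distrib_left)
      \<comment> \<open>\<open>s\<close> already contains the distance, so the trivial bound 1 on
        the bump difference suffices there; \<open>e\<close> does not, and uses the slope
        bound.\<close>
      also have "\<dots> \<le> 1 * s + t"
        using b1[of q] nn(2) b[of q] by (intro add_mono mult_right_mono)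
      finally show ?thesis by simp
    qed
  qed
  have "(\<Sum>q\<in>grid k. ?b q * f y) = 0"
    using bump_sum[OF x, of k] bump_sum[OF y, of k]
    by (simp add: sum_distrib_right[symmetric] sum_subtractf)
  then have "blend x - blend y
      = (\<Sum>q\<in>grid k. (bump k q x * local_poly q x - bump k q y * local_poly q y) - ?b q * f y)"
    by (simp add: blend_def sum_subtractf)
  also have "\<dots> = (\<Sum>q\<in>grid k. bump k q x * (local_poly q x - local_poly q y) + ?b q * (local_poly q y - f y))"
    by (intro sum.cong) (simp_all add: algebra_simps)
  finally have eq: "blend x - blend y = (\<Sum>q\<in>grid k. bump k q x * (local_poly q x - local_poly q y))
      + (\<Sum>q\<in>grid k. ?b q * (local_poly q y - f y))"
    by (simp only: sum.distrib)
  have "\<bar>blend x - blend y\<bar> \<le> \<bar>\<Sum>q\<in>grid k. bump k q x * (local_poly q x - local_poly q y)\<bar>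
      + \<bar>\<Sum>q\<in>grid k. ?b q * (local_poly q y - f y)\<bar>"
    unfolding eq by (rule abs_triangle_ineq)
  also have "\<dots> \<le> lip_poly CARD('d) \<gamma> * K * \<rho> + 2 * 2 ^ CARD('d) * (s + t)"
  proof (rule add_mono)
    have "\<bar>\<Sum>q\<in>grid k. bump k q x * (local_poly q x - local_poly q y)\<bar>
        \<le> (\<Sum>q\<in>grid k. \<bar>bump k q x * (local_poly q x - local_poly q y)\<bar>)"
      by (rule sum_abs)
    also have "\<dots> \<le> (\<Sum>q\<in>grid k. bump k q x * (lip_poly CARD('d) \<gamma> * K * \<rho>))"
    proof (rule sum_mono)
      fix q assume q: "q \<in> (grid k :: ('d \<Rightarrow> nat) set)"
      have "\<bar>bump k q x\<bar> = bump k q x" "0 \<le> bump k q x"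
        using bump_range[of k q x] by simp_all
      then show "\<bar>bump k q x * (local_poly q x - local_poly q y)\<bar> \<le> bump k q x * (lip_poly CARD('d) \<gamma> * K * \<rho>)"
        unfolding abs_mult \<rho>_def using local_poly_diff[OF q, of x y] by (simp only: mult_left_mono)
    qed
    also have "\<dots> = lip_poly CARD('d) \<gamma> * K * \<rho>"
      using bump_sum[OF x, of k] by (simp only: sum_distrib_right[symmetric] mult_1_left)
    finally show "\<bar>\<Sum>q\<in>grid k. bump k q x * (local_poly q x - local_poly q y)\<bar> \<le> lip_poly CARD('d) \<gamma> * K * \<rho>" .
    show "\<bar>\<Sum>q\<in>grid k. ?b q * (local_poly q y - f y)\<bar> \<le> 2 * 2 ^ CARD('d) * (s + t)"
      by (rule sum_active_bound[OF x y _ _ term_le]) (use nn in simp_all)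
  qed
  also have "\<dots> = lip_blend CARD('d) \<gamma> * K * \<rho>"
    by (simp add: lip_blend_def s_def t_def d_def algebra_simps)
  finally show ?thesis unfolding \<rho>_def .
qed

section \<open>Approximate products and the approximant\<close>

definition factors :: "('d \<Rightarrow> nat) \<Rightarrow> ('d \<Rightarrow> nat) \<Rightarrow> (real ^ 'd \<Rightarrow> real) list" where
  "factors q \<alpha> = map (\<lambda>i x. tent (ramp k (q i) (x $ i))) es
    @ concat (map (\<lambda>i. replicate (\<alpha> i) (\<lambda>x. ramp k (max (q i) 1) (x $ i))) es)
    @ replicate (2 ^ \<kappa> - (CARD('d) + mi_abs \<alpha>)) (\<lambda>_. 1)"

definition piece :: "('d \<Rightarrow> nat) \<Rightarrow> ('d \<Rightarrow> nat) \<Rightarrow> real ^ 'd \<Rightarrow> real" where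
  "piece q \<alpha> x = ptree (k * \<gamma>) \<kappa> (map (\<lambda>u. u x) (factors q \<alpha>))"

definition approx :: "real ^ 'd \<Rightarrow> real" where
  "approx x = (\<Sum>q\<in>grid k. \<Sum>\<alpha> | mi_abs \<alpha> < \<gamma>. coef q \<alpha> * piece q \<alpha> x)"

lemma length_factors:
  assumes "mi_abs \<alpha> < \<gamma>"
  shows "length (factors q \<alpha>) = 2 ^ \<kappa>"
proof -
  have "length es = CARD('d)"
    using distinct_card[OF es(2)] es(1) by simp
  moreover have "(\<Sum>i\<leftarrow>es. \<alpha> i) = mi_abs \<alpha>"
    using sum_list_distinct_conv_sum_set[OF es(2), of \<alpha>] es(1) by (simp add: mi_abs_def)
  ultimately show ?thesis
    using assms \<kappa> by (simp add: factors_def length_concat o_def)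
qed

lemma prod_factors: "prod_list (map (\<lambda>u. u x) (factors q \<alpha>)) = bump k q x * scaled_monom k q \<alpha> x"
proof -
  have "prod_list (map (\<lambda>u. u x) (concat (map (\<lambda>i. replicate (\<alpha> i) (\<lambda>x. ramp k (max (q i) 1) (x $ i))) zs)))
      = (\<Prod>i\<leftarrow>zs. ramp k (max (q i) 1) (x $ i) ^ \<alpha> i)" for zs
    by (induction zs) (simp_all add: prod_list_replicate)
  then show ?thesis
    by (simp add: factors_def prod_list_replicate bump_def scaled_monom_def o_def
        prod.distinct_set_conv_list[OF es(2), unfolded es(1)])
qed

lemma factors_cases:
  assumes "u \<in> set (factors q \<alpha>)"
  obtains i where "u = (\<lambda>x. tent (ramp k (q i) (x $ i)))"
  | i where "u = (\<lambda>x. ramp k (max (q i) 1) (x $ i))"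
  | "u = (\<lambda>_. 1)"
  using assms unfolding factors_def by (auto split: if_splits)

lemma factors_range:
  assumes "u \<in> set (factors q \<alpha>)"
  shows "u x \<in> {0..1}"
  using assms by (cases rule: factors_cases) (use ramp_range tent_ramp_range in auto)

lemma factors_diff:
  assumes "u \<in> set (factors q \<alpha>)"
  shows "\<bar>u x - u y\<bar> \<le> 2 ^ k * norm (x - y)"
proof -
  have c: "2 ^ k * \<bar>x $ i - y $ i\<bar> \<le> 2 ^ k * norm (x - y)" for i
    using component_le_norm_cart[of "x - y" i] by simp
  from assms show ?thesis
  proof (cases rule: factors_cases)
    case (1 i)
    show ?thesis unfolding 1 by (rule order_trans[OF tent_ramp_diff c])
  next
    case (2 i)
    have "2 ^ k / 2 * \<bar>x $ i - y $ i\<bar> \<le> 2 ^ k * \<bar>x $ i - y $ i\<bar>"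
      by (intro mult_right_mono) auto
    from order_trans[OF ramp_diff order_trans[OF this c]] show ?thesis unfolding 2 .
  qed simp
qed

lemma piece_range:
  assumes "mi_abs \<alpha> < \<gamma>"
  shows "piece q \<alpha> x \<in> {0..1}"
  unfolding piece_def by (rule ptree_range) (use length_factors[OF assms] factors_range in auto)

lemma piece_error:
  assumes "mi_abs \<alpha> < \<gamma>"
  shows "\<bar>piece q \<alpha> x - bump k q x * scaled_monom k q \<alpha> x\<bar> \<le> 2 ^ \<kappa> / (2 ^ k) ^ \<gamma>"
proof -
  have "\<bar>piece q \<alpha> x - bump k q x * scaled_monom k q \<alpha> x\<bar> \<le> (2 ^ \<kappa> - 1) / 4 ^ (k * \<gamma>)"
    unfolding piece_def prod_factors[symmetric]
    by (rule ptree_error) (use length_factors[OF assms] factors_range in auto)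
  also have "\<dots> \<le> 2 ^ \<kappa> / 2 ^ (k * \<gamma>)"
    by (intro frac_le power_mono) auto
  finally show ?thesis by (simp only: power_mult)
qed

lemma piece_zero:
  assumes "mi_abs \<alpha> < \<gamma>" "bump k q x = 0"
  shows "piece q \<alpha> x = 0"
proof -
  obtain i where "tent (ramp k (q i) (x $ i)) = 0"
    using assms(2) unfolding bump_def by auto
  then have "0 \<in> set (map (\<lambda>u. u x) (factors q \<alpha>))"
    using es(1) by (auto simp: factors_def image_iff)
  then show ?thesis
    unfolding piece_def by (intro ptree_zero) (use length_factors[OF assms(1)] factors_range in auto)
qed

lemma piece_error_diff:
  assumes "mi_abs \<alpha> < \<gamma>"
  shows "\<bar>(piece q \<alpha> x - bump k q x * scaled_monom k q \<alpha> x) - (piece q \<alpha> y - bump k q y * scaled_monom k q \<alpha> y)\<bar>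
    \<le> ptree_lip \<kappa> * norm (x - y)"
proof -
  have "\<bar>(piece q \<alpha> x - bump k q x * scaled_monom k q \<alpha> x) - (piece q \<alpha> y - bump k q y * scaled_monom k q \<alpha> y)\<bar>
      \<le> ptree_lip \<kappa> * (2 ^ k * norm (x - y)) / 2 ^ (k * \<gamma>)"
    unfolding piece_def prod_factors[symmetric]
  proof (rule ptree_error_lipschitz)
    fix i :: nat assume "i < 2 ^ \<kappa>"
    then have "i < length (factors q \<alpha>)" using length_factors[OF assms] by simp
    then show "\<bar>map (\<lambda>u. u x) (factors q \<alpha>) ! i - map (\<lambda>u. u y) (factors q \<alpha>) ! i\<bar> \<le> 2 ^ k * norm (x - y)"
      using factors_diff[OF nth_mem] by simp
  qed (use length_factors[OF assms] factors_range in auto)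
  also have "\<dots> = ptree_lip \<kappa> * norm (x - y) * (2 ^ k / 2 ^ (k * \<gamma>))"
    by simp
  also have "\<dots> \<le> ptree_lip \<kappa> * norm (x - y) * 1"
    using \<gamma> by (intro mult_left_mono) (auto simp: ptree_lip_nonneg intro!: power_increasing)
  finally show ?thesis by simp
qed

lemma coef_sum_bound:
  assumes "q \<in> grid k" "\<And>\<alpha>. mi_abs \<alpha> < \<gamma> \<Longrightarrow> \<bar>e \<alpha>\<bar> \<le> b" "0 \<le> b"
  shows "\<bar>\<Sum>\<alpha> | mi_abs \<alpha> < \<gamma>. coef q \<alpha> * e \<alpha>\<bar> \<le> real \<gamma> ^ CARD('d) * (K * 2 ^ \<gamma> * b)"
proof -
  let ?I = "{\<alpha> :: 'd \<Rightarrow> nat. mi_abs \<alpha> < \<gamma>}"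
  have t: "\<bar>coef q \<alpha> * e \<alpha>\<bar> \<le> K * 2 ^ \<gamma> * b" if "\<alpha> \<in> ?I" for \<alpha>
    unfolding abs_mult using coef_bound'[OF assms(1), of \<alpha>] assms(2)[of \<alpha>] that K(2) by (intro mult_mono) auto
  have "\<bar>\<Sum>\<alpha>\<in>?I. coef q \<alpha> * e \<alpha>\<bar> \<le> (\<Sum>\<alpha>\<in>?I. \<bar>coef q \<alpha> * e \<alpha>\<bar>)"
    by (rule sum_abs)
  also have "\<dots> \<le> real (card ?I) * (K * 2 ^ \<gamma> * b)"
    using sum_bounded_above[of ?I "\<lambda>\<alpha>. \<bar>coef q \<alpha> * e \<alpha>\<bar>" "K * 2 ^ \<gamma> * b"] t by blast
  also have "\<dots> \<le> real (\<gamma> ^ CARD('d)) * (K * 2 ^ \<gamma> * b)"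
  proof (rule mult_right_mono)
    show "real (card ?I) \<le> real (\<gamma> ^ CARD('d))"
      using card_multi_indices[where 'd = 'd, of \<gamma>] by (simp only: of_nat_le_iff)
  qed (use K(2) assms(3) in simp)
  finally show ?thesis by simp
qed

lemma approx_blend:
  "approx x - blend x = (\<Sum>q\<in>grid k. \<Sum>\<alpha> | mi_abs \<alpha> < \<gamma>.
     coef q \<alpha> * (piece q \<alpha> x - bump k q x * scaled_monom k q \<alpha> x))"
  by (simp add: approx_def blend_def local_poly_def right_diff_distrib sum_subtractf sum_distrib_left mult.left_commute)

lemma approx_error:
  assumes "x \<in> unit_cube"
  shows "\<bar>approx x - f x\<bar> \<le> K * err_approx CARD('d) \<gamma> \<kappa> / (2 ^ k) ^ \<gamma>"
proof -
  let ?M = "(2 ^ k) ^ \<gamma> :: real"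
  have "\<bar>approx x - blend x\<bar> \<le> 2 * 2 ^ CARD('d) * (real \<gamma> ^ CARD('d) * (K * 2 ^ \<gamma> * (2 ^ \<kappa> / ?M)))"
    unfolding approx_blend
  proof (rule sum_active_bound[OF assms assms])
    show "(\<Sum>\<alpha> | mi_abs \<alpha> < \<gamma>. coef q \<alpha> * (piece q \<alpha> x - bump k q x * scaled_monom k q \<alpha> x)) = 0"
      if "bump k q x = 0" for q
      using piece_zero[OF _ that] that by (intro sum.neutral) simp
    show "\<bar>\<Sum>\<alpha> | mi_abs \<alpha> < \<gamma>. coef q \<alpha> * (piece q \<alpha> x - bump k q x * scaled_monom k q \<alpha> x)\<bar>
        \<le> real \<gamma> ^ CARD('d) * (K * 2 ^ \<gamma> * (2 ^ \<kappa> / ?M))" if "q \<in> grid k" for q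
      by (rule coef_sum_bound[OF that piece_error]) simp_all
  qed (use K(2) in simp)
  moreover have "\<bar>blend x - f x\<bar> \<le> K * err_taylor CARD('d) \<gamma> / ?M"
    by (rule blend_error[OF assms])
  ultimately have "\<bar>approx x - f x\<bar> \<le> 2 * 2 ^ CARD('d) * (real \<gamma> ^ CARD('d) * (K * 2 ^ \<gamma> * (2 ^ \<kappa> / ?M)))
      + K * err_taylor CARD('d) \<gamma> / ?M"
    by linarith
  also have "\<dots> = K * err_approx CARD('d) \<gamma> \<kappa> / ?M"
    by (simp add: err_approx_def field_simps)
  finally show ?thesis .
qed

lemma approx_diff:
  assumes x: "x \<in> unit_cube" and y: "y \<in> unit_cube"
  shows "\<bar>approx x - approx y\<bar> \<le> K * lip_approx CARD('d) \<gamma> \<kappa> * norm (x - y)"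
proof -
  let ?e = "\<lambda>q \<alpha> x. piece q \<alpha> x - bump k q x * scaled_monom k q \<alpha> x"
  let ?h = "\<lambda>q. \<Sum>\<alpha> | mi_abs \<alpha> < \<gamma>. coef q \<alpha> * (?e q \<alpha> x - ?e q \<alpha> y)"
  have eq: "(approx x - blend x) - (approx y - blend y) = (\<Sum>q\<in>grid k. ?h q)"
    unfolding approx_blend by (simp only: sum_subtractf[symmetric] right_diff_distrib[symmetric])
  have "\<bar>\<Sum>q\<in>grid k. ?h q\<bar>
      \<le> 2 * 2 ^ CARD('d) * (real \<gamma> ^ CARD('d) * (K * 2 ^ \<gamma> * (ptree_lip \<kappa> * norm (x - y))))"
  proof (rule sum_active_bound[OF x y])
    show "?h q = 0" if "bump k q x = 0" "bump k q y = 0" for q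
      using piece_zero[OF _ that(1)] piece_zero[OF _ that(2)] that by (intro sum.neutral) simp
    show "\<bar>?h q\<bar> \<le> real \<gamma> ^ CARD('d) * (K * 2 ^ \<gamma> * (ptree_lip \<kappa> * norm (x - y)))" if "q \<in> grid k" for q
      by (rule coef_sum_bound[OF that piece_error_diff]) (simp_all add: ptree_lip_nonneg)
  qed (use K(2) ptree_lip_nonneg in simp)
  moreover have "\<bar>blend x - blend y\<bar> \<le> lip_blend CARD('d) \<gamma> * K * norm (x - y)"
    by (rule blend_diff[OF x y])
  ultimately have "\<bar>approx x - approx y\<bar>
      \<le> 2 * 2 ^ CARD('d) * (real \<gamma> ^ CARD('d) * (K * 2 ^ \<gamma> * (ptree_lip \<kappa> * norm (x - y))))
        + lip_blend CARD('d) \<gamma> * K * norm (x - y)"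
    using eq by linarith
  also have "\<dots> = K * lip_approx CARD('d) \<gamma> \<kappa> * norm (x - y)"
    by (simp add: lip_approx_def algebra_simps)
  finally show ?thesis .
qed

section \<open>The approximant as a network\<close>

lemma computes_piece:
  assumes q: "q \<in> grid k" and \<alpha>: "mi_abs \<alpha> < \<gamma>"
  shows "computes (k + 5 + \<kappa> * (k * \<gamma> + 3)) (2 ^ \<kappa> * 8) (2 ^ \<kappa> * (6 * k + 35 + 40 * (k * \<gamma> + 3)))
    [\<lambda>x. piece q \<alpha> (clip_vec x)]"
proof -
  let ?fs = "map (\<lambda>u x. u (clip_vec x)) (factors q \<alpha>)"
  have qi: "q i \<le> 2 ^ k" "max (q i) 1 \<le> 2 ^ k" for i
    using q by (auto simp: grid_def PiE_UNIV_domain Pi_iff)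
  have "computes (k + 5) 3 (6 * k + 35) [\<lambda>x. u (clip_vec x)]" if "u \<in> set (factors q \<alpha>)" for u
    using that
  proof (cases rule: factors_cases)
    case (1 i)
    then show ?thesis using computes_hat_factor[OF qi(1), of i i] by (simp add: clip_vec_def)
  next
    case (2 i)
    then show ?thesis using computes_ramp_factor[OF qi(2), of i i] by (simp add: clip_vec_def)
  next
    case 3
    have "computes (Suc (k + 4)) 3 (6 * k + 35) [\<lambda>_ :: real ^ 'd. 1]"
      by (rule computes_mono[OF computes_one]) simp_all
    then show ?thesis unfolding 3 by (simp add: eval_nat_numeral)
  qed
  then have "computes (k + 5 + \<kappa> * (k * \<gamma> + 3)) (2 ^ \<kappa> * (3 + 5))
      (2 ^ \<kappa> * (6 * k + 35 + 40 * (k * \<gamma> + 3)) - 40 * (k * \<gamma> + 3))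
      [\<lambda>x. ptree (k * \<gamma>) \<kappa> (map (\<lambda>u. u x) ?fs)]"
    using length_factors[OF \<alpha>] factors_range by (intro computes_ptree) auto
  then show ?thesis
    \<comment> \<open>Monotonicity combined with a change of the function list: the tree is
      identified with \<open>piece\<close>, and the subtracted node cost is dropped.\<close>
    by (rule computes_mono[THEN iffD1[OF arg_cong[of _ _ "computes _ _ _"], rotated]])
      (simp_all add: piece_def o_def)
qed

text \<open>Here the smallness of \<open>K\<close> serves the weight bound: the coefficients are
  entries of the last matrix.\<close>

lemma computes_approx:
  assumes "K * 2 ^ \<gamma> \<le> 1"
  shows "computes (Suc (k + 5 + \<kappa> * (k * \<gamma> + 3))) (num_pieces CARD('d) \<gamma> k * (2 ^ \<kappa> * 8 + 1))
    (num_pieces CARD('d) \<gamma> k * (2 ^ \<kappa> * (6 * k + 35 + 40 * (k * \<gamma> + 3)) + 3))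
    [\<lambda>x. approx (clip_vec x), \<lambda>x. - approx (clip_vec x)]"
proof -
  let ?I = "(grid k :: ('d \<Rightarrow> nat) set) \<times> {\<alpha> :: 'd \<Rightarrow> nat. mi_abs \<alpha> < \<gamma>}"
  have eq: "approx x = (\<Sum>i\<in>?I. coef (fst i) (snd i) * piece (fst i) (snd i) x)" for x
    unfolding approx_def by (simp add: sum.cartesian_product case_prod_unfold)
  have "card ?I = (2 ^ k + 1) ^ CARD('d) * card {\<alpha> :: 'd \<Rightarrow> nat. mi_abs \<alpha> < \<gamma>}"
    by (simp add: card_cartesian_product card_grid)
  then have card: "card ?I \<le> num_pieces CARD('d) \<gamma> k"
    unfolding num_pieces_def by (simp add: card_multi_indices)
  have "computes (Suc (k + 5 + \<kappa> * (k * \<gamma> + 3))) (card ?I * (2 ^ \<kappa> * 8 + 1))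
    (card ?I * (2 ^ \<kappa> * (6 * k + 35 + 40 * (k * \<gamma> + 3)) + 3))
    [\<lambda>x. approx (clip_vec x), \<lambda>x. - approx (clip_vec x)]"
    unfolding eq
  proof (rule computes_sum)
    show "finite ?I" using finite_grid finite_multi_indices by blast
    fix i x assume i: "i \<in> ?I"
    then show "computes (k + 5 + \<kappa> * (k * \<gamma> + 3)) (2 ^ \<kappa> * 8) (2 ^ \<kappa> * (6 * k + 35 + 40 * (k * \<gamma> + 3)))
        [\<lambda>x. piece (fst i) (snd i) (clip_vec x)]"
      by (intro computes_piece) auto
    show "0 \<le> piece (fst i) (snd i) (clip_vec x)"
      using piece_range i by auto
    show "\<bar>coef (fst i) (snd i)\<bar> \<le> 1"
      using coef_bound'[of "fst i" "snd i"] i assms by auto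
  qed
  then show ?thesis
    by (rule computes_mono) (intro mult_le_mono1 card)+
qed

lemma approx_critic:
  assumes "K * 2 ^ \<gamma> \<le> 1" "K + K * err_approx CARD('d) \<gamma> \<kappa> \<le> F"
    and p: "p 0 = CARD('d)" "p (Suc L) = 1"
    and L: "Suc (k + 5 + \<kappa> * (k * \<gamma> + 3)) \<le> L"
    and w: "\<And>i. i \<in> {1..L} \<Longrightarrow> max (num_pieces CARD('d) \<gamma> k * (2 ^ \<kappa> * 8 + 1)) 2 \<le> p i"
    and c: "real (num_pieces CARD('d) \<gamma> k * (2 ^ \<kappa> * (6 * k + 35 + 40 * (k * \<gamma> + 3)) + 3) + 6 * L) \<le> s"
  shows "(\<lambda>x. approx (clip_vec x)) \<in> critics L p s F"
proof -
  let ?l = "Suc (k + 5 + \<kappa> * (k * \<gamma> + 3))"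
  let ?c = "num_pieces CARD('d) \<gamma> k * (2 ^ \<kappa> * (6 * k + 35 + 40 * (k * \<gamma> + 3)) + 3)"
  have "computes (?l + (L - ?l)) (max (num_pieces CARD('d) \<gamma> k * (2 ^ \<kappa> * 8 + 1)) 2) (?c + 6 * (L - ?l))
      [\<lambda>x. approx (clip_vec x), \<lambda>x. - approx (clip_vec x)]"
    by (rule computes_pad[OF computes_approx[OF assms(1)]])
  then have comp: "computes L (max (num_pieces CARD('d) \<gamma> k * (2 ^ \<kappa> * 8 + 1)) 2) (?c + 6 * L)
      [\<lambda>x. approx (clip_vec x), \<lambda>x. - approx (clip_vec x)]"
    using L by (simp only: le_add_diff_inverse) (erule computes_mono; simp)
  show ?thesis
  proof (rule computes_critic[OF comp p w c])
    fix x :: "real ^ 'd" assume x: "x \<in> unit_cube"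
    have "\<bar>f x\<bar> \<le> K"
      using holder_norm_bound[OF K _ x, of "\<lambda>_. 0"] \<gamma> D_0[OF x] by (simp add: mi_abs_0)
    moreover have "\<bar>approx x - f x\<bar> \<le> K * err_approx CARD('d) \<gamma> \<kappa>"
    proof -
      have "K * err_approx CARD('d) \<gamma> \<kappa> / (2 ^ k) ^ \<gamma> \<le> K * err_approx CARD('d) \<gamma> \<kappa> / 1"
        using K(2) by (intro divide_left_mono) (auto simp: err_approx_def err_taylor_def)
      with approx_error[OF x] show ?thesis by simp
    qed
    ultimately show "\<bar>approx (clip_vec x)\<bar> \<le> F"
      using assms(2) by (simp add: clip_vec_eq[OF x])
  qed
qed

lemma approx_clip_lipschitz:
  assumes "K * lip_approx CARD('d) \<gamma> \<kappa> \<le> 1"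
  shows "1-lipschitz_on UNIV (\<lambda>x. approx (clip_vec x))"
proof (rule lipschitz_onI)
  fix x y :: "real ^ 'd"
  have "\<bar>approx (clip_vec x) - approx (clip_vec y)\<bar>
      \<le> K * lip_approx CARD('d) \<gamma> \<kappa> * norm (clip_vec x - clip_vec y)"
    by (intro approx_diff clip_vec_cube)
  also have "\<dots> \<le> 1 * norm (x - y)"
    using assms by (intro mult_mono clip_vec_diff) auto
  finally show "dist (approx (clip_vec x)) (approx (clip_vec y)) \<le> 1 * dist x y"
    by (simp add: dist_norm)
qed simp

end

section \<open>Approximation by critics\<close>

lemma zero_critic:
  assumes "0 \<le> s" "0 \<le> F"
  shows "(\<lambda>_. 0) \<in> critics L p s F"
proof -
  have "net p (\<lambda>_ _ _. 0) (\<lambda>_ _. 0) L \<in> relu_nets L p s F"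
    unfolding relu_nets_def using assms
    by (intro CollectI exI[of _ "\<lambda>_ _ _. 0"] exI[of _ "\<lambda>_ _. 0"])
      (simp add: weights_bounded_def num_nonzero_def net_zero case_prod_unfold)
  then show ?thesis
    unfolding critics_def by (rule rev_image_eqI) (simp add: net_zero)
qed

text \<open>For the least power of two, \<open>2 ^ \<kappa>\<close> is below 2 (d + \<gamma>), hence
  at most 4 max(d, \<gamma>). This is what the factors 4 in the depth condition provide for.\<close>

lemma tree_depth_exists:
  assumes "1 \<le> d" "1 \<le> (\<gamma> :: nat)"
  shows "\<exists>\<kappa>. d + \<gamma> \<le> 2 ^ \<kappa> \<and> real \<kappa> \<le> log 2 (real (max (4 * d) (4 * \<gamma>)))"
proof -
  obtain n where n: "2 ^ n < d + \<gamma>" "d + \<gamma> \<le> 2 ^ (n + 1)"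
    using ex_power_ivl2[of 2 "d + \<gamma>"] assms by auto
  have "(2 :: nat) ^ (n + 1) \<le> max (4 * d) (4 * \<gamma>)"
    using n(1) by (auto simp: max_def)
  then have "real (n + 1) \<le> log 2 (real (max (4 * d) (4 * \<gamma>)))"
    by (rule le_log2_of_power)
  with n(2) show ?thesis by blast
qed

lemma dyadic_scale_exists:
  fixes E :: real
  assumes "1 \<le> n" "0 < E"
  shows "\<exists>k. real k * E \<le> log 2 (real n) \<and> 2 ^ k \<le> real n powr (1 / E) \<and> real n powr (1 / E) \<le> 2 * 2 ^ k"
proof -
  define t where "t = log 2 (real n) / E"
  have t: "0 \<le> t" using assms by (simp add: t_def)
  define k where "k = nat \<lfloor>t\<rfloor>"
  have k: "real k \<le> t" "t \<le> real k + 1"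
    using t by (auto simp: k_def)
  have "2 powr t = (2 powr log 2 (real n)) powr (1 / E)"
    by (simp add: powr_powr t_def)
  also have "2 powr log 2 (real n) = real n"
    using assms by simp
  finally have n: "real n powr (1 / E) = 2 powr t" ..
  have "2 ^ k = 2 powr real k" "2 * 2 ^ k = 2 powr (real k + 1)"
    by (simp_all add: powr_realpow powr_add)
  moreover have "2 powr real k \<le> 2 powr t" "2 powr t \<le> 2 powr (real k + 1)"
    using k by (simp_all add: powr_mono)
  moreover have "real k * E \<le> log 2 (real n)"
    using k(1) assms by (simp add: t_def field_simps)
  ultimately show ?thesis
    unfolding n by metis
qed

text \<open>For a mesh of about the inverse of z = n^(1/E), this identifies n a_n with the order of
  the number of grid points, and a_n^(1/2) with the order of the approximation error.\<close>

lemma rate_eqs: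
  assumes "1 \<le> n" and E: "E = 2 * real \<gamma> + real d" "0 < E"
  shows "real n * rate \<gamma> d n = (real n powr (1 / E)) ^ d"
    and "sqrt (rate \<gamma> d n) = 1 / (real n powr (1 / E)) ^ \<gamma>"
proof -
  have n: "0 < real n" using assms(1) by simp
  then have pos: "0 < real n powr (1 / E)" by simp
  have "real n * rate \<gamma> d n = real n powr 1 * real n powr (- (2 * real \<gamma> / E))"
    using n by (simp add: rate_def E)
  also have "\<dots> = real n powr (1 / E * real d)"
    unfolding powr_add[symmetric] using E by (simp add: field_simps)
  also have "\<dots> = (real n powr (1 / E)) powr real d"
    by (simp only: powr_powr)
  also have "\<dots> = (real n powr (1 / E)) ^ d"
    using pos by (rule powr_realpow)
  finally show "real n * rate \<gamma> d n = (real n powr (1 / E)) ^ d" .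
  have "rate \<gamma> d n = real n powr (1 / E * (- (2 * real \<gamma>)))"
    using E by (simp add: rate_def)
  also have "\<dots> = (real n powr (1 / E)) powr (- (2 * real \<gamma>))"
    by (simp only: powr_powr)
  also have "\<dots> = 1 / (real n powr (1 / E)) powr real (2 * \<gamma>)"
    by (simp add: powr_minus_divide)
  also have "\<dots> = (1 / (real n powr (1 / E)) ^ \<gamma>)\<^sup>2"
    using pos by (subst powr_realpow) (simp_all add: power_divide power_mult[symmetric] mult.commute)
  finally show "sqrt (rate \<gamma> d n) = 1 / (real n powr (1 / E)) ^ \<gamma>"
    using pos by simp
qed

text \<open>\<open>b\<close> stands for log_2 n. Since k \<le> b/3 and k \<gamma> \<le> b/2, the
  depth is at most b/3 + 6 + Q (b/2 + 3). As \<open>Q\<close> is at least 2, this is at most b Q as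
  soon as b/3 + 6 \<le> b - 6, that is, from b = 18 on.\<close>

lemma depth_bound:
  fixes k \<kappa> \<gamma> d L :: nat and b Q :: real
  assumes "18 \<le> b" "real \<kappa> \<le> Q" "2 \<le> Q" "real k * (2 * real \<gamma> + real d) \<le> b" "1 \<le> \<gamma>" "1 \<le> d"
    and "b * Q \<le> real L"
  shows "Suc (k + 5 + \<kappa> * (k * \<gamma> + 3)) \<le> L"
proof -
  have "real k * 3 \<le> real k * (2 * real \<gamma> + real d)"
    using assms by (intro mult_left_mono) auto
  then have k: "real k \<le> b / 3" using assms(4) by linarith
  have "real k * (2 * real \<gamma>) \<le> real k * (2 * real \<gamma> + real d)"
    by (intro mult_left_mono) auto
  then have "real k * real \<gamma> \<le> b / 2" using assms(4) by linarith
  then have "real \<kappa> * (real k * real \<gamma> + 3) \<le> Q * (b / 2 + 3)"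
    using assms by (intro mult_mono) auto
  moreover have "2 * (b / 2 - 3) \<le> Q * (b / 2 - 3)"
    using assms by (intro mult_right_mono) auto
  ultimately have "real k + 6 + real \<kappa> * (real k * real \<gamma> + 3) \<le> b * Q"
    using k assms(1) by (simp add: algebra_simps)
  then have "real (Suc (k + 5 + \<kappa> * (k * \<gamma> + 3))) \<le> real L"
    using assms(7) by simp
  then show ?thesis by (simp only: of_nat_le_iff)
qed

lemma holder_lip1_bound:
  fixes f :: "real ^ 'd::finite \<Rightarrow> real"
  assumes "f \<in> holder_lip1 \<gamma> K" "0 \<le> K" "1 \<le> \<gamma>" "x \<in> unit_cube"
  shows "\<bar>f x\<bar> \<le> K"
proof -
  obtain D where D: "partial_derivs unit_cube (\<gamma> - 1) f D" "holder_norm unit_cube \<gamma> D \<le> ennreal K"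
    using assms(1) unfolding holder_lip1_def holder_class_def by blast
  have "\<bar>D (\<lambda>_. 0) x\<bar> \<le> K"
    using holder_norm_bound[OF D(2) assms(2) _ assms(4), of "\<lambda>_. 0"] assms(3) by (simp add: mi_abs_0)
  then show ?thesis
    using D(1) assms(4) by (simp add: partial_derivs_def)
qed

text \<open>For small \<open>n\<close> the depth condition leaves no room for the construction, but then the zero
  network is accurate enough.\<close>

lemma holder_critic_approximation:
  fixes \<gamma> :: nat
  assumes \<gamma>: "1 \<le> \<gamma>"
  shows "\<exists>c1>0. \<exists>c2>0. \<exists>c3>0. \<exists>C>0. \<exists>K. 0 < K \<and> K < 1 \<and>
    (\<forall>n L p s F. \<forall>f \<in> holder_lip1 \<gamma> K :: (real ^ 'd::finite \<Rightarrow> real) set.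
       1 \<le> n \<and> 0 < s \<and> 1 \<le> F \<and> p 0 = CARD('d) \<and> p (Suc L) = 1 \<and>
       log 2 (real n) * log 2 (real (max (4 * CARD('d)) (4 * \<gamma>))) \<le> real L \<and>
       (\<forall>i\<in>{1..L}. c1 * (real n * rate \<gamma> CARD('d) n) \<le> real (p i)) \<and>
       c2 * (ln (real n) * (real n * rate \<gamma> CARD('d) n)) \<le> s \<and> c3 * real L \<le> s
       \<longrightarrow> (\<exists>h \<in> critics L p s F. 1-lipschitz_on UNIV h \<and>
             (\<forall>x\<in>unit_cube. \<bar>f x - h x\<bar> \<le> C * sqrt (rate \<gamma> CARD('d) n))))"
proof -
  let ?d = "CARD('d)"
  define Q where "Q = log 2 (real (max (4 * ?d) (4 * \<gamma>)))"
  define E where "E = 2 * real \<gamma> + real ?d"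
  obtain \<kappa> where \<kappa>: "?d + \<gamma> \<le> 2 ^ \<kappa>" "real \<kappa> \<le> Q"
    using tree_depth_exists[of ?d \<gamma>] \<gamma> unfolding Q_def by auto
  have Q: "2 \<le> Q"
  proof -
    have "2 ^ 2 \<le> max (4 * ?d) (4 * \<gamma>)" using \<gamma> by auto
    then have "real 2 \<le> Q" unfolding Q_def by (rule le_log2_of_power)
    then show ?thesis by simp
  qed
  obtain es :: "'d list" where es: "set es = UNIV" "distinct es"
    using finite_distinct_list[of "UNIV :: 'd set"] by auto
  define e where "e = err_approx ?d \<gamma> \<kappa>"
  define l where "l = lip_approx ?d \<gamma> \<kappa>"
  have e: "0 \<le> e" by (simp add: e_def err_approx_def err_taylor_def)
  have l: "0 \<le> l"
    by (simp add: l_def lip_approx_def lip_blend_def lip_poly_def err_taylor_def ptree_lip_nonneg)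
  \<comment> \<open>One denominator for three demands: \<open>2 ^ \<gamma>\<close> for the weights,
    \<open>l\<close> for the Lipschitz constant, \<open>1 + e\<close> for the range.\<close>
  define K where "K = 1 / (2 ^ \<gamma> + e + l + 1)"
  have den: "1 < 2 ^ \<gamma> + e + l + 1" using e l by (simp add: add_pos_nonneg)
  have K: "0 < K" "K < 1" using den by (simp_all add: K_def)
  have K_le: "K * t \<le> 1" if "t \<le> 2 ^ \<gamma> + e + l + 1" for t
    using den that by (simp add: K_def)
  have K_bounds: "K * 2 ^ \<gamma> \<le> 1" "K * l \<le> 1" "K * (1 + e) \<le> 1"
    using e l by (intro K_le; simp add: add_nonneg_nonneg)+
  define c where "c = (2 * real \<gamma>) ^ ?d"
  have c: "1 \<le> c" unfolding c_def using \<gamma> by (intro one_le_power) simp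
  \<comment> \<open>The summand 2 secures the two channels of the padding.\<close>
  define c1 where "c1 = c * (2 ^ \<kappa> * 8 + 1) + 2"
  \<comment> \<open>201 = 6 + 35 + 40 + 120 adds up the coefficients of the cost of a piece. The
    factor 2 reserves half of \<open>s\<close> for the padding, whose cost 6 L is covered by 12 L
    \<le> s.\<close>
  define c2 where "c2 = 2 * (c * (2 ^ \<kappa> * (201 * real \<gamma>) + 3))"
  \<comment> \<open>The factor \<open>2 ^ \<gamma>\<close> pays for rounding the mesh to a power of
    two, \<open>2 ^ 18\<close> for the case of small \<open>n\<close>, where the zero network is
    used.\<close>
  define C where "C = e * 2 ^ \<gamma> + 2 ^ 18"
  have pos: "0 < c1" "0 < c2" "0 < C"
    using c \<gamma> e by (simp_all add: c1_def c2_def C_def add_pos_pos add_nonneg_pos)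
  have main: "\<exists>h \<in> critics L p s F. 1-lipschitz_on UNIV h \<and>
      (\<forall>x\<in>unit_cube. \<bar>f x - h x\<bar> \<le> C * sqrt (rate \<gamma> ?d n))"
    if f: "f \<in> (holder_lip1 \<gamma> K :: (real ^ 'd \<Rightarrow> real) set)" and n: "1 \<le> n" and s: "0 < s" and F: "1 \<le> F"
      and p: "p 0 = ?d" "p (Suc L) = 1" and L: "log 2 (real n) * Q \<le> real L"
      and w: "\<forall>i\<in>{1..L}. c1 * (real n * rate \<gamma> ?d n) \<le> real (p i)"
      and s2: "c2 * (ln (real n) * (real n * rate \<gamma> ?d n)) \<le> s" and s3: "12 * real L \<le> s"
    for n L p s F f
  proof -
    have E0: "0 < E" "3 \<le> E"
      using \<gamma> by (simp_all add: E_def add_pos_pos) (smt (verit) of_nat_1 of_nat_mono zero_less_card_finite Suc_leI One_nat_def)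
    define z where "z = real n powr (1 / E)"
    have z: "1 \<le> z" unfolding z_def using n E0 by (intro ge_one_powr_ge_zero) auto
    have N: "real n * rate \<gamma> ?d n = z ^ ?d" and R: "sqrt (rate \<gamma> ?d n) = 1 / z ^ \<gamma>"
      using rate_eqs[OF n E_def E0(1)] by (simp_all add: z_def)
    show ?thesis
    proof (cases "18 \<le> log 2 (real n)")
      case False
      have "z ^ \<gamma> \<le> 2 ^ 18"
      proof -
        have "z ^ \<gamma> = real n powr (real \<gamma> / E)"
          using n by (simp add: z_def powr_realpow[symmetric] powr_powr)
        also have "\<dots> \<le> real n powr 1"
          using n E0 by (intro powr_mono) (auto simp: E_def)
        also have "\<dots> = 2 powr (log 2 (real n))" using n by simp
        also have "\<dots> \<le> 2 powr real 18" using False by (intro powr_mono) auto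
        also have "\<dots> = 2 ^ 18" by (rule powr_realpow) simp
        finally show ?thesis .
      qed
      then have "z ^ \<gamma> \<le> C" using e by (simp add: C_def add_increasing)
      then have C: "1 \<le> C * sqrt (rate \<gamma> ?d n)"
        unfolding R using z by simp
      have "\<bar>f x - 0\<bar> \<le> C * sqrt (rate \<gamma> ?d n)" if "x \<in> unit_cube" for x
        using holder_lip1_bound[OF f _ \<gamma> that] K C by simp
      moreover have "1-lipschitz_on UNIV (\<lambda>_ :: real ^ 'd. 0 :: real)"
        by (rule lipschitz_onI) auto
      ultimately show ?thesis
        using zero_critic[of s F L p] s F by (intro bexI[of _ "\<lambda>_. 0"]) auto
    next
      case True
      obtain k where k: "real k * E \<le> log 2 (real n)" "2 ^ k \<le> z" "z \<le> 2 * 2 ^ k"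
        using dyadic_scale_exists[OF n E0(1)] unfolding z_def by blast
      obtain D where D: "partial_derivs unit_cube (\<gamma> - 1) f D" "holder_norm unit_cube \<gamma> D \<le> ennreal K"
        using f unfolding holder_lip1_def holder_class_def by blast
      interpret I: holder_interpolation \<gamma> f D K k \<kappa> es
        using \<gamma> D K \<kappa>(1) es by unfold_locales auto
      define P where "P = real (num_pieces ?d \<gamma> k)"
      have P: "P \<le> c * z ^ ?d"
      proof -
        have "P \<le> c * (2 ^ k) ^ ?d" unfolding P_def c_def by (rule num_pieces_le)
        also have "\<dots> \<le> c * z ^ ?d"
          using c k(2) by (intro mult_left_mono power_mono) auto
        finally show ?thesis .
      qed
      have zd: "1 \<le> z ^ ?d" using z by (rule one_le_power)
      have depth: "Suc (k + 5 + \<kappa> * (k * \<gamma> + 3)) \<le> L"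
        by (rule depth_bound[OF True \<kappa>(2) Q k(1)[unfolded E_def] \<gamma> _ L]) simp
      have width: "max (num_pieces ?d \<gamma> k * (2 ^ \<kappa> * 8 + 1)) 2 \<le> p i" if "i \<in> {1..L}" for i
      proof -
        have "P * (2 ^ \<kappa> * 8 + 1) \<le> c * z ^ ?d * (2 ^ \<kappa> * 8 + 1)"
          using P by (intro mult_right_mono) auto
        moreover have "0 \<le> c * z ^ ?d * (2 ^ \<kappa> * 8 + 1)" using c z by simp
        moreover have "c * z ^ ?d * (2 ^ \<kappa> * 8 + 1) + 2 * z ^ ?d \<le> real (p i)"
          using w that unfolding N c1_def by (auto simp: algebra_simps)
        ultimately have "P * (2 ^ \<kappa> * 8 + 1) \<le> real (p i)" "2 \<le> real (p i)"
          using zd by linarith+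
        moreover have "real (num_pieces ?d \<gamma> k * (2 ^ \<kappa> * 8 + 1)) = P * (2 ^ \<kappa> * 8 + 1)"
          unfolding P_def by (simp add: distrib_left)
        ultimately have "real (num_pieces ?d \<gamma> k * (2 ^ \<kappa> * 8 + 1)) \<le> real (p i)" "real 2 \<le> real (p i)"
          by simp_all
        then show ?thesis by (simp only: of_nat_le_iff max.bounded_iff)
      qed
      have cost: "real (num_pieces ?d \<gamma> k * (2 ^ \<kappa> * (6 * k + 35 + 40 * (k * \<gamma> + 3)) + 3) + 6 * L) \<le> s"
      proof -
        \<comment> \<open>k is at most a third of log_2 n, whereas ln n is at least two thirds of
          it; the remaining third is at least 6.\<close>
        have ln: "real k + 1 \<le> ln (real n)"
        proof -
          have "log 2 (real n) * ln 2 = ln (real n)"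
            by (simp add: log_def)
          moreover have "log 2 (real n) * (2 / 3) \<le> log 2 (real n) * ln 2"
            using True ln2_ge_two_thirds by (intro mult_left_mono) auto
          moreover have "real k * 3 \<le> log 2 (real n)"
            using k(1) mult_left_mono[OF E0(2), of "real k"] by simp
          ultimately show ?thesis using True by linarith
        qed
        have "real (6 * k + 35 + 40 * (k * \<gamma> + 3)) \<le> 201 * real \<gamma> * (real k + 1)"
        proof -
          have "6 * k + 35 + 40 * (k * \<gamma> + 3) \<le> 201 * \<gamma> * (k + 1)"
            using \<gamma> by (cases \<gamma>) (auto simp: algebra_simps)
          then have "real (6 * k + 35 + 40 * (k * \<gamma> + 3)) \<le> real (201 * \<gamma> * (k + 1))"
            by (simp only: of_nat_le_iff)
          also have "real (201 * \<gamma> * (k + 1)) = 201 * real \<gamma> * (real k + 1)"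
            by (simp add: algebra_simps)
          finally show ?thesis .
        qed
        also have "\<dots> \<le> 201 * real \<gamma> * ln (real n)"
          using ln by (intro mult_left_mono) auto
        finally have "2 ^ \<kappa> * real (6 * k + 35 + 40 * (k * \<gamma> + 3)) + 3
            \<le> 2 ^ \<kappa> * (201 * real \<gamma> * ln (real n)) + 3 * ln (real n)"
          using ln by (intro add_mono mult_left_mono) auto
        then have "P * (2 ^ \<kappa> * real (6 * k + 35 + 40 * (k * \<gamma> + 3)) + 3)
            \<le> (c * z ^ ?d) * (2 ^ \<kappa> * (201 * real \<gamma> * ln (real n)) + 3 * ln (real n))"
          using c z by (intro mult_mono P) (auto simp: P_def)
        also have "\<dots> = c2 * (ln (real n) * z ^ ?d) / 2"
          by (simp add: c2_def algebra_simps)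
        also have "\<dots> \<le> s / 2"
          using s2 unfolding N by simp
        finally have "P * (2 ^ \<kappa> * real (6 * k + 35 + 40 * (k * \<gamma> + 3)) + 3) + 6 * real L \<le> s"
          using s3 by linarith
        then show ?thesis by (simp add: P_def)
      qed
      have crit: "(\<lambda>x. I.approx (clip_vec x)) \<in> critics L p s F"
      proof (rule I.approx_critic[OF K_bounds(1) _ p depth width cost])
        show "K + K * err_approx ?d \<gamma> \<kappa> \<le> F"
          using K_bounds(3) F by (simp add: e_def distrib_left)
      qed
      have lip: "1-lipschitz_on UNIV (\<lambda>x. I.approx (clip_vec x))"
        by (rule I.approx_clip_lipschitz) (use K_bounds(2) in \<open>simp add: l_def\<close>)
      have "\<bar>f x - I.approx (clip_vec x)\<bar> \<le> C * sqrt (rate \<gamma> ?d n)" if x: "x \<in> unit_cube" for x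
      proof -
        have "z ^ \<gamma> \<le> (2 * 2 ^ k) ^ \<gamma>"
          using z k(3) by (intro power_mono) auto
        then have zk: "1 / (2 ^ k) ^ \<gamma> \<le> 2 ^ \<gamma> / z ^ \<gamma>"
          using z by (simp add: field_simps)
        have "\<bar>f x - I.approx (clip_vec x)\<bar> \<le> K * e / (2 ^ k) ^ \<gamma>"
          using I.approx_error[OF x] by (simp add: clip_vec_eq[OF x] e_def abs_minus_commute)
        also have "\<dots> = (K * e) * (1 / (2 ^ k) ^ \<gamma>)" by simp
        also have "\<dots> \<le> e * (2 ^ \<gamma> / z ^ \<gamma>)"
          using K e zk by (intro mult_mono mult_left_le_one_le) auto
        also have "\<dots> \<le> C * (1 / z ^ \<gamma>)"
          using z by (simp add: C_def field_simps)
        finally show ?thesis unfolding R .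
      qed
      with crit lip show ?thesis by (intro bexI[of _ "\<lambda>x. I.approx (clip_vec x)"]) auto
    qed
  qed
  show ?thesis
  proof (rule exI[of _ c1], rule conjI, rule pos(1), rule exI[of _ c2], rule conjI, rule pos(2),
      rule exI[of _ "12 :: real"], rule conjI, simp, rule exI[of _ C], rule conjI, rule pos(3),
      rule exI[of _ K], rule conjI, rule K(1), rule conjI, rule K(2), intro allI ballI impI, elim conjE)
    fix n L p and s F :: real and f :: "real ^ 'd \<Rightarrow> real"
    assume "f \<in> holder_lip1 \<gamma> K" "1 \<le> n" "0 < s" "1 \<le> F" "p 0 = ?d" "p (Suc L) = 1"
      "log 2 (real n) * log 2 (real (max (4 * ?d) (4 * \<gamma>))) \<le> real L"
      "\<forall>i\<in>{1..L}. c1 * (real n * rate \<gamma> ?d n) \<le> real (p i)"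
      "c2 * (ln (real n) * (real n * rate \<gamma> ?d n)) \<le> s" "12 * real L \<le> s"
    then show "\<exists>h\<in>critics L p s F. 1-lipschitz_on UNIV h \<and>
        (\<forall>x\<in>unit_cube. \<bar>f x - h x\<bar> \<le> C * sqrt (rate \<gamma> ?d n))"
      by (rule main[unfolded Q_def])
  qed
qed

section \<open>Comparison of the distances\<close>

lemma zero_holder_lip1: "(\<lambda>_. 0) \<in> (holder_lip1 \<gamma> K :: (real ^ 'd::finite \<Rightarrow> real) set)"
proof -
  have "partial_derivs unit_cube (\<gamma> - 1) (\<lambda>_. 0) (\<lambda>_ _ :: real ^ 'd. 0)"
    by (simp add: partial_derivs_def)
  moreover have "holder_norm unit_cube \<gamma> (\<lambda>_ _ :: real ^ 'd. 0) = 0"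
    by (auto simp: holder_norm_def SUP_constant bot_ennreal intro!: sum.neutral SUP_eqI)
  ultimately have "(\<lambda>_. 0) \<in> (holder_class unit_cube \<gamma> K :: (real ^ 'd \<Rightarrow> real) set)"
    unfolding holder_class_def by force
  moreover have "1-lipschitz_on unit_cube (\<lambda>_ :: real ^ 'd. 0 :: real)"
    by (rule lipschitz_onI) auto
  ultimately show ?thesis by (simp add: holder_lip1_def)
qed

lemma critic_bounded:
  fixes h :: "real ^ 'd::finite \<Rightarrow> real"
  assumes "h \<in> critics L p s F" "p 0 = CARD('d)" "p (Suc L) = 1" "x \<in> unit_cube"
  shows "\<bar>h x\<bar> \<le> F"
proof -
  obtain g where g: "g \<in> relu_nets L p s F" "h = (\<lambda>x. g (\<lambda>i. x $ from_nat_into UNIV i) 0)"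
    using assms(1) unfolding critics_def by auto
  have "\<forall>j<p 0. 0 \<le> x $ from_nat_into UNIV j \<and> x $ from_nat_into UNIV j \<le> 1"
    using assms(4) by (simp add: unit_cube_def)
  then show ?thesis
    using g assms(3) unfolding relu_nets_def by auto
qed

lemma zero_in_cube: "0 \<in> unit_cube"
  by (simp add: unit_cube_def)

text \<open>\<open>f\<close> is arbitrary off the cube, so measurability has to come from continuity
  on the cube and the range of \<open>X\<close>.\<close>

lemma lipschitz_cube_measurable:
  fixes f :: "real ^ 'd::finite \<Rightarrow> real"
  assumes "C-lipschitz_on unit_cube f" "X \<in> borel_measurable M" "\<And>\<omega>. \<omega> \<in> space M \<Longrightarrow> X \<omega> \<in> unit_cube"
  shows "(\<lambda>\<omega>. f (X \<omega>)) \<in> borel_measurable M"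
proof -
  have "f \<in> borel_measurable (restrict_space borel unit_cube)"
    by (rule borel_measurable_continuous_on_restrict[OF lipschitz_on_continuous_on[OF assms(1)]])
  moreover have "X \<in> measurable M (restrict_space borel unit_cube)"
    using assms(2,3) by (intro measurable_restrict_space2) auto
  ultimately show ?thesis
    by (rule measurable_compose[rotated])
qed

lemma integrable_bounded_on_cube:
  fixes f :: "real ^ 'd::finite \<Rightarrow> real"
  assumes "prob_space M" "C-lipschitz_on unit_cube f" "X \<in> borel_measurable M"
    and "\<And>\<omega>. \<omega> \<in> space M \<Longrightarrow> X \<omega> \<in> unit_cube" "\<And>x. x \<in> unit_cube \<Longrightarrow> \<bar>f x\<bar> \<le> B"
  shows "integrable M (\<lambda>\<omega>. f (X \<omega>))" "\<bar>\<integral>\<omega>. f (X \<omega>) \<partial>M\<bar> \<le> B"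
proof -
  interpret prob_space M by fact
  show int: "integrable M (\<lambda>\<omega>. f (X \<omega>))"
    using assms(4,5) lipschitz_cube_measurable[OF assms(2,3,4)]
    by (intro integrable_const_bound[of _ B]) auto
  have "(\<integral>\<omega>. f (X \<omega>) \<partial>M) \<le> B" "- B \<le> (\<integral>\<omega>. f (X \<omega>) \<partial>M)"
    using assms(4,5) int
    by (auto intro!: integral_le_const integral_ge_const AE_I2 simp: abs_le_iff minus_le_iff)
  then show "\<bar>\<integral>\<omega>. f (X \<omega>) \<partial>M\<bar> \<le> B" by linarith
qed

lemma expectation_diff_le:
  fixes f h :: "real ^ 'd::finite \<Rightarrow> real"
  assumes "prob_space M" "X \<in> borel_measurable M" "\<And>\<omega>. \<omega> \<in> space M \<Longrightarrow> X \<omega> \<in> unit_cube"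
    and f: "1-lipschitz_on unit_cube f" "\<And>x. x \<in> unit_cube \<Longrightarrow> \<bar>f x\<bar> \<le> A"
    and h: "1-lipschitz_on unit_cube h" "\<And>x. x \<in> unit_cube \<Longrightarrow> \<bar>h x\<bar> \<le> B"
    and "\<And>x. x \<in> unit_cube \<Longrightarrow> \<bar>f x - h x\<bar> \<le> \<epsilon>"
  shows "\<bar>(\<integral>\<omega>. f (X \<omega>) \<partial>M) - (\<integral>\<omega>. h (X \<omega>) \<partial>M)\<bar> \<le> \<epsilon>"
proof -
  have "(\<integral>\<omega>. f (X \<omega>) \<partial>M) - (\<integral>\<omega>. h (X \<omega>) \<partial>M) = (\<integral>\<omega>. f (X \<omega>) - h (X \<omega>) \<partial>M)"
    using integrable_bounded_on_cube(1)[OF assms(1) f(1) assms(2,3) f(2)]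
      integrable_bounded_on_cube(1)[OF assms(1) h(1) assms(2,3) h(2)] by simp
  moreover have "2-lipschitz_on unit_cube (\<lambda>x. f x - h x)"
    using lipschitz_on_diff[OF f(1) h(1)] by simp
  ultimately show ?thesis
    using integrable_bounded_on_cube(2)[OF assms(1) _ assms(2,3) assms(8)] by simp
qed

text \<open>These are suprema and infima of reals, so nonemptiness and boundedness must be supplied.
  The latter comes from the bounds \<open>K\<close> on \<open>f\<close> and \<open>F\<close> on the
  critics.\<close>

lemma sup_inf_error_le:
  fixes \<gamma> :: nat
  assumes p: "p 0 = CARD('d::finite)" "p (Suc L) = 1" and K: "0 \<le> K" "1 \<le> \<gamma>"
    and approx: "\<And>f. f \<in> (holder_lip1 \<gamma> K :: (real ^ 'd \<Rightarrow> real) set) \<Longrightarrow>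
      \<exists>h\<in>critics L p s F. \<forall>x\<in>unit_cube. \<bar>f x - h x\<bar> \<le> \<epsilon>"
  shows "(SUP f\<in>holder_lip1 \<gamma> K :: (real ^ 'd \<Rightarrow> real) set. INF h\<in>critics L p s F.
          SUP x\<in>unit_cube. \<bar>f x - h x\<bar>) \<le> \<epsilon>"
proof (rule cSUP_least)
  show "(holder_lip1 \<gamma> K :: (real ^ 'd \<Rightarrow> real) set) \<noteq> {}"
    using zero_holder_lip1 by blast
  fix f assume f: "f \<in> (holder_lip1 \<gamma> K :: (real ^ 'd \<Rightarrow> real) set)"
  then obtain h where h: "h \<in> critics L p s F" "\<And>x. x \<in> unit_cube \<Longrightarrow> \<bar>f x - h x\<bar> \<le> \<epsilon>"
    using approx by blast
  have ne: "(unit_cube :: (real ^ 'd) set) \<noteq> {}" using zero_in_cube by blast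
  have bdd: "bdd_below ((\<lambda>h. SUP x\<in>unit_cube. \<bar>f x - h x\<bar>) ` critics L p s F)"
  proof (rule bdd_belowI2)
    fix h :: "real ^ 'd \<Rightarrow> real" assume h: "h \<in> critics L p s F"
    have "\<bar>f x - h x\<bar> \<le> K + F" if "x \<in> unit_cube" for x
      using holder_lip1_bound[OF f K that] critic_bounded[OF h p that] by linarith
    then have "bdd_above ((\<lambda>x. \<bar>f x - h x\<bar>) ` unit_cube)"
      by (intro bdd_aboveI2)
    then have "\<bar>f 0 - h 0\<bar> \<le> (SUP x\<in>unit_cube. \<bar>f x - h x\<bar>)"
      by (rule cSUP_upper[OF zero_in_cube])
    then show "0 \<le> (SUP x\<in>unit_cube. \<bar>f x - h x\<bar>)" by linarith
  qed
  have "(INF h\<in>critics L p s F. SUP x\<in>unit_cube. \<bar>f x - h x\<bar>) \<le> (SUP x\<in>unit_cube. \<bar>f x - h x\<bar>)"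
    by (rule cINF_lower[OF bdd h(1)])
  also have "\<dots> \<le> \<epsilon>"
    using h(2) by (intro cSUP_least ne)
  finally show "(INF h\<in>critics L p s F. SUP x\<in>unit_cube. \<bar>f x - h x\<bar>) \<le> \<epsilon>" .
qed

text \<open>Replacing \<open>f\<close> by a critic \<open>h\<close> costs \<open>\<epsilon>\<close>
  in each of the two expectations, hence the factor 2. Being 1-Lipschitz on the whole space,
  \<open>h\<close> competes in \<open>W1n\<close>.\<close>

lemma W1_holder_le_W1n:
  fixes \<gamma> :: nat and X :: "'w \<Rightarrow> real ^ 'd::finite"
  assumes p: "p 0 = CARD('d)" "p (Suc L) = 1" and K: "0 \<le> K" "1 \<le> \<gamma>"
    and approx: "\<And>f. f \<in> (holder_lip1 \<gamma> K :: (real ^ 'd \<Rightarrow> real) set) \<Longrightarrow>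
      \<exists>h\<in>critics L p s F. 1-lipschitz_on UNIV h \<and> (\<forall>x\<in>unit_cube. \<bar>f x - h x\<bar> \<le> \<epsilon>)"
    and M: "prob_space M"
    and X: "X \<in> borel_measurable M" "\<And>\<omega>. \<omega> \<in> space M \<Longrightarrow> X \<omega> \<in> unit_cube"
    and Y: "(\<lambda>\<omega>. g (Z \<omega>)) \<in> borel_measurable M" "\<And>\<omega>. \<omega> \<in> space M \<Longrightarrow> g (Z \<omega>) \<in> unit_cube"
  shows "W1_holder M X Z \<gamma> K g \<le> W1n M X Z L p s F g + 2 * \<epsilon>"
  unfolding W1_holder_def
proof (rule cSUP_least)
  show "(holder_lip1 \<gamma> K :: (real ^ 'd \<Rightarrow> real) set) \<noteq> {}"
    using zero_holder_lip1 by blast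
  fix f assume f: "f \<in> (holder_lip1 \<gamma> K :: (real ^ 'd \<Rightarrow> real) set)"
  then obtain h where h: "h \<in> critics L p s F" "1-lipschitz_on UNIV h"
    "\<And>x. x \<in> unit_cube \<Longrightarrow> \<bar>f x - h x\<bar> \<le> \<epsilon>"
    using approx by blast
  have cube: "1-lipschitz_on unit_cube h" if "1-lipschitz_on UNIV h" for h :: "real ^ 'd \<Rightarrow> real"
    by (rule lipschitz_on_subset[OF that]) simp
  have fl: "1-lipschitz_on unit_cube f" using f by (simp add: holder_lip1_def)
  note hb = critic_bounded[OF h(1) p]
  note diff = expectation_diff_le[OF M _ _ fl holder_lip1_bound[OF f K] cube[OF h(2)] hb h(3)]
  let ?S = "{f \<in> critics L p s F :: (real ^ 'd \<Rightarrow> real) set. 1-lipschitz_on UNIV f}"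
  let ?\<Delta> = "\<lambda>f. (\<integral>\<omega>. f (X \<omega>) \<partial>M) - (\<integral>\<omega>. f (g (Z \<omega>)) \<partial>M)"
  have "bdd_above (?\<Delta> ` ?S)"
  proof (rule bdd_aboveI2)
    fix h assume h: "h \<in> ?S"
    then have hc: "h \<in> critics L p s F" and "1-lipschitz_on UNIV h" by simp_all
    from cube[OF this(2)] have hl: "1-lipschitz_on unit_cube h" .
    show "?\<Delta> h \<le> F + F"
      using integrable_bounded_on_cube(2)[OF M hl X critic_bounded[OF hc p]]
        integrable_bounded_on_cube(2)[OF M hl Y critic_bounded[OF hc p]] by linarith
  qed
  then have "?\<Delta> h \<le> W1n M X Z L p s F g"
    unfolding W1n_def using h by (intro cSUP_upper) auto
  with diff[OF X] diff[OF Y] show "?\<Delta> f \<le> W1n M X Z L p s F g + 2 * \<epsilon>"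
    by linarith
qed

text \<open>The condition with \<open>c3\<close> is due to the unbounded depth: with fewer
  parameters than layers the class contains only constants. \<open>g (Z \<omega>)\<close> lies in
  the cube because the Hoelder class determines functions only there.\<close>

theorem lemma3p1:
  fixes \<gamma> :: nat
  assumes "\<gamma> \<ge> 1"
  shows "\<exists>c1>0. \<exists>c2>0. \<exists>c3>0. \<forall>F\<ge>1. \<exists>C>0. \<exists>K. 0 < K \<and> K < 1 \<and>
    (\<forall>(n::nat) (L::nat) (p :: nat \<Rightarrow> nat) (s::real).
       n \<ge> 1 \<and> s > 0 \<and> p 0 = CARD('d::finite) \<and> p (Suc L) = 1 \<and>
       real L \<ge> log 2 (real n) * log 2 (real (max (4 * CARD('d)) (4 * \<gamma>))) \<and>
       (\<forall>i\<in>{1..L}. real (p i) \<ge> c1 * (real n * rate \<gamma> CARD('d) n)) \<and>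
       s \<ge> c2 * (ln (real n) * (real n * rate \<gamma> CARD('d) n)) \<and>
       s \<ge> c3 * real L
       \<longrightarrow>
       (SUP f\<in>holder_lip1 \<gamma> K :: (real ^ 'd \<Rightarrow> real) set. INF h\<in>critics L p s F.
          SUP x\<in>unit_cube. \<bar>f x - h x\<bar>) \<le> C * sqrt (rate \<gamma> CARD('d) n) \<and>
       (\<forall>(M :: 'w measure) (X :: 'w \<Rightarrow> real ^ 'd) (dZ::nat) (Z :: 'w \<Rightarrow> nat \<Rightarrow> real)
          (g :: (nat \<Rightarrow> real) \<Rightarrow> real ^ 'd).
          prob_space M \<and>
          X \<in> borel_measurable M \<and> (\<forall>\<omega>\<in>space M. X \<omega> \<in> unit_cube) \<and>
          Z \<in> measurable M (vec_space dZ) \<and> (\<forall>\<omega>\<in>space M. \<forall>i<dZ. 0 \<le> Z \<omega> i \<and> Z \<omega> i \<le> 1) \<and>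
          g \<in> borel_measurable (vec_space dZ) \<and> (\<forall>\<omega>\<in>space M. g (Z \<omega>) \<in> unit_cube)
          \<longrightarrow>
          W1_holder M X Z \<gamma> K g \<le> W1n M X Z L p s F g + C * sqrt (rate \<gamma> CARD('d) n)))"
proof -
  obtain c1 c2 c3 C K :: real where pos: "0 < c1" "0 < c2" "0 < c3" "0 < C" "0 < K" "K < 1"
    and main: "\<forall>n L p s F. \<forall>f \<in> holder_lip1 \<gamma> K :: (real ^ 'd \<Rightarrow> real) set.
       1 \<le> n \<and> 0 < s \<and> 1 \<le> F \<and> p 0 = CARD('d) \<and> p (Suc L) = 1 \<and>
       log 2 (real n) * log 2 (real (max (4 * CARD('d)) (4 * \<gamma>))) \<le> real L \<and>
       (\<forall>i\<in>{1..L}. c1 * (real n * rate \<gamma> CARD('d) n) \<le> real (p i)) \<and>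
       c2 * (ln (real n) * (real n * rate \<gamma> CARD('d) n)) \<le> s \<and> c3 * real L \<le> s
       \<longrightarrow> (\<exists>h \<in> critics L p s F. 1-lipschitz_on UNIV h \<and>
             (\<forall>x\<in>unit_cube. \<bar>f x - h x\<bar> \<le> C * sqrt (rate \<gamma> CARD('d) n)))"
    using holder_critic_approximation[OF assms, where 'd = 'd] by (elim exE conjE) (rule that)
  show ?thesis
  \<comment> \<open>The first claim holds with \<open>C\<close>; the second replaces
    \<open>f\<close> in two expectations, so \<open>2 * C\<close> serves both.\<close>
  proof (rule exI[of _ c1], rule conjI, rule pos(1), rule exI[of _ c2], rule conjI, rule pos(2),
      rule exI[of _ c3], rule conjI, rule pos(3), intro allI impI, rule exI[of _ "2 * C"], rule conjI,
      use pos(4) in simp, rule exI[of _ K], rule conjI, rule pos(5), rule conjI, rule pos(6), intro allI impI)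
    fix F :: real and n L :: nat and p :: "nat \<Rightarrow> nat" and s :: real
    let ?\<epsilon> = "C * sqrt (rate \<gamma> CARD('d) n)"
    assume F: "1 \<le> F" and h: "n \<ge> 1 \<and> s > 0 \<and> p 0 = CARD('d) \<and> p (Suc L) = 1 \<and>
       real L \<ge> log 2 (real n) * log 2 (real (max (4 * CARD('d)) (4 * \<gamma>))) \<and>
       (\<forall>i\<in>{1..L}. real (p i) \<ge> c1 * (real n * rate \<gamma> CARD('d) n)) \<and>
       s \<ge> c2 * (ln (real n) * (real n * rate \<gamma> CARD('d) n)) \<and>
       s \<ge> c3 * real L"
    have p: "p 0 = CARD('d)" "p (Suc L) = 1" using h by blast+
    have ap: "\<exists>h\<in>critics L p s F. 1-lipschitz_on UNIV h \<and> (\<forall>x\<in>unit_cube. \<bar>f x - h x\<bar> \<le> ?\<epsilon>)"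
      if "f \<in> (holder_lip1 \<gamma> K :: (real ^ 'd \<Rightarrow> real) set)" for f
      by (rule main[rule_format, OF that]) (use h F in \<open>intro conjI; simp\<close>)
    have "0 \<le> ?\<epsilon>" using pos(4) by (simp add: rate_def)
    then have le: "?\<epsilon> \<le> 2 * C * sqrt (rate \<gamma> CARD('d) n)" by simp
    have sup: "(SUP f\<in>holder_lip1 \<gamma> K :: (real ^ 'd \<Rightarrow> real) set. INF h\<in>critics L p s F.
          SUP x\<in>unit_cube. \<bar>f x - h x\<bar>) \<le> ?\<epsilon>"
    proof (rule sup_inf_error_le[OF p _ assms])
      show "\<exists>h\<in>critics L p s F. \<forall>x\<in>unit_cube. \<bar>f x - h x\<bar> \<le> ?\<epsilon>"
        if "f \<in> (holder_lip1 \<gamma> K :: (real ^ 'd \<Rightarrow> real) set)" for f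
        using ap[OF that] by blast
    qed (use pos(5) in simp)
    have dist: "W1_holder M X Z \<gamma> K g \<le> W1n M X Z L p s F g + 2 * C * sqrt (rate \<gamma> CARD('d) n)"
      if "prob_space M \<and>
          X \<in> borel_measurable M \<and> (\<forall>\<omega>\<in>space M. X \<omega> \<in> unit_cube) \<and>
          Z \<in> measurable M (vec_space dZ) \<and> (\<forall>\<omega>\<in>space M. \<forall>i<dZ. 0 \<le> Z \<omega> i \<and> Z \<omega> i \<le> 1) \<and>
          g \<in> borel_measurable (vec_space dZ) \<and> (\<forall>\<omega>\<in>space M. g (Z \<omega>) \<in> unit_cube)"
      for M :: "'w measure" and X :: "'w \<Rightarrow> real ^ 'd" and dZ and Z :: "'w \<Rightarrow> nat \<Rightarrow> real"
        and g :: "(nat \<Rightarrow> real) \<Rightarrow> real ^ 'd"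
    proof -
      have "(\<lambda>\<omega>. g (Z \<omega>)) \<in> borel_measurable M"
        using that by (auto intro: measurable_compose)
      then have "W1_holder M X Z \<gamma> K g \<le> W1n M X Z L p s F g + 2 * ?\<epsilon>"
        using that pos(5) by (intro W1_holder_le_W1n[OF p _ assms ap]) simp_all
      then show ?thesis by (simp only: mult.assoc)
    qed
    show "(SUP f\<in>holder_lip1 \<gamma> K :: (real ^ 'd \<Rightarrow> real) set. INF h\<in>critics L p s F.
          SUP x\<in>unit_cube. \<bar>f x - h x\<bar>) \<le> 2 * C * sqrt (rate \<gamma> CARD('d) n) \<and>
       (\<forall>(M :: 'w measure) (X :: 'w \<Rightarrow> real ^ 'd) (dZ::nat) (Z :: 'w \<Rightarrow> nat \<Rightarrow> real)
          (g :: (nat \<Rightarrow> real) \<Rightarrow> real ^ 'd).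
          prob_space M \<and>
          X \<in> borel_measurable M \<and> (\<forall>\<omega>\<in>space M. X \<omega> \<in> unit_cube) \<and>
          Z \<in> measurable M (vec_space dZ) \<and> (\<forall>\<omega>\<in>space M. \<forall>i<dZ. 0 \<le> Z \<omega> i \<and> Z \<omega> i \<le> 1) \<and>
          g \<in> borel_measurable (vec_space dZ) \<and> (\<forall>\<omega>\<in>space M. g (Z \<omega>) \<in> unit_cube)
          \<longrightarrow>
          W1_holder M X Z \<gamma> K g \<le> W1n M X Z L p s F g + 2 * C * sqrt (rate \<gamma> CARD('d) n))"
      using order_trans[OF sup le] dist by (intro conjI allI impI)
  qed
qed

end
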